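(* Let $c \in \mathbb{Z} \setminus \{0,-1\}$ with $|c| \le 10^9$, let $r = 1/c$ and $f_r(x) = x^2 + r \in \mathbb{Q}[x]$. For $n \ge 1$ let $k_n$ denote the number of irreducible factors over $\mathbb{Q}$ of the $n$-th iterate $f_r^n(x)$. Then $f_r$ is eventually stable over $\mathbb{Q}$, and $k_n \le 4$ for all $n \ge 1$. More precisely: (1) If $c = -m^2$ with $m > 0$ an integer, $m+1$ not the square of an integer, and $m \neq 4$, then $k_n = 2$ for all $n \ge 1$. (2) If $c = -16$, then $k_1 = k_2 = 2$ and $k_n = 3$ for all $n \ge 3$. (3) If $c = -(s^2-1)^2$ for an integer $s \ge 2$ with $s \notin \{3,5,56\}$, then $k_1 = 2$ and $k_n = 3$ for all $n \ge 2$. (4) If $c = -(s^2-1)^2$ for $s \in \{3,5,56\}$, then $k_1 = 2$, $k_2 = 3$, and $k_n = 4$ for all $n \ge 3$. (5) If $c = 4m^2(m^2-1)$ for an integer $m \ge 3$, then $k_1 = 1$ and $k_n = 2$ for all $n \ge 2$. (6) If $c = 48$, then $k_1 = 1$, $k_2 = 2$, and $k_n = 3$ for all $n \ge 3$. (7) If $c$ is in none of the cases (1)–(6), then $k_n = 1$ for all $n \ge 1$.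
   Context: For a field $K$ and $f \in K[x]$, $f^n$ denotes the $n$-fold composition of $f$ with itself ($f^0(x)=x$). $f$ is called eventually stable over $K$ if there is a constant $C$ such that the number of irreducible factors over $K$ of $f^n(x)$ is at most $C$ for all $n \ge 1$. *)

theory Defs
  imports
    "HOL-Computational_Algebra.Computational_Algebra"
    "HOL-Computational_Algebra.Field_as_Ring"
begin

definition poly_iter :: "nat \<Rightarrow> 'a::comm_semiring_1 poly \<Rightarrow> 'a poly" where
  "poly_iter n f = (pcompose f ^^ n) [:0, 1:]"

(* Factors are counted with multiplicity. The sort field_gcd (fields with the trivial gcd
   structure) only serves to make prime_factorization available on polynomials; over it,
   prime and irreducible polynomials coincide up to normalisation. *)
definition num_irreducible_factors :: "'a::field_gcd poly \<Rightarrow> nat" where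
  "num_irreducible_factors p = size (prime_factorization p)"

definition eventually_stable :: "'a::field_gcd poly \<Rightarrow> bool" where
  "eventually_stable f \<longleftrightarrow>
     (\<exists>C::nat. \<forall>n\<ge>1. num_irreducible_factors (poly_iter n f) \<le> C)"

definition quad :: "rat \<Rightarrow> rat poly" where
  "quad r = [:r, 0, 1:]"

definition k_fac :: "int \<Rightarrow> nat \<Rightarrow> nat" where
  "k_fac c n = num_irreducible_factors (poly_iter n (quad (1 / of_int c)))"

definition case1 :: "int \<Rightarrow> bool" where
  "case1 c \<longleftrightarrow>
     (\<exists>m::int. m > 0 \<and> \<not> (\<exists>t::int. m + 1 = t ^ 2) \<and> m \<noteq> 4 \<and> c = - (m ^ 2))"

definition case2 :: "int \<Rightarrow> bool" where
  "case2 c \<longleftrightarrow> c = -16"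

definition case3 :: "int \<Rightarrow> bool" where
  "case3 c \<longleftrightarrow> (\<exists>s::int. s \<ge> 2 \<and> s \<notin> {3, 5, 56} \<and> c = - ((s ^ 2 - 1) ^ 2))"

definition case4 :: "int \<Rightarrow> bool" where
  "case4 c \<longleftrightarrow> (\<exists>s::int. s \<in> {3, 5, 56} \<and> c = - ((s ^ 2 - 1) ^ 2))"

definition case5 :: "int \<Rightarrow> bool" where
  "case5 c \<longleftrightarrow> (\<exists>m::int. m \<ge> 3 \<and> c = 4 * m ^ 2 * (m ^ 2 - 1))"

definition case6 :: "int \<Rightarrow> bool" where
  "case6 c \<longleftrightarrow> c = 48"

end

theory Submission
  imports Defs "HOL-Number_Theory.Cong"
begin

text \<open>
  Write \<open>f = x\<^sup>2 + r\<close>. If \<open>g\<close> is irreducible but \<open>g \<circ> f\<close> is not, then \<open>\<alpha> - r\<close> is a square in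
  \<open>K(\<alpha>)\<close> for a root \<open>\<alpha>\<close> of \<open>g\<close>. Taking norms along the tower generated by \<open>f\<close> turns
  reducibility of \<open>g \<circ> f\<^sup>n\<^sup>+\<^sup>1\<close> into the statement that \<open>f\<^sup>n\<^sup>+\<^sup>1(0) - \<gamma>\<close> is a square in \<open>K(\<gamma>)\<close> for a root
  \<open>\<gamma>\<close> of \<open>g\<close>; for quadratic \<open>g\<close> this says that \<open>g(f\<^sup>n\<^sup>+\<^sup>1(0)) = w\<^sup>2\<close> and that a trace involving \<open>w\<close> is
  a square as well.

  For \<open>c > 0\<close> and \<open>g = f\<close> the two conditions give \<open>4 X\<^sup>2 (X\<^sup>2 - a) = c\<^sup>N\<close> with \<open>a\<close> coprime to \<open>c\<close> and
  \<open>N = 2\<^sup>n - 1\<close>. Hence \<open>c = t\<^sup>2 v\<close> where \<open>t\<^sup>2 / v\<close> is so close to a power of \<open>4\<close> with exponent \<open>\<plusminus>1/N\<close>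
  that each \<open>t\<close> leaves only a few values of \<open>v\<close>, and these violate congruences modulo \<open>t\<^sup>2\<close> and \<open>v\<close>.
  For \<open>c < 0\<close> not minus a square the critical orbit is negative. In the remaining families the
  first iterates split explicitly, and for every factor \<open>g\<close> and every parameter there is a prime modulo
  which the two conditions fail along the whole critical orbit, which is finite there.
\<close>

section \<open>Composition with a quadratic polynomial\<close>

text \<open>Norms alone do not decide reducibility: for c = b^2 - 1 with c > 0 the first norm
  condition for g = f always holds, yet f o f splits only if c = 4 m^2 (m^2 - 1). Only the trace
  condition sees the difference. For a linear g there is no trace to use, so a factor x + t/m is
  first composed with f and then treated as a quadratic. All n are handled at once because the
  critical orbit modulo a prime is eventually periodic. Even and odd indices get separate
  certificates, so that each may use its own prime. The bound on c makes the negative families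
  finite: m <= 31622 and s <= 177. For c > 0 one certificate for each c is out of reach, hence the
  exponential equation. There a is at most 2 c^((N-1)/2), which places t^2/v close to its limit, and
  a = 1 modulo c and modulo a growing power of 2. The latter forces 2^n to divide v + 1, or 2^(n-1)
  to divide t^2 - 1, and so bounds n.\<close>

lemma poly_even_odd_parts:
  fixes P :: "'a::comm_ring_1 poly"
  shows "\<exists>A B. P = A \<circ>\<^sub>p [:0,0,1:] + [:0,1:] * (B \<circ>\<^sub>p [:0,0,1:])"
proof (induction "degree P" arbitrary: P rule: less_induct)
  case less
  obtain a Q where P1: "P = pCons a Q" by (cases P)
  obtain b R where Q1: "Q = pCons b R" by (cases Q)
  show ?case
  proof (cases "P = 0 \<or> Q = 0")
    case True
    hence "P = [:a:] \<circ>\<^sub>p [:0,0,1:] + [:0,1:] * (0 \<circ>\<^sub>p [:0,0,1:])" using P1 by auto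
    thus ?thesis by blast
  next
    case False
    hence "degree R < degree P" using P1 Q1 by (auto simp: degree_pCons_eq_if)
    from less[OF this] obtain A B where R: "R = A \<circ>\<^sub>p [:0,0,1:] + [:0,1:] * (B \<circ>\<^sub>p [:0,0,1:])" by blast
    have "P = pCons a A \<circ>\<^sub>p [:0,0,1:] + [:0,1:] * (pCons b B \<circ>\<^sub>p [:0,0,1:])"
      by (simp add: P1 Q1 R pcompose_pCons algebra_simps)
    thus ?thesis by blast
  qed
qed

lemma pcompose_reflect_square:
  fixes A :: "'a::comm_ring_1 poly"
  shows "(A \<circ>\<^sub>p [:0,0,1:]) \<circ>\<^sub>p [:0,-1:] = A \<circ>\<^sub>p [:0,0,1:]"
  by (simp add: pcompose_assoc[symmetric] pcompose_pCons)

lemma pcompose_quad_reflect: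
  fixes A :: "'a::comm_ring_1 poly"
  shows "(A \<circ>\<^sub>p [:r,0,1:]) \<circ>\<^sub>p [:0,-1:] = A \<circ>\<^sub>p [:r,0,1:]"
  by (simp add: pcompose_assoc[symmetric] pcompose_pCons)

lemma pcompose_right_cancel_quad:
  fixes A B :: "'a::idom poly"
  assumes "A \<circ>\<^sub>p [:r,0,1:] = B \<circ>\<^sub>p [:r,0,1:]"
  shows "A = B"
proof -
  have "(A - B) \<circ>\<^sub>p [:r,0,1:] = 0" using assms by (simp add: pcompose_diff)
  hence "A - B = 0" by (rule pcompose_eq_0) simp
  thus ?thesis by simp
qed

text \<open>The odd part equals its own negative and vanishes in characteristic 0; a polynomial in
  x^2 is one in x^2 + r after a shift.\<close>

lemma even_poly_imp_pcompose_quad: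
  fixes F :: "'a::{idom,ring_char_0} poly"
  assumes "F \<circ>\<^sub>p [:0,-1:] = F"
  shows "\<exists>H. F = H \<circ>\<^sub>p [:r,0,1:]"
proof -
  obtain A B where F: "F = A \<circ>\<^sub>p [:0,0,1:] + [:0,1:] * (B \<circ>\<^sub>p [:0,0,1:])"
    using poly_even_odd_parts by blast
  let ?B = "B \<circ>\<^sub>p [:0,0,1:]"
  have "F = (A \<circ>\<^sub>p [:0,0,1:]) \<circ>\<^sub>p [:0,-1:] + ([:0,1:] \<circ>\<^sub>p [:0,-1:]) * (?B \<circ>\<^sub>p [:0,-1:])"
    using assms by (subst (asm) F) (simp only: pcompose_add pcompose_mult)
  hence "F = A \<circ>\<^sub>p [:0,0,1:] - [:0,1:] * ?B"
    by (simp add: pcompose_reflect_square pcompose_pCons)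
  hence "2 * ([:0,1:] * ?B) = 0" using F by (simp add: algebra_simps)
  hence "?B = 0" by (auto simp del: mult_pCons_left)
  hence "F = A \<circ>\<^sub>p [:0,0,1:]" using F by simp
  also have "\<dots> = (A \<circ>\<^sub>p [:-r,1:]) \<circ>\<^sub>p [:r,0,1:]"
    by (simp add: pcompose_assoc[symmetric] pcompose_pCons)
  finally show ?thesis by blast
qed

text \<open>The cofactor of two even polynomials is even, so it is itself a polynomial in x^2 + r,
  and x^2 + r can be cancelled.\<close>

lemma quad_pcompose_dvd_iff:
  fixes g H :: "'a::{field_gcd,field_char_0} poly"
  shows "g \<circ>\<^sub>p [:r,0,1:] dvd H \<circ>\<^sub>p [:r,0,1:] \<longleftrightarrow> g dvd H"
proof
  assume "g dvd H"
  then obtain k where "H = g * k" by (elim dvdE)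
  thus "g \<circ>\<^sub>p [:r,0,1:] dvd H \<circ>\<^sub>p [:r,0,1:]" by (simp add: pcompose_mult)
next
  let ?s = "[:r,0,1:]"
  assume "g \<circ>\<^sub>p ?s dvd H \<circ>\<^sub>p ?s"
  then obtain K where K: "H \<circ>\<^sub>p ?s = (g \<circ>\<^sub>p ?s) * K" by (elim dvdE)
  show "g dvd H"
  proof (cases "g = 0")
    case True
    hence "H \<circ>\<^sub>p ?s = 0" using K by simp
    hence "H = 0" by (rule pcompose_eq_0) simp
    thus ?thesis by simp
  next
    case False
    have ne: "g \<circ>\<^sub>p ?s \<noteq> 0" using False pcompose_eq_0[of g ?s] by auto
    have "(g \<circ>\<^sub>p ?s) * (K \<circ>\<^sub>p [:0,-1:]) = ((g \<circ>\<^sub>p ?s) * K) \<circ>\<^sub>p [:0,-1:]"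
      by (simp add: pcompose_mult pcompose_quad_reflect)
    also have "\<dots> = (g \<circ>\<^sub>p ?s) * K"
      by (simp only: K[symmetric] pcompose_quad_reflect)
    finally have "(g \<circ>\<^sub>p ?s) * (K \<circ>\<^sub>p [:0,-1:]) = (g \<circ>\<^sub>p ?s) * K" .
    hence "K \<circ>\<^sub>p [:0,-1:] = K" using ne by simp
    then obtain L where "K = L \<circ>\<^sub>p ?s" using even_poly_imp_pcompose_quad by blast
    hence "H \<circ>\<^sub>p ?s = (g * L) \<circ>\<^sub>p ?s" using K by (simp add: pcompose_mult)
    hence "H = g * L" by (rule pcompose_right_cancel_quad)
    thus ?thesis by simp
  qed
qed

lemma irreducible_reflect:
  fixes P :: "'a::{field_gcd,field_char_0} poly"
  assumes "irreducible P"
  shows "irreducible (P \<circ>\<^sub>p [:0,-1:])"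
proof (rule irreducibleI)
  have inv: "(Q \<circ>\<^sub>p [:0,-1:]) \<circ>\<^sub>p [:0,-1:] = Q" for Q :: "'a poly"
    by (simp add: pcompose_assoc[symmetric] pcompose_pCons pcompose_idR)
  have u: "Q \<circ>\<^sub>p [:0,-1:] dvd 1 \<longleftrightarrow> Q dvd 1" for Q :: "'a poly"
  proof -
    have d: "degree (Q \<circ>\<^sub>p [:0,-1:]) = degree Q" by (simp add: degree_pcompose)
    have z: "Q \<circ>\<^sub>p [:0,-1:] = 0 \<longleftrightarrow> Q = 0" using inv by (metis pcompose_0)
    show ?thesis using d z by (simp add: is_unit_iff_degree is_unit_poly_iff) (metis d degree_0 is_unit_iff_degree is_unit_poly_iff z)
  qed
  show "P \<circ>\<^sub>p [:0,-1:] \<noteq> 0" using assms inv by (metis irreducible_def pcompose_0)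
  show "\<not> P \<circ>\<^sub>p [:0,-1:] dvd 1" using assms u by (auto simp: irreducible_def)
  fix a b assume "P \<circ>\<^sub>p [:0,-1:] = a * b"
  hence "P = (a \<circ>\<^sub>p [:0,-1:]) * (b \<circ>\<^sub>p [:0,-1:])" using inv by (metis pcompose_mult)
  thus "a dvd 1 \<or> b dvd 1" using assms u by (metis irreducible_def)
qed

text \<open>A proper irreducible factor \<open>P\<close> of \<open>g(x\<^sup>2 + r)\<close> cannot be even, so \<open>P(x) P(-x)\<close> is an even
  divisor and hence the whole polynomial; splitting \<open>P\<close> into even and odd parts gives the norm form.\<close>
lemma reducible_pcompose_quad_norm_form:
  fixes g :: "'a::{field_gcd,field_char_0} poly"
  assumes g: "irreducible g" and red: "\<not> irreducible (g \<circ>\<^sub>p [:r,0,1:])"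
  obtains u A B where "u \<noteq> 0" "g = smult u (A^2 - [:-r,1:] * B^2)" "\<not> g dvd B"
proof -
  let ?s = "[:r,0,1:]"
  let ?F = "g \<circ>\<^sub>p ?s"
  have g0: "g \<noteq> 0" and gnu: "\<not> g dvd 1" using g by (auto simp: irreducible_def)
  have F0: "?F \<noteq> 0" using g0 pcompose_eq_0[of g ?s] by auto
  have "degree g > 0" using g0 gnu by (metis is_unit_iff_degree gr0I)
  hence dF: "degree ?F > 0" by (simp add: degree_pcompose)
  hence "\<not> ?F dvd 1" using F0 by (metis is_unit_iff_degree less_irrefl)
  then obtain P where P: "P dvd ?F" "prime_elem P"
    using F0 prime_divisor_exists by (metis prime_def)
  hence Pirr: "irreducible P" by (simp add: prime_elem_iff_irreducible)
  let ?P' = "P \<circ>\<^sub>p [:0,-1:]"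
  have P'irr: "irreducible ?P'" using Pirr by (rule irreducible_reflect)
  have P'F: "?P' dvd ?F"
  proof -
    obtain k where "?F = P * k" using P by (elim dvdE)
    hence "?F \<circ>\<^sub>p [:0,-1:] = ?P' * (k \<circ>\<^sub>p [:0,-1:])" by (simp add: pcompose_mult)
    thus ?thesis by (simp add: pcompose_quad_reflect)
  qed
  have notev: "?P' \<noteq> P"
  proof
    assume "?P' = P"
    then obtain H where H: "P = H \<circ>\<^sub>p ?s" using even_poly_imp_pcompose_quad by blast
    hence "H dvd g" using P quad_pcompose_dvd_iff by metis
    moreover have "\<not> H dvd 1" 
    proof
      assume "H dvd 1"
      hence "H \<circ>\<^sub>p ?s dvd 1 \<circ>\<^sub>p ?s" by (simp only: quad_pcompose_dvd_iff)
      hence "P dvd 1" using H by (simp add: pcompose_1)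
      thus False using Pirr by (auto simp: irreducible_def)
    qed
    ultimately have "g dvd H" using g by (metis irreducibleD')
    hence "?F dvd P" using H quad_pcompose_dvd_iff by metis
    hence "normalize ?F = normalize P" using P(1) by (metis associatedI)
    hence "prime_elem ?F" using P(2) by (metis prime_elem_normalize_iff)
    hence "irreducible ?F" by (simp add: prime_elem_iff_irreducible)
    thus False using red by simp
  qed
  have PP: "P * ?P' dvd ?F"
  proof (cases "P dvd ?P'")
    case False
    hence "coprime P ?P'" using Pirr by (metis coprime_commute prime_elem_imp_coprime P(2))
    thus ?thesis using P(1) P'F by (metis divides_mult)
  next
    case True
    then obtain k where k: "?P' = P * k" by (elim dvdE)
    have "degree ?P' = degree P" by (simp add: degree_pcompose)
    moreover have "P \<noteq> 0" "k \<noteq> 0" using Pirr P'irr k by auto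
    ultimately have "degree k = 0" using k degree_mult_eq[of P k] by simp
    then obtain c where c: "k = [:c:]" by (metis degree_eq_zeroE)
    hence Pc: "?P' = smult c P" using k by simp
    have "P = ?P' \<circ>\<^sub>p [:0,-1:]" by (simp add: pcompose_assoc[symmetric] pcompose_pCons pcompose_idR)
    also have "\<dots> = smult c ?P'" using Pc by (simp add: pcompose_smult)
    also have "\<dots> = smult (c * c) P" using Pc by simp
    finally have "smult (c * c - 1) P = 0" by (simp add: smult_diff_left)
    hence "(c - 1) * (c + 1) = 0" using \<open>P \<noteq> 0\<close> by (simp add: algebra_simps)
    hence "c = 1 \<or> c = -1" by (simp add: eq_neg_iff_add_eq_0)
    \<comment> \<open>The remaining case P(-x) = -P(x) forces P to be x up to a unit. Then g(r) = 0,
      so x - r divides g and x^2 divides g(x^2 + r).\<close>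
    hence odd: "?P' = - P" using Pc notev by auto
    have "poly P 0 = poly ?P' 0" by (simp add: poly_pcompose)
    hence "poly P 0 = 0" using odd by simp
    hence xP: "[:0,1:] dvd P" using poly_eq_0_iff_dvd[of P 0] by simp
    hence "[:0,1:] dvd ?F" using P(1) dvd_trans by blast
    hence "poly ?F 0 = 0" using poly_eq_0_iff_dvd[of ?F 0] by simp
    hence "poly g r = 0" by (simp add: poly_pcompose)
    hence "[:-r,1:] dvd g" by (simp add: poly_eq_0_iff_dvd)
    hence "[:-r,1:] \<circ>\<^sub>p ?s dvd ?F" by (simp only: quad_pcompose_dvd_iff)
    hence d: "[:0,0,1:] dvd ?F" by (simp add: pcompose_pCons)
    have "irreducible [:0,1::'a:]" by (rule irreducible_linear_field_poly) simp
    hence "P dvd [:0,1:]" using xP Pirr by (metis irreducibleD' irreducible_def)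
    hence "?P' dvd [:0,1:]" using odd by simp
    hence "P * ?P' dvd [:0,1:] * [:0,1:]" using \<open>P dvd [:0,1:]\<close> by (metis mult_dvd_mono)
    also have "[:0,1:] * [:0,1:] = [:0,0,1::'a:]" by simp
    finally show ?thesis using d by (rule dvd_trans)
  qed
  obtain A B where AB: "P = A \<circ>\<^sub>p [:0,0,1:] + [:0,1:] * (B \<circ>\<^sub>p [:0,0,1:])"
    using poly_even_odd_parts by blast
  define A1 where "A1 = A \<circ>\<^sub>p [:-r,1:]"
  define B1 where "B1 = B \<circ>\<^sub>p [:-r,1:]"
  let ?N = "A1^2 - [:-r,1:] * B1^2"
  have A1: "A1 \<circ>\<^sub>p ?s = A \<circ>\<^sub>p [:0,0,1:]" and B1: "B1 \<circ>\<^sub>p ?s = B \<circ>\<^sub>p [:0,0,1:]"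
    by (simp_all add: A1_def B1_def pcompose_assoc[symmetric] pcompose_pCons)
  have "P * ?P' = (A \<circ>\<^sub>p [:0,0,1:])^2 - [:0,1:]^2 * (B \<circ>\<^sub>p [:0,0,1:])^2"
    by (simp add: AB pcompose_add pcompose_mult pcompose_reflect_square pcompose_pCons power2_eq_square algebra_simps)
  also have "[:0,1::'a:]^2 = [:-r,1:] \<circ>\<^sub>p ?s" by (simp add: pcompose_pCons power2_eq_square)
  finally have N: "P * ?P' = ?N \<circ>\<^sub>p ?s"
    by (simp only: A1[symmetric] B1[symmetric] power2_eq_square pcompose_mult pcompose_diff)
  have "?N dvd g" using PP N quad_pcompose_dvd_iff by metis
  moreover have "\<not> ?N dvd 1"
  proof
    assume "?N dvd 1"
    hence "?N \<circ>\<^sub>p ?s dvd 1 \<circ>\<^sub>p ?s" by (simp only: quad_pcompose_dvd_iff)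
    hence "P * ?P' dvd 1" using N by (simp add: pcompose_1)
    hence "P dvd 1" by (metis dvd_mult_left)
    thus False using Pirr by (auto simp: irreducible_def)
  qed
  ultimately have gN: "g dvd ?N" using g by (metis irreducibleD')
  obtain k where k: "g = ?N * k" using \<open>?N dvd g\<close> by (elim dvdE)
  have "k dvd 1" using k g \<open>\<not> ?N dvd 1\<close> by (metis irreducibleD)
  then obtain u where u: "k = [:u:]" "u \<noteq> 0" by (auto simp: is_unit_poly_iff dvd_field_iff)
  have gu: "g = smult u ?N" using k u by (simp add: mult.commute[of ?N])
  \<comment> \<open>Otherwise g divides A as well, and g^2 divides the norm form, an associate of g.
    This is what later makes B invertible modulo g.\<close>
  have "\<not> g dvd B1"
  proof
    assume gB: "g dvd B1"
    hence "g dvd ?N + [:-r,1:] * B1^2" using gN by (metis dvd_add dvd_mult dvd_power_same dvd_trans dvd_power power2_eq_square dvd_mult2)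
    hence "g dvd A1^2" by simp
    hence "g dvd A1" using g by (metis prime_elem_iff_irreducible prime_elem_dvd_power)
    hence "g^2 dvd A1^2" "g^2 dvd B1^2" using gB by (simp_all add: dvd_power_same)
    hence "g^2 dvd ?N" by (metis dvd_diff dvd_mult)
    hence "g^2 dvd g" using \<open>?N dvd g\<close> dvd_trans by blast
    hence "g * g dvd g * 1" by (simp add: power2_eq_square)
    hence "g dvd 1" using g0 by (simp only: dvd_mult_cancel_left) simp
    thus False using gnu by simp
  qed
  thus thesis using that gu u by blast
qed

text \<open>Evaluating the norm form at r leaves g(r) = u A(r)^2. One of A^2 and (x - r) B^2 has
  even degree and the other odd degree; the larger one supplies the leading coefficient 1 of g and
  shows that u is a square or minus a square, according to the parity of the degree.\<close>

lemma reducible_pcompose_quad_imp_square: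
  fixes g :: "'a::{field_gcd,field_char_0} poly"
  assumes g: "irreducible g" and lc: "lead_coeff g = 1" and red: "\<not> irreducible (g \<circ>\<^sub>p [:r,0,1:])"
  shows "\<exists>q. (-1) ^ degree g * poly g r = q^2"
proof -
  obtain u A B where u: "u \<noteq> 0" and gu: "g = smult u (A^2 - [:-r,1:] * B^2)" and B: "\<not> g dvd B"
    using reducible_pcompose_quad_norm_form[OF g red] by blast
  define C where "C = [:-r,1:] * B^2"
  have gu: "g = smult u (A^2 - C)" using gu by (simp only: C_def)
  have B0: "B \<noteq> 0" using B by auto
  have dC: "degree C = Suc (2 * degree B)" using B0 by (simp add: C_def degree_mult_eq degree_power_eq del: mult_pCons_left)
  have lcC: "lead_coeff C = (lead_coeff B)^2" by (simp only: C_def lead_coeff_mult lead_coeff_power) simp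
  have val: "poly g r = u * (poly A r)^2" by (simp add: gu C_def)
  show ?thesis
  proof (cases "degree (A^2) < degree C")
    case True
    have lt: "degree (A^2) < degree (- C)" using True by (simp only: degree_minus)
    have "degree (A^2 + - C) = degree (- C)" using lt by (rule degree_add_eq_right)
    hence d: "degree g = Suc (2 * degree B)" using u dC by (simp add: gu)
    have "lead_coeff (A^2 + - C) = lead_coeff (- C)" using lt by (rule lead_coeff_add_le)
    hence "lead_coeff g = - (u * (lead_coeff B)^2)" using lcC by (simp add: gu lead_coeff_minus)
    hence "u * (lead_coeff B)^2 = -1" using lc by (metis minus_minus)
    hence "u = - ((1 / lead_coeff B)^2)" using B0 by (simp add: field_simps power2_eq_square)
    hence "(-1) ^ degree g * poly g r = (poly A r / lead_coeff B)^2"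
      by (simp add: d val power_divide)
    thus ?thesis by blast
  next
    case False
    have A0: "A \<noteq> 0" using False dC by auto
    have dA: "degree (A^2) = 2 * degree A" using A0 by (simp add: degree_power_eq)
    hence lt: "degree (- C) < degree (A^2)" using False dC unfolding degree_minus by presburger
    have "degree (A^2 + - C) = degree (A^2)" using lt by (rule degree_add_eq_left)
    hence d: "degree g = 2 * degree A" using u dA by (simp add: gu)
    have "lead_coeff (- C + A^2) = lead_coeff (A^2)" using lt by (rule lead_coeff_add_le)
    hence "lead_coeff g = u * (lead_coeff A)^2" by (simp add: gu lead_coeff_power)
    hence "u = (1 / lead_coeff A)^2" using A0 lc by (simp add: field_simps power2_eq_square)
    hence "(-1) ^ degree g * poly g r = (poly A r / lead_coeff A)^2"
      by (simp add: d val power_divide)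
    thus ?thesis by blast
  qed
qed

text \<open>With \<beta>^2 + r = \<gamma>, the norm of e (t - \<beta>) from K(\<beta>) to
  K(\<gamma>) is t^2 - \<beta>^2 = t^2 + r - \<gamma>: the sign e drops out and t moves one step
  along its orbit under f.\<close>

lemma norm_descent:
  fixes g :: "'a::{field_gcd,field_char_0} poly"
  assumes irr: "irreducible (g \<circ>\<^sub>p [:r,0,1:])" and e: "e^2 = 1"
    and dvd: "g \<circ>\<^sub>p [:r,0,1:] dvd A^2 - [:e*t,-e:] * B^2" and B: "\<not> g \<circ>\<^sub>p [:r,0,1:] dvd B"
  shows "\<exists>A' B'. g dvd A'^2 - [:t^2 + r,-1:] * B'^2 \<and> \<not> g dvd B'"
proof -
  let ?s = "[:r,0,1:]" and ?m = "[:0,-1::'a:]"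
  let ?h = "g \<circ>\<^sub>p ?s" and ?l = "[:e*t,-e:]"
  have inv: "(Q \<circ>\<^sub>p ?m) \<circ>\<^sub>p ?m = Q" for Q :: "'a poly"
    by (simp add: pcompose_assoc[symmetric] pcompose_pCons pcompose_idR)
  have ev: "\<exists>Q'. Q * (Q \<circ>\<^sub>p ?m) = Q' \<circ>\<^sub>p ?s" for Q :: "'a poly"
    by (rule even_poly_imp_pcompose_quad) (simp add: pcompose_mult inv mult.commute)
  obtain A' where A': "A * (A \<circ>\<^sub>p ?m) = A' \<circ>\<^sub>p ?s" using ev by blast
  obtain B' where B': "B * (B \<circ>\<^sub>p ?m) = B' \<circ>\<^sub>p ?s" using ev by blast
  have refl_dvd: "?h dvd Q \<circ>\<^sub>p ?m" if hQ: "?h dvd Q" for Q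
  proof -
    obtain k where "Q = ?h * k" using hQ by (elim dvdE)
    hence "Q \<circ>\<^sub>p ?m = ?h * (k \<circ>\<^sub>p ?m)" by (simp add: pcompose_mult pcompose_quad_reflect)
    thus ?thesis by simp
  qed
  let ?N = "A^2 - ?l * B^2"
  have N': "?N \<circ>\<^sub>p ?m = (A \<circ>\<^sub>p ?m)^2 - (?l \<circ>\<^sub>p ?m) * (B \<circ>\<^sub>p ?m)^2"
    by (simp only: pcompose_diff pcompose_mult power2_eq_square)
  have ll: "?l * (?l \<circ>\<^sub>p ?m) = [:t^2 + r,-1:] \<circ>\<^sub>p ?s"
    using e by (simp add: pcompose_pCons power2_eq_square algebra_simps)
  \<comment> \<open>The congruence A^2 = l B^2 modulo h is multiplied by its image under x -> -x;
    the products of conjugates are even and descend to g.\<close>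
  have "?h dvd ?N * (A \<circ>\<^sub>p ?m)^2 + ?l * B^2 * (?N \<circ>\<^sub>p ?m)"
    using dvd refl_dvd[OF dvd] by (intro dvd_add dvd_mult dvd_mult2)
  also have "?N * (A \<circ>\<^sub>p ?m)^2 + ?l * B^2 * (?N \<circ>\<^sub>p ?m)
      = (A * (A \<circ>\<^sub>p ?m))^2 - (?l * (?l \<circ>\<^sub>p ?m)) * (B * (B \<circ>\<^sub>p ?m))^2"
    unfolding N' by algebra
  also have "\<dots> = (A'^2 - [:t^2 + r,-1:] * B'^2) \<circ>\<^sub>p ?s"
    unfolding ll A' B' by (simp only: pcompose_diff pcompose_mult power2_eq_square)
  finally have 1: "g dvd A'^2 - [:t^2 + r,-1:] * B'^2" by (simp only: quad_pcompose_dvd_iff)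
  have "\<not> g dvd B'"
  proof
    assume "g dvd B'"
    hence "?h dvd B * (B \<circ>\<^sub>p ?m)" unfolding B' by (simp only: quad_pcompose_dvd_iff)
    moreover have "prime_elem ?h" using irr by (simp add: prime_elem_iff_irreducible)
    ultimately have "?h dvd B \<circ>\<^sub>p ?m" using B by (metis prime_elem_dvd_mult_iff)
    hence "?h dvd B" using refl_dvd inv by metis
    thus False using B by simp
  qed
  with 1 show ?thesis by blast
qed

section \<open>Iterates, the critical orbit and the irreducibility criteria\<close>

lemma poly_iter_0 [simp]: "poly_iter 0 f = [:0,1:]"
  by (simp add: poly_iter_def)

lemma poly_iter_Suc: "poly_iter (Suc n) f = f \<circ>\<^sub>p poly_iter n f"
  by (simp add: poly_iter_def)

lemma poly_iter_Suc2: "poly_iter (Suc n) f = poly_iter n f \<circ>\<^sub>p f"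
  by (induction n) (simp_all add: poly_iter_Suc pcompose_idR pcompose_pCons pcompose_assoc)

primrec crit_orbit :: "'a::comm_semiring_1 \<Rightarrow> nat \<Rightarrow> 'a" where
  "crit_orbit r 0 = 0"
| "crit_orbit r (Suc n) = (crit_orbit r n)^2 + r"

lemma poly_iter_crit_orbit:
  "poly (poly_iter n [:r,0,1:]) (crit_orbit r k) = crit_orbit r (n + k)"
  by (induction n) (simp_all add: poly_iter_Suc poly_pcompose power2_eq_square algebra_simps)

lemma lead_coeff_pcompose_poly_iter_quad:
  fixes g :: "'a::idom poly"
  assumes "lead_coeff g = 1"
  shows "lead_coeff (g \<circ>\<^sub>p poly_iter n [:r,0,1:]) = 1" "degree (g \<circ>\<^sub>p poly_iter n [:r,0,1:]) = 2^n * degree g"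
proof -
  have d: "degree (poly_iter n [:r,0,1::'a:]) = 2^n" for n by (induction n) (simp_all add: poly_iter_Suc degree_pcompose)
  have l: "lead_coeff (poly_iter n [:r,0,1:]) = 1"
  proof (induction n)
    case (Suc n)
    thus ?case unfolding poly_iter_Suc by (subst lead_coeff_comp) (use d[of n] in simp_all)
  qed simp
  show "lead_coeff (g \<circ>\<^sub>p poly_iter n [:r,0,1:]) = 1"
    using lead_coeff_comp[of "poly_iter n [:r,0,1:]" g] l by (simp add: assms d)
  show "degree (g \<circ>\<^sub>p poly_iter n [:r,0,1:]) = 2^n * degree g" by (simp add: degree_pcompose d)
qed

text \<open>The value of g o f^n at r is g(f^(n+1)(0)). The sign matters only for n = 0, since all
  later degrees are even.\<close>

theorem irreducible_iterates:
  fixes g :: "'a::{field_gcd,field_char_0} poly"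
  assumes g: "irreducible g" and lc: "lead_coeff g = 1"
    and first: "\<nexists>q. (-1) ^ degree g * poly g r = q^2"
    and later: "\<And>n. n \<ge> 2 \<Longrightarrow> \<nexists>q. poly g (crit_orbit r n) = q^2"
  shows "irreducible (g \<circ>\<^sub>p poly_iter n [:r,0,1:])"
proof (induction n)
  case 0
  show ?case using g by (simp add: pcompose_idR)
next
  case (Suc n)
  let ?h = "g \<circ>\<^sub>p poly_iter n [:r,0,1:]"
  have r: "crit_orbit r 1 = r" by simp
  have "poly ?h r = poly g (crit_orbit r (Suc n))"
    using poly_iter_crit_orbit[of n r 1] by (simp add: poly_pcompose)
  moreover have "\<nexists>q. (-1) ^ degree ?h * poly g (crit_orbit r (Suc n)) = q^2"
  proof (cases n)
    case 0 thus ?thesis using first by (simp add: pcompose_idR)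
  next
    case (Suc m)
    hence "even (degree ?h)" by (simp add: lead_coeff_pcompose_poly_iter_quad[OF lc])
    thus ?thesis using later[of "Suc n"] Suc by simp
  qed
  ultimately have "irreducible (?h \<circ>\<^sub>p [:r,0,1:])"
    using reducible_pcompose_quad_imp_square[OF Suc lead_coeff_pcompose_poly_iter_quad(1)[OF lc], where r = r]
    by metis
  thus ?case by (simp add: poly_iter_Suc2 pcompose_assoc)
qed

text \<open>Each descent replaces t = f^k(0) by f^(k+1)(0). After the first one the sign is 1, so e
  is absent from the conclusion.\<close>

lemma norm_descent_iterates:
  fixes g :: "'a::{field_gcd,field_char_0} poly"
  assumes "\<And>m. m \<le> Suc n \<Longrightarrow> irreducible (g \<circ>\<^sub>p poly_iter m [:r,0,1:])" and "e^2 = 1"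
    and "g \<circ>\<^sub>p poly_iter (Suc n) [:r,0,1:] dvd A^2 - [:e*crit_orbit r k,-e:] * B^2"
    and "\<not> g \<circ>\<^sub>p poly_iter (Suc n) [:r,0,1:] dvd B"
  shows "\<exists>A' B'. g dvd A'^2 - [:crit_orbit r (Suc n + k),-1:] * B'^2 \<and> \<not> g dvd B'"
  using assms
proof (induction n arbitrary: A B e k)
  case 0
  have i: "poly_iter (Suc 0) [:r,0,1:] = [:r,0,1:]" by (simp add: poly_iter_Suc2 pcompose_pCons)
  have "\<exists>A' B'. g dvd A'^2 - [:(crit_orbit r k)^2 + r,-1:] * B'^2 \<and> \<not> g dvd B'"
    by (rule norm_descent[where A = A and B = B])
      (use 0(1)[of 1] 0(2-4) in \<open>simp_all only: i order_refl One_nat_def not_False_eq_True\<close>)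
  thus ?case by simp
next
  case (Suc n)
  let ?h = "g \<circ>\<^sub>p poly_iter (Suc n) [:r,0,1:]"
  have i: "g \<circ>\<^sub>p poly_iter (Suc (Suc n)) [:r,0,1:] = ?h \<circ>\<^sub>p [:r,0,1:]"
    by (simp only: poly_iter_Suc2 pcompose_assoc)
  have "\<exists>A' B'. ?h dvd A'^2 - [:(crit_orbit r k)^2 + r,-1:] * B'^2 \<and> \<not> ?h dvd B'"
    by (rule norm_descent[where A = A and B = B])
      (use Suc.prems(1)[of "Suc (Suc n)"] Suc.prems(2-4) in \<open>simp_all only: i order_refl not_False_eq_True\<close>)
  then obtain A' B' where 1: "?h dvd A'^2 - [:(crit_orbit r k)^2 + r,-1:] * B'^2" "\<not> ?h dvd B'" by blast
  have "\<exists>A' B'. g dvd A'^2 - [:crit_orbit r (Suc n + Suc k),-1:] * B'^2 \<and> \<not> g dvd B'"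
    by (rule Suc.IH[of 1 A' "Suc k" B']) (use Suc.prems(1) 1 in simp_all)
  thus ?case by simp
qed

text \<open>If \<open>\<gamma>\<close> is a root of the quadratic and \<open>\<rho>\<^sup>2 = e (t - \<gamma>)\<close> in \<open>K(\<gamma>)\<close>, then \<open>w\<close> below is the norm
  and \<open>y\<close> the trace of \<open>\<rho>\<close>.\<close>
lemma quadratic_norm_form_imp_norm_trace:
  fixes q :: "'a::{field_gcd,field_char_0}"
  assumes irr: "irreducible [:q,b,1:]" and e: "e^2 = 1"
    and dvd: "[:q,b,1:] dvd A^2 - [:e*t,-e:] * B^2" and B: "\<not> [:q,b,1:] dvd B"
  shows "\<exists>w y. w^2 = t^2 + b*t + q \<and> y^2 = e * (2*t + b) + 2*w"
proof -
  let ?g = "[:q,b,1:]"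
  have "coprime B ?g" using irr B by (metis coprime_commute prime_elem_imp_coprime prime_elem_iff_irreducible)
  then obtain u v where uv: "u * B + v * ?g = 1" by (metis bezout_coefficients_fst_snd coprime_iff_gcd_eq_1)
  \<comment> \<open>\<open>u\<close> inverts B modulo g, so \<open>R\<close> represents \<rho> = A/B
    in K[x]/(g), of the form \<alpha> + \<beta> x.\<close>
  define R where "R = (u * A) mod ?g"
  have "degree R < 2 \<or> R = 0" unfolding R_def using degree_mod_less[of ?g "u * A"] by auto
  then obtain \<alpha> \<beta> where R: "R = [:\<alpha>,\<beta>:]" 
    by (metis One_nat_def degree1_coeffs degree_0 less_2_cases degree_eq_zeroE pCons_0_0)
  have "?g dvd u * A - R" unfolding R_def by (metis dvd_minus_mod)
  then obtain k where k: "u * A = R + ?g * k" by (metis add.commute diff_eq_eq dvdE)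
  have "?g dvd u^2 * (A^2 - [:e*t,-e:] * B^2)" using dvd by simp
  also have "u^2 * (A^2 - [:e*t,-e:] * B^2) = (u*A)^2 - [:e*t,-e:] * (u*B)^2" by algebra
  also have "u * B = 1 - v * ?g" using uv by (metis add_diff_cancel_right')
  also have "(u*A)^2 - [:e*t,-e:] * (1 - v * ?g)^2
     = R^2 - [:e*t,-e:] + ?g * (2 * R * k + ?g * k^2 + [:e*t,-e:] * (2 * v - v^2 * ?g))"
    unfolding k by algebra
  finally have "?g dvd R^2 - [:e*t,-e:]" by (metis dvd_add_times_triv_right_iff mult.commute)
  moreover have "R^2 - [:e*t,-e:] = [:\<alpha>^2 - \<beta>^2 * q - e*t, 2*\<alpha>*\<beta> - b*\<beta>^2 + e:] + ?g * [:\<beta>^2:]"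
    by (simp add: R power2_eq_square algebra_simps)
  ultimately have d: "?g dvd [:\<alpha>^2 - \<beta>^2 * q - e*t, 2*\<alpha>*\<beta> - b*\<beta>^2 + e:]" 
    by (metis dvd_add_times_triv_right_iff mult.commute)
  have "[:\<alpha>^2 - \<beta>^2 * q - e*t, 2*\<alpha>*\<beta> - b*\<beta>^2 + e:] = 0" (is "?L = 0")
  proof (rule ccontr)
    assume "?L \<noteq> 0"
    hence "degree ?g \<le> degree ?L" using d by (rule dvd_imp_degree_le[rotated])
    also have "\<dots> \<le> 1" by (rule degree_pCons_le[THEN order_trans]) simp
    finally show False by simp
  qed
  hence 1: "\<alpha>^2 - \<beta>^2 * q - e*t = 0" and 2: "2*\<alpha>*\<beta> - b*\<beta>^2 + e = 0"
    by (simp_all only: pCons_eq_0_iff)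
  \<comment> \<open>Norm of \<alpha> + \<beta> \<gamma>, where \<gamma> has trace -b and norm q. The
    identity after it is Tr(\<rho>)^2 = Tr(\<rho>^2) + 2 N(\<rho>).\<close>
  have "(\<alpha>^2 - \<alpha>*\<beta>*b + \<beta>^2*q)^2 = t^2 + b*t + q"
    using 1 2 e by algebra
  moreover have "(2*\<alpha> - b*\<beta>)^2 = e * (2*t + b) + 2 * (\<alpha>^2 - \<alpha>*\<beta>*b + \<beta>^2*q)"
    using 1 2 by algebra
  ultimately show ?thesis by blast
qed

text \<open>Strong induction, because the descent from g o f^m to g passes through all levels in
  between and needs each of them irreducible. The element \<alpha> - r is e (t - \<alpha>) with e =
  -1 and t = f(0); this sign survives only if no descent takes place, whence the separate condition
  \<open>first\<close>.\<close>

theorem irreducible_iterates_quadratic: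
  fixes q :: "'a::{field_gcd,field_char_0}"
  assumes irr: "irreducible [:q,b,1:]"
    and first: "\<nexists>w y. w^2 = r^2 + b*r + q \<and> y^2 = - (2*r + b) + 2*w"
    and later: "\<And>n z. n \<ge> 2 \<Longrightarrow> z = crit_orbit r n \<Longrightarrow> \<nexists>w y. w^2 = z^2 + b*z + q \<and> y^2 = 2*z + b + 2*w"
  shows "irreducible ([:q,b,1:] \<circ>\<^sub>p poly_iter n [:r,0,1:])"
proof (induction n rule: less_induct)
  case (less n)
  let ?g = "[:q,b,1:]"
  show ?case
  proof (cases n)
    case 0 thus ?thesis using irr by (simp add: pcompose_idR)
  next
    case (Suc m)
    let ?h = "?g \<circ>\<^sub>p poly_iter m [:r,0,1:]"
    have irrh: "irreducible ?h" using less Suc by simp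
    have hr: "?g \<circ>\<^sub>p poly_iter n [:r,0,1:] = ?h \<circ>\<^sub>p [:r,0,1:]"
      unfolding Suc by (simp only: poly_iter_Suc2 pcompose_assoc)
    show ?thesis
    proof (rule ccontr)
      assume "\<not> ?thesis"
      then obtain u A B where "u \<noteq> 0" and u: "?h = smult u (A^2 - [:-r,1:] * B^2)" and B: "\<not> ?h dvd B"
        using reducible_pcompose_quad_norm_form[OF irrh] unfolding hr by blast
      have l: "[:-1 * crit_orbit r 1, - (- 1)::'a:] = [:-r,1:]" by simp
      have "A^2 - [:-r,1:] * B^2 = smult (1/u) ?h" using \<open>u \<noteq> 0\<close> by (subst u) simp
      hence dvd: "?h dvd A^2 - [:-1 * crit_orbit r 1, - (- 1):] * B^2" unfolding l by (simp add: dvd_smult)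
      show False
      proof (cases m)
        case 0
        have "\<exists>w y. w^2 = (crit_orbit r 1)^2 + b * crit_orbit r 1 + q \<and> y^2 = -1 * (2 * crit_orbit r 1 + b) + 2*w"
          by (rule quadratic_norm_form_imp_norm_trace[OF irr _ _, of _ A _ B]) (use dvd B 0 in \<open>simp_all add: pcompose_idR\<close>)
        thus False using first by simp
      next
        case (Suc j)
        have "\<exists>A' B'. ?g dvd A'^2 - [:crit_orbit r (Suc j + 1),-1:] * B'^2 \<and> \<not> ?g dvd B'"
          by (rule norm_descent_iterates[of j ?g r "-1" A 1 B]) (use dvd B Suc \<open>n = Suc m\<close> less in simp_all)
        then obtain A' B' where "?g dvd A'^2 - [:1 * crit_orbit r (Suc j + 1),-1:] * B'^2" "\<not> ?g dvd B'" by auto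
        hence "\<exists>w y. w^2 = (crit_orbit r (Suc j + 1))^2 + b * crit_orbit r (Suc j + 1) + q
            \<and> y^2 = 1 * (2 * crit_orbit r (Suc j + 1) + b) + 2*w"
          by (intro quadratic_norm_form_imp_norm_trace[OF irr]) simp_all
        thus False using later[of "Suc j + 1", OF _ refl] by simp
      qed
    qed
  qed
qed

lemma irreducible_quadratic_field:
  fixes q :: "'a::field"
  assumes "\<And>x. x^2 + b*x + q \<noteq> 0"
  shows "irreducible [:q,b,1:]"
proof (rule irreducibleI)
  have lin: False if uv: "[:q,b,1:] = u * v" and du: "degree u = 1" for u v
  proof -
    obtain c d where u: "u = [:c,d:]" "d \<noteq> 0" using du by (metis degree1_coeffs)
    have "poly [:q,b,1:] (- c / d) = 0" unfolding uv using u by simp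
    thus False using assms[of "- c / d"] by (simp add: power2_eq_square algebra_simps)
  qed
  fix u v assume uv: "[:q,b,1:] = u * v"
  hence "u \<noteq> 0" "v \<noteq> 0" by auto
  moreover have "degree (u * v) = 2" unfolding uv[symmetric] by simp
  ultimately have "degree u + degree v = 2" by (simp add: degree_mult_eq)
  moreover have "degree u \<noteq> 1" using lin uv by blast
  moreover have "degree v \<noteq> 1" using lin[of v u] uv by (auto simp: mult.commute)
  ultimately have "degree u = 0 \<or> degree v = 0" by arith
  thus "u dvd 1 \<or> v dvd 1" using \<open>u \<noteq> 0\<close> \<open>v \<noteq> 0\<close> by (auto simp: is_unit_iff_degree)
qed (auto simp: is_unit_pCons_iff)

section \<open>Counting irreducible factors of products\<close>

lemma num_irreducible_factors_mult:
  fixes p q :: "'a::field_gcd poly"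
  assumes "p \<noteq> 0" "q \<noteq> 0"
  shows "num_irreducible_factors (p * q) = num_irreducible_factors p + num_irreducible_factors q"
  using assms by (simp add: num_irreducible_factors_def prime_factorization_mult)

lemma num_irreducible_factors_irreducible:
  fixes p :: "'a::field_gcd poly"
  assumes "irreducible p"
  shows "num_irreducible_factors p = 1"
proof -
  have "prime (normalize p)" using assms by (simp add: prime_elem_iff_irreducible[symmetric])
  hence "prime_factorization p = {#normalize p#}"
    by (metis prime_factorization_prime prime_factorization_normalize)
  thus ?thesis by (simp add: num_irreducible_factors_def)
qed

section \<open>Certificates modulo primes\<close>

definition rat_cong :: "int \<Rightarrow> rat \<Rightarrow> int \<Rightarrow> bool" where
  "rat_cong p x i \<longleftrightarrow> (\<exists>a b. x * of_int b = of_int a \<and> coprime b p \<and> b \<noteq> 0 \<and> [a = i * b] (mod p))"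

lemma rat_cong_of_int [intro]: "rat_cong p (of_int i) i"
  unfolding rat_cong_def by (rule exI[of _ i], rule exI[of _ 1]) simp

lemma rat_cong_cong:
  assumes "rat_cong p x i" "[i = j] (mod p)"
  shows "rat_cong p x j"
  using assms unfolding rat_cong_def by (meson cong_scalar_right cong_trans)

lemma rat_cong_mod: "rat_cong p x i \<Longrightarrow> rat_cong p x (i mod p)"
  by (erule rat_cong_cong) simp

lemma rat_cong_mult:
  assumes "rat_cong p x i" "rat_cong p y j"
  shows "rat_cong p (x * y) (i * j)"
proof -
  from assms obtain a b c d where "x * of_int b = of_int a" "coprime b p" "b \<noteq> 0" "[a = i * b] (mod p)"
    "y * of_int d = of_int c" "coprime d p" "d \<noteq> 0" "[c = j * d] (mod p)"
    unfolding rat_cong_def by blast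
  moreover from this have "x * y * of_int (b * d) = of_int (a * c)"
    by (simp add: algebra_simps)
  moreover have "[a * c = i * b * (j * d)] (mod p)" by (intro cong_mult) fact+
  ultimately show ?thesis unfolding rat_cong_def
    by (intro exI[of _ "a * c"] exI[of _ "b * d"]) (simp add: mult_ac)
qed

lemma rat_cong_add:
  assumes "rat_cong p x i" "rat_cong p y j"
  shows "rat_cong p (x + y) (i + j)"
proof -
  from assms obtain a b c d where 1: "x * of_int b = of_int a" "coprime b p" "b \<noteq> 0" "[a = i * b] (mod p)"
    "y * of_int d = of_int c" "coprime d p" "d \<noteq> 0" "[c = j * d] (mod p)"
    unfolding rat_cong_def by blast
  have "(x + y) * of_int (b * d) = (x * of_int b) * of_int d + (y * of_int d) * of_int b"
    by (simp add: algebra_simps)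
  hence "(x + y) * of_int (b * d) = of_int (a * d + c * b)" using 1 by simp
  moreover have "[a * d + c * b = i * b * d + j * d * b] (mod p)"
    using 1 by (intro cong_add cong_mult cong_refl)
  ultimately show ?thesis unfolding rat_cong_def
    using 1 by (intro exI[of _ "a * d + c * b"] exI[of _ "b * d"]) (simp add: algebra_simps)
qed

lemma rat_cong_uminus: "rat_cong p x i \<Longrightarrow> rat_cong p (- x) (- i)"
  using rat_cong_mult[OF rat_cong_of_int[of p "-1"], of x i] by simp

lemma rat_cong_power: "rat_cong p x i \<Longrightarrow> rat_cong p (x ^ n) (i ^ n)"
  by (induction n) (use rat_cong_of_int[of p 1] in \<open>auto intro: rat_cong_mult\<close>)

lemma rat_cong_unique:
  assumes "rat_cong p x i" "rat_cong p x j"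
  shows "[i = j] (mod p)"
proof -
  from assms obtain a b c d where 1: "x * of_int b = of_int a" "coprime b p" "b \<noteq> 0" "[a = i * b] (mod p)"
    "x * of_int d = of_int c" "coprime d p" "d \<noteq> 0" "[c = j * d] (mod p)"
    unfolding rat_cong_def by blast
  have "(of_int (a * d) :: rat) = of_int (c * b)"
  proof -
    have "of_int a * of_int d = (x * of_int b) * of_int d" by (simp only: 1(1))
    also have "\<dots> = (x * of_int d) * of_int b" by (simp only: mult_ac)
    finally show ?thesis by (simp only: 1(5) of_int_mult)
  qed
  hence e: "a * d = c * b" by (simp only: of_int_eq_iff)
  have "[i * b * d = a * d] (mod p)" using 1(4) by (intro cong_mult cong_refl) (simp add: cong_sym)
  also have "a * d = c * b" by (rule e)
  also have "[c * b = j * d * b] (mod p)" using 1(8) by (intro cong_mult cong_refl)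
  finally have "[i * (b * d) = j * (b * d)] (mod p)" by (simp add: mult_ac)
  thus ?thesis using 1 by (simp add: cong_mult_rcancel)
qed

lemma rat_cong_inverse:
  assumes "rat_cong p x i" "[i * j = 1] (mod p)"
  shows "rat_cong p (1 / x) j"
proof -
  from assms obtain a b where 1: "x * of_int b = of_int a" "coprime b p" "b \<noteq> 0" "[a = i * b] (mod p)"
    unfolding rat_cong_def by blast
  have "[a * j = i * b * j] (mod p)" using 1(4) by (intro cong_mult cong_refl)
  also have "i * b * j = (i * j) * b" by simp
  also have "[(i * j) * b = 1 * b] (mod p)" using assms(2) by (intro cong_mult cong_refl)
  finally have 2: "[b = j * a] (mod p)" by (simp add: cong_sym mult.commute)
  have "coprime i p" using assms(2) by (metis cong_imp_coprime coprime_1_left coprime_mult_left_iff cong_sym)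
  hence cop: "coprime a p" using 1 by (metis cong_imp_coprime coprime_mult_left_iff cong_sym)
  show ?thesis
  proof (cases "x = 0")
    case True
    hence "a = 0" using 1 by simp
    hence "is_unit p" using cop by simp
    hence "[0 = j * 1] (mod p)" by (simp only: cong_iff_dvd_diff unit_imp_dvd)
    thus ?thesis unfolding rat_cong_def using True
      by (intro exI[of _ 0] exI[of _ 1]) auto
  next
    case False
    have "a \<noteq> 0" using 1 False by auto
    moreover have "1 / x * of_int a = of_int b" using 1 False by (simp add: field_simps)
    ultimately show ?thesis unfolding rat_cong_def using 2 cop by blast
  qed
qed

text \<open>If p divided the denominator of x, it would divide the denominator of x^2. This is what
  allows the unknown rationals w and y of a solution to be reduced modulo p.\<close>

lemma rat_cong_sqrt:
  assumes p: "prime p" and y: "rat_cong p (x^2) j"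
  obtains i where "rat_cong p x i"
proof -
  from y obtain c d where 1: "x^2 * of_int d = of_int c" "coprime d p" "d \<noteq> 0"
    unfolding rat_cong_def by blast
  obtain a b where q: "quotient_of x = (a, b)" by (cases "quotient_of x")
  have b: "b > 0" "coprime a b" "x = of_int a / of_int b"
    using q quotient_of_denom_pos quotient_of_coprime quotient_of_div by auto
  have "(of_int a)^2 * of_int d = (of_int c :: rat) * (of_int b)^2"
    using 1(1) b by (simp add: field_simps)
  hence "of_int (a^2 * d) = (of_int (c * b^2) :: rat)" by simp
  hence e: "a^2 * d = c * b^2" by (simp only: of_int_eq_iff)
  have "\<not> p dvd b"
  proof
    assume pb: "p dvd b"
    hence "p dvd a^2 * d" unfolding e by (simp add: power2_eq_square)
    moreover have "\<not> p dvd d" using 1(2) p by (metis coprime_absorb_left coprime_commute not_prime_unit)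
    ultimately have "p dvd a" using p by (metis prime_dvd_mult_iff prime_dvd_power)
    with pb b(2) p show False by (metis coprime_common_divisor not_prime_unit)
  qed
  hence cop: "coprime b p" using p by (metis coprime_commute prime_imp_coprime)
  then obtain k where k: "[b * k = 1] (mod p)" by (metis cong_solve_coprime_int)
  have "[a * (b * k) = a * 1] (mod p)" using k by (intro cong_mult cong_refl)
  hence "[a = a * k * b] (mod p)" by (simp add: cong_sym mult_ac)
  hence "rat_cong p x (a * k)" unfolding rat_cong_def using b cop 
    by (intro exI[of _ a] exI[of _ b]) auto
  thus thesis by (rule that)
qed

text \<open>One representative of each pair v, -v. The root is kept with its square because the
  trace condition involves w itself.\<close>

definition sqs :: "int \<Rightarrow> (int \<times> int) list" where
  "sqs p = map (\<lambda>v. (v, v * v mod p)) [0..p div 2]"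

fun is_sq :: "(int \<times> int) list \<Rightarrow> int \<Rightarrow> bool" where
  "is_sq [] x = False"
| "is_sq ((v, s) # l) x = (if s = x then True else is_sq l x)"

lemma is_sq_iff: "is_sq l x \<longleftrightarrow> x \<in> snd ` set l"
  by (induction l x rule: is_sq.induct) auto

lemma sqs_memb:
  assumes "p > 0"
  shows "(v mod p, v * v mod p) \<in> set (sqs p) \<or> ((- v) mod p, v * v mod p) \<in> set (sqs p)"
proof -
  have 1: "(w mod p, w * w mod p) \<in> set (sqs p)" if "w mod p \<le> p div 2" for w
    unfolding sqs_def set_map set_upto
    by (rule image_eqI[of _ _ "w mod p"]) (use that assms in \<open>auto simp: mod_mult_eq\<close>)
  show ?thesis
  proof (cases "v mod p \<le> p div 2")
    case True thus ?thesis using 1 by blast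
  next
    case False
    hence "(- v) mod p \<le> p div 2" using assms zmod_zminus1_eq_if[of v p] by auto
    from 1[OF this] show ?thesis by simp
  qed
qed

lemma square_imp_is_sq:
  assumes p: "prime p" and x: "rat_cong p (y^2) i"
  shows "is_sq (sqs p) (i mod p)"
proof -
  obtain j where "rat_cong p y j" using rat_cong_sqrt[OF p x] .
  hence "rat_cong p (y^2) (j^2)" by (rule rat_cong_power)
  hence "i mod p = j * j mod p" using x rat_cong_unique by (metis cong_def power2_eq_square)
  thus ?thesis using sqs_memb[of p j] p unfolding is_sq_iff by (metis image_eqI prime_gt_0_int snd_conv)
qed

text \<open>Both signs of the root are tested, since \<open>sqs\<close> lists only one of v and -v.
  If \<open>D\<close> is a nonsquare modulo p, the norm condition already fails and the test
  succeeds without looking at traces.\<close>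

fun norm_trace_free_aux :: "(int \<times> int) list \<Rightarrow> int \<Rightarrow> int \<Rightarrow> int \<Rightarrow> (int \<times> int) list \<Rightarrow> bool" where
  "norm_trace_free_aux sq p t D [] = True"
| "norm_trace_free_aux sq p t D ((v, s) # l) =
     ((if s = D then \<not> is_sq sq ((t + 2 * v) mod p) \<and> \<not> is_sq sq ((t - 2 * v) mod p) else True)
      \<and> norm_trace_free_aux sq p t D l)"

definition norm_trace_free :: "(int \<times> int) list \<Rightarrow> int \<Rightarrow> int \<Rightarrow> int \<Rightarrow> bool" where
  "norm_trace_free sq p D t = norm_trace_free_aux sq p t (D mod p) sq"

lemma norm_trace_free_aux_iff: "norm_trace_free_aux sq p t D l \<longleftrightarrow>
   (\<forall>(v, s) \<in> set l. s = D \<longrightarrow> \<not> is_sq sq ((t + 2 * v) mod p) \<and> \<not> is_sq sq ((t - 2 * v) mod p))"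
  by (induction sq p t D l rule: norm_trace_free_aux.induct) auto

lemma norm_trace_free_sound:
  assumes p: "prime p" and N: "rat_cong p N D" and T: "rat_cong p T t"
    and nf: "norm_trace_free (sqs p) p D t"
  shows "\<nexists>w y. w^2 = N \<and> y^2 = T + 2 * w"
proof
  assume "\<exists>w y. w^2 = N \<and> y^2 = T + 2 * w"
  then obtain w y where w: "w^2 = N" and y: "y^2 = T + of_int 2 * w" by auto
  have D: "rat_cong p (w^2) D" unfolding w by (rule N)
  obtain v where v: "rat_cong p w v" using rat_cong_sqrt[OF p D] .
  hence "rat_cong p (w^2) (v^2)" by (rule rat_cong_power)
  hence vD: "v * v mod p = D mod p" using D rat_cong_unique by (metis cong_def power2_eq_square)
  have "rat_cong p (y^2) (t + 2 * v)"
    unfolding y using T v by (intro rat_cong_add rat_cong_mult rat_cong_of_int)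
  from square_imp_is_sq[OF p this] have sq: "is_sq (sqs p) ((t + 2 * v) mod p)" .
  have "(t + 2 * v) mod p = (t + 2 * (v mod p)) mod p" by (metis mod_add_right_eq mod_mult_right_eq)
  moreover have "(t + 2 * v) mod p = (t - 2 * ((- v) mod p)) mod p"
  proof -
    have "(t - 2 * ((- v) mod p)) mod p = (t - 2 * (- v)) mod p" by (metis mod_diff_right_eq mod_mult_right_eq)
    thus ?thesis by simp
  qed
  ultimately have "is_sq (sqs p) ((t + 2 * (v mod p)) mod p)" "is_sq (sqs p) ((t - 2 * ((- v) mod p)) mod p)"
    using sq by simp_all
  moreover have "\<not> is_sq (sqs p) ((t + 2 * u) mod p) \<and> \<not> is_sq (sqs p) ((t - 2 * u) mod p)"
    if "(u, v * v mod p) \<in> set (sqs p)" for u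
    using nf that vD unfolding norm_trace_free_def norm_trace_free_aux_iff by auto
  ultimately show False using sqs_memb[of p v] prime_gt_0_int[OF p] by blast
qed

text \<open>Success requires that the orbit actually returns to a visited point; running out of fuel
  before that yields False.\<close>

fun orbit_closed :: "(int \<Rightarrow> bool) \<Rightarrow> (int \<Rightarrow> int) \<Rightarrow> nat \<Rightarrow> int list \<Rightarrow> int \<Rightarrow> bool" where
  "orbit_closed P g 0 seen x = (x \<in> set seen)"
| "orbit_closed P g (Suc n) seen x =
     (if x \<in> set seen then True else P x \<and> orbit_closed P g n (x # seen) (g x))"

text \<open>\<open>S\<close> collects the points visited from x on. A successor may fall into
  \<open>seen\<close>, whose points were tested by the enclosing calls; with \<open>seen\<close>
  empty, S is closed under g.\<close>

lemma orbit_closed_sound: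
  assumes "orbit_closed P g n seen x"
  shows "\<exists>S. x \<in> S \<union> set seen \<and> (\<forall>y\<in>S. P y \<and> g y \<in> S \<union> set seen)"
  using assms
proof (induction P g n seen x rule: orbit_closed.induct)
  case (1 P g seen x)
  thus ?case by (intro exI[of _ "{}"]) auto
next
  case (2 P g n seen x)
  show ?case
  proof (cases "x \<in> set seen")
    case True thus ?thesis by (intro exI[of _ "{}"]) auto
  next
    case False
    hence "P x" "orbit_closed P g n (x # seen) (g x)" using 2 by auto
    with 2(1) False obtain S where "g x \<in> S \<union> set (x # seen)" "\<forall>y\<in>S. P y \<and> g y \<in> S \<union> set (x # seen)"
      by blast
    thus ?thesis using \<open>P x\<close> by (intro exI[of _ "insert x S"]) auto
  qed
qed

lemma orbit_closed_iterates:
  assumes "orbit_closed P g n [] x"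
  shows "P ((g ^^ k) x)"
proof -
  obtain S where S: "x \<in> S" "\<forall>y\<in>S. P y \<and> g y \<in> S" using orbit_closed_sound[OF assms] by auto
  have "(g ^^ k) x \<in> S" by (induction k) (use S in auto)
  thus ?thesis using S by blast
qed

fun quad_iter :: "int \<Rightarrow> int \<Rightarrow> nat \<Rightarrow> int \<Rightarrow> int" where
  "quad_iter p r 0 x = x"
| "quad_iter p r (Suc n) x = quad_iter p r n ((x * x + r) mod p)"

lemma rat_cong_crit_orbit:
  assumes "rat_cong p r ri" "rat_cong p (crit_orbit r n) x"
  shows "rat_cong p (crit_orbit r (n + k)) (quad_iter p ri k x)"
  using assms(2)
proof (induction k arbitrary: n x)
  case (Suc k)
  have "rat_cong p (crit_orbit r (Suc n)) ((x * x + ri) mod p)"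
    using assms(1) Suc.prems by (auto simp: power2_eq_square intro!: rat_cong_mod rat_cong_add rat_cong_mult)
  from Suc.IH[OF this] show ?case by simp
qed simp

text \<open>The index n = 0 encodes the condition \<open>first\<close>, with its reversed sign of
  the trace; n > 0 covers the progression n, n + k, n + 2k, and so on.\<close>

definition norm_trace_obstructed :: "rat \<Rightarrow> rat \<Rightarrow> rat \<Rightarrow> nat \<Rightarrow> nat \<Rightarrow> bool" where
  "norm_trace_obstructed r b q n k \<longleftrightarrow>
     (if n = 0 then \<nexists>w y. w^2 = r^2 + b*r + q \<and> y^2 = - (2*r + b) + 2*w
      else \<forall>j z. z = crit_orbit r (n + k * j) \<longrightarrow> (\<nexists>w y. w^2 = z^2 + b*z + q \<and> y^2 = 2*z + b + 2*w))"

text \<open>Splitting the indices from 2 on by parity allows different primes for the two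
  classes.\<close>

lemma irreducible_iterates_if_obstructed:
  assumes "irreducible [:q,b,1:]" "norm_trace_obstructed r b q 0 0"
    "norm_trace_obstructed r b q 2 2" "norm_trace_obstructed r b q 3 2"
  shows "irreducible ([:q,b,1:] \<circ>\<^sub>p poly_iter n [:r,0,1:])"
proof (rule irreducible_iterates_quadratic)
  fix n :: nat and z assume n: "n \<ge> 2" and z: "z = crit_orbit r n"
  have "n = 2 + 2 * ((n - 2) div 2) \<or> n = 3 + 2 * ((n - 2) div 2)" using n by presburger
  thus "\<nexists>w y. w^2 = z^2 + b*z + q \<and> y^2 = 2*z + b + 2*w"
    using assms(3,4) z unfolding norm_trace_obstructed_def by (metis numeral_3_eq_3 old.nat.distinct(1) zero_neq_numeral)
qed (use assms(1,2) in \<open>auto simp: norm_trace_obstructed_def\<close>)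

text \<open>The fuel 30 exceeds the length of all orbits that occur below.\<close>
definition quadratic_cert ::
  "(int \<times> int) list \<Rightarrow> int \<Rightarrow> int \<Rightarrow> int \<Rightarrow> int \<Rightarrow> nat \<Rightarrow> nat \<Rightarrow> bool" where
  "quadratic_cert sq p r b q n k =
     (if n = 0 then norm_trace_free sq p (r * r + b * r + q) (- (2 * r + b))
      else orbit_closed (\<lambda>z. norm_trace_free sq p (z * z + b * z + q) (2 * z + b))
             (quad_iter p r k) 30 [] (quad_iter p r n 0))"

lemma quadratic_cert_sound:
  assumes p: "prime p" and r: "rat_cong p r ri" and b: "rat_cong p b bi" and q: "rat_cong p q qi"
    and c: "quadratic_cert (sqs p) p ri bi qi n k"
  shows "norm_trace_obstructed r b q n k"
proof (cases "n = 0")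
  case True
  have "rat_cong p (r^2 + b*r + q) (ri * ri + bi * ri + qi)"
    unfolding power2_eq_square using r b q by (intro rat_cong_add rat_cong_mult)
  moreover have "rat_cong p (- (2*r + b)) (- (2 * ri + bi))"
    using rat_cong_uminus[OF rat_cong_add[OF rat_cong_mult[OF rat_cong_of_int[of p 2] r] b]] by simp
  ultimately show ?thesis
    using norm_trace_free_sound[OF p] c True unfolding quadratic_cert_def norm_trace_obstructed_def by simp
next
  case False
  have "\<nexists>w y. w^2 = z^2 + b*z + q \<and> y^2 = 2*z + b + 2*w" if z: "z = crit_orbit r (n + k * j)" for j z
  proof -
    define x where "x = (quad_iter p ri k ^^ j) (quad_iter p ri n 0)"
    have "rat_cong p (crit_orbit r (n + k * i)) ((quad_iter p ri k ^^ i) (quad_iter p ri n 0))" for i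
    proof (induction i)
      case 0 thus ?case using rat_cong_crit_orbit[OF r, of 0 0 n] rat_cong_of_int[of p 0] by simp
    next
      case (Suc i)
      have "n + k * Suc i = n + k * i + k" by simp
      thus ?case using rat_cong_crit_orbit[OF r Suc, of k] by (simp only:) simp
    qed
    hence zx: "rat_cong p z x" unfolding z x_def .
    have "orbit_closed (\<lambda>z. norm_trace_free (sqs p) p (z * z + bi * z + qi) (2 * z + bi))
             (quad_iter p ri k) 30 [] (quad_iter p ri n 0)"
      using c False unfolding quadratic_cert_def by simp
    hence nf: "norm_trace_free (sqs p) p (x * x + bi * x + qi) (2 * x + bi)"
      unfolding x_def by (rule orbit_closed_iterates)
    have "rat_cong p (z^2 + b*z + q) (x * x + bi * x + qi)"
      unfolding power2_eq_square using zx b q by (intro rat_cong_add rat_cong_mult)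
    moreover have "rat_cong p (2*z + b) (2 * x + bi)"
      using rat_cong_add[OF rat_cong_mult[OF rat_cong_of_int[of p 2] zx] b] by simp
    ultimately show ?thesis using norm_trace_free_sound[OF p _ _ nf] by blast
  qed
  thus ?thesis using False unfolding norm_trace_obstructed_def by simp
qed

section \<open>Numerators of the critical orbit\<close>

lemma rat_square_eq_of_int:
  fixes x :: rat
  assumes "x^2 = of_int n"
  obtains i where "x = of_int i"
proof -
  obtain a b where q: "quotient_of x = (a, b)" by (cases "quotient_of x")
  have b: "b > 0" "coprime a b" "x = of_int a / of_int b"
    using q quotient_of_denom_pos quotient_of_coprime quotient_of_div by auto
  have "(of_int (a^2) :: rat) = of_int (n * b^2)" using assms b by (simp add: field_simps)
  hence "b^2 dvd a^2" by (simp only: of_int_eq_iff) simp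
  hence "b dvd a" by simp
  hence "b = 1" using b by (metis coprime_absorb_left coprime_commute zdvd1_eq abs_of_pos)
  thus thesis using that[of a] b by simp
qed

lemma coprime_mult_square_int:
  fixes x y z :: int
  assumes "x * y = z^2" "coprime x y" "x \<ge> 0" "y \<ge> 0"
  obtains u where "x = u^2" "u \<ge> 0"
proof -
  have "nat x * nat y = (nat \<bar>z\<bar>)^2"
    using assms by (simp add: nat_mult_distrib[symmetric] nat_power_eq[symmetric])
  hence "is_nth_power 2 (nat x * nat y)" by (metis is_nth_powerI)
  moreover have "coprime (nat x) (nat y)" using assms
    by (metis coprime_int_iff int_nat_eq)
  ultimately have "is_nth_power 2 (nat x)" using is_nth_power_mult_coprime_nat_iff by blast
  then obtain k where "nat x = k^2" by (elim is_nth_powerE)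
  hence "x = (int k)^2" using assms(3) by (metis int_nat_eq of_nat_power)
  thus thesis using that by simp
qed

text \<open>Numerators of the critical orbit of x^2 + 1/c: for n >= 1, f^n(0) has denominator
  c^(2^(n-1)).\<close>

primrec orbit_num :: "int \<Rightarrow> nat \<Rightarrow> int" where
  "orbit_num c 0 = 0"
| "orbit_num c (Suc n) = (orbit_num c n)^2 + c ^ (2^n - 1)"

lemma crit_orbit_eq_orbit_num:
  assumes "c \<noteq> 0"
  shows "crit_orbit (1 / of_int c) (Suc n) * of_int c ^ (2^n) = (of_int (orbit_num c (Suc n)) :: rat)"
proof (induction n)
  case 0 thus ?case using assms by simp
next
  case (Suc n)
  define z :: rat where "z = crit_orbit (1 / of_int c) (Suc n)"
  let ?c = "of_int c :: rat"
  have e: "2 ^ Suc n = Suc (2 ^ Suc n - 1)" by simp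
  have "crit_orbit (1 / ?c) (Suc (Suc n)) * ?c ^ (2^Suc n) = (z^2 + 1 / ?c) * ?c ^ (2^Suc n)"
    by (simp only: crit_orbit.simps z_def)
  also have "\<dots> = (z * ?c ^ (2^n))^2 + 1 / ?c * ?c ^ (2^Suc n)"
    by (simp add: algebra_simps power_mult_distrib power_mult[symmetric])
  also have "1 / ?c * ?c ^ (2^Suc n) = ?c ^ (2^Suc n - 1)"
    using assms by (subst e) (simp only: power_Suc, simp)
  finally show ?case unfolding z_def Suc by simp
qed

text \<open>Modulo c each numerator from the second on is the square of the preceding one, and the
  first is 1.\<close>

lemma coprime_orbit_num: "coprime (orbit_num c (Suc n)) c"
proof (induction n)
  case 0 thus ?case by simp
next
  case (Suc n)
  have e: "2 ^ Suc n - 1 = Suc (2 ^ Suc n - 2)" 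
    using one_le_power[of "2::nat" n] unfolding power_Suc by arith
  have "orbit_num c (Suc (Suc n)) = (orbit_num c (Suc n))^2 + c ^ (2^Suc n - 1)" by simp
  also have "c ^ (2^Suc n - 1) = c ^ (2 ^ Suc n - 2) * c" unfolding e by simp
  finally have "coprime (orbit_num c (Suc (Suc n))) c \<longleftrightarrow> coprime ((orbit_num c (Suc n))^2) c"
    by (metis gcd_add_mult coprime_iff_gcd_eq_1 gcd.commute add.commute)
  thus ?case using Suc by simp
qed

text \<open>Modulo c + 1 the map is x^2 - 1, whose critical orbit is 0, -1, 0, -1, and so
  on.\<close>

lemma dvd_orbit_num_even: "(c + 1) dvd orbit_num c (2 * j)"
proof (induction j)
  case 0 thus ?case by simp
next
  case (Suc j)
  have m1: "[c = -1] (mod (c + 1))" by (simp add: cong_iff_dvd_diff)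
  have o: "odd (2 ^ Suc (2 * j) - 1 :: nat)" by simp
  have "[orbit_num c (Suc (2*j)) = 0^2 + (-1) ^ (2 ^ (2*j) - 1)] (mod (c + 1))"
    unfolding orbit_num.simps using Suc m1 by (intro cong_add cong_pow) (simp_all add: cong_0_iff)
  hence "[orbit_num c (Suc (Suc (2*j))) = (0^2 + (-1) ^ (2 ^ (2*j) - 1))^2 + (-1) ^ (2 ^ Suc (2*j) - 1)] (mod (c + 1))"
    unfolding orbit_num.simps(2)[of c "Suc (2*j)"] using m1 by (intro cong_add cong_pow)
  also have "(0^2 + (-1) ^ (2 ^ (2*j) - 1))^2 + (-1) ^ (2 ^ Suc (2*j) - 1) = (0::int)"
    using o by (simp add: power2_eq_square power_mult_distrib[symmetric])
  finally show ?case by (simp add: cong_0_iff)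
qed

text \<open>As c + 1 = -(m - 1)(m + 1), the numerator is a = (m - 1) d, and the cleared equation W^2
  = a^2 + (m - 1) m^K factors into the coprime numbers m - 1 and (m - 1) d^2 + m^K. At even indices
  the norm condition alone thus leaves only m = h^2 + 1.\<close>

lemma even_orbit_square_imp:
  assumes m: "m \<ge> 2" and j: "j \<ge> 1" and w: "(w::rat)^2 = (crit_orbit (1 / of_int (- (m^2))) (2*j))^2 + of_int (m - 1) / of_int (m^2)"
  obtains h where "m - 1 = h^2" "h \<ge> 0"
proof -
  define n where "n = 2 * j - 1"
  have n: "2 * j = Suc n" "n \<ge> 1" using j by (simp_all add: n_def)
  define c where "c = - (m^2)"
  have c0: "c \<noteq> 0" using m by (simp add: c_def)
  define a where "a = orbit_num c (2 * j)"
  let ?z = "crit_orbit (1 / of_int c) (Suc n)" and ?m = "of_int m :: rat"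
  \<comment> \<open>Here n >= 1, so the sign of c = -m^2 disappears from the denominator
    c^(2^n).\<close>
  have "even ((2::nat) ^ n)" using n by simp
  hence "c ^ (2^n) = m ^ (2 ^ Suc n)" by (simp add: c_def power_mult[symmetric])
  hence D: "of_int c ^ (2^n) = (?m ^ (2 ^ Suc n))" by (metis of_int_power)
  have za: "?z * ?m ^ (2 ^ Suc n) = of_int a"
    using crit_orbit_eq_orbit_num[OF c0, of n] unfolding D a_def n .
  define K :: nat where "K = 2 * 2 ^ Suc n - 2"
  have K: "2 * 2 ^ Suc n = K + 2"
    using one_le_power[of "2::nat" n] unfolding K_def power_Suc by arith
  have "(w * ?m ^ (2 ^ Suc n))^2 = (?z * ?m ^ (2 ^ Suc n))^2 + of_int (m - 1) / of_int (m^2) * (?m ^ (2 ^ Suc n))^2"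
    using w unfolding c_def[symmetric] n by (simp add: power_mult_distrib algebra_simps del: crit_orbit.simps)
  also have "(?m ^ (2 ^ Suc n))^2 = ?m ^ (K + 2)" unfolding K[symmetric] by (simp add: power_mult[symmetric] mult.commute)
  also have "of_int (m - 1) / of_int (m^2) * ?m ^ (K + 2) = of_int ((m - 1) * m ^ K)"
    using m by (simp add: power_add power2_eq_square field_simps)
  finally have W: "(w * ?m ^ (2 ^ Suc n))^2 = of_int (a^2 + (m - 1) * m ^ K)" unfolding za by simp
  then obtain W where W': "w * ?m ^ (2 ^ Suc n) = of_int W" by (rule rat_square_eq_of_int)
  have W2: "W^2 = a^2 + (m - 1) * m ^ K" using W unfolding W' by (metis of_int_eq_iff of_int_power)
  have "c + 1 = (m - 1) * (- m - 1)" by (simp add: c_def algebra_simps power2_eq_square)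
  hence "m - 1 dvd a" using dvd_orbit_num_even[of c j] unfolding a_def by (metis dvd_mult_left)
  then obtain d where d: "a = (m - 1) * d" by (elim dvdE)
  have e: "(m - 1) * ((m - 1) * d^2 + m ^ K) = W^2" unfolding W2 d by (simp add: algebra_simps power2_eq_square)
  have "coprime (m - 1) m" by (metis coprime_diff_one_left coprime_commute diff_add_cancel)
  hence "coprime (m - 1) (m ^ K)" by simp
  hence "coprime (m - 1) ((m - 1) * d^2 + m ^ K)" by (metis coprime_iff_gcd_eq_1 gcd_add_mult mult.commute add.commute)
  thus thesis using coprime_mult_square_int[OF e] m that by auto
qed

text \<open>For c = -m^2 the quadratic is (x + t/m) o f = x^2 + (t m - 1)/m^2, and \<open>mi\<close>
  is the inverse of m modulo p.\<close>

definition minus_square_cert ::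
  "(int \<times> int) list \<Rightarrow> int \<Rightarrow> nat \<Rightarrow> nat \<Rightarrow> int \<Rightarrow> int \<Rightarrow> int \<Rightarrow> bool" where
  "minus_square_cert sq p n k t m mi =
     ((m * mi) mod p = 1 \<and> quadratic_cert sq p ((- (mi * mi)) mod p) 0 (((t * m - 1) * (mi * mi)) mod p) n k)"

abbreviation minus_square_obstructed :: "int \<Rightarrow> int \<Rightarrow> nat \<Rightarrow> nat \<Rightarrow> bool" where
  "minus_square_obstructed t m \<equiv>
     norm_trace_obstructed (1 / of_int (- (m^2))) 0 (of_int (t * m - 1) / of_int (m^2))"

lemma minus_square_cert_sound:
  assumes p: "prime p" and c: "minus_square_cert (sqs p) p n k t m mi"
    and m': "[m' = m] (mod p)" and t': "[t' = t] (mod p)"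
  shows "minus_square_obstructed t' m' n k"
proof -
  have "[m' * mi = m * mi] (mod p)" using m' by (intro cong_mult cong_refl)
  also have "[m * mi = 1] (mod p)" using c prime_gt_1_int[OF p] by (simp add: minus_square_cert_def cong_def)
  finally have i: "rat_cong p (1 / of_int m') mi" by (rule rat_cong_inverse[OF rat_cong_of_int])
  have "rat_cong p (- (1 / of_int m' * (1 / of_int m'))) ((- (mi * mi)) mod p)"
    using i by (intro rat_cong_mod rat_cong_uminus rat_cong_mult)
  hence r: "rat_cong p (1 / of_int (- (m'^2))) ((- (mi * mi)) mod p)"
    by (simp add: power2_eq_square)
  have "[t' * m' - 1 = t * m - 1] (mod p)" using m' t' by (intro cong_diff cong_mult cong_refl)
  hence "rat_cong p (of_int (t' * m' - 1)) (t * m - 1)" using rat_cong_of_int rat_cong_cong by blast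
  hence "rat_cong p (of_int (t' * m' - 1) * (1 / of_int m' * (1 / of_int m'))) (((t * m - 1) * (mi * mi)) mod p)"
    using i by (intro rat_cong_mod rat_cong_mult)
  hence q: "rat_cong p (of_int (t' * m' - 1) / of_int (m'^2)) (((t * m - 1) * (mi * mi)) mod p)"
    by (simp add: power2_eq_square)
  show ?thesis
    using quadratic_cert_sound[OF p r _ q] rat_cong_of_int[of p 0] c by (simp add: minus_square_cert_def)
qed

section \<open>The family c = -m^2\<close>

text \<open>An entry \<open>(p, [(a, i), \<dots>])\<close> lists residue classes \<open>a\<close> of the parameter that are excluded modulo the
  prime \<open>p\<close>; \<open>i\<close> is the inverse modulo \<open>p\<close> of the denominator attached to \<open>a\<close>.\<close>
type_synonym sieve = "(int \<times> (int \<times> int) list) list"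

fun key_member :: "int \<Rightarrow> (int \<times> int) list \<Rightarrow> bool" where
  "key_member x [] = False"
| "key_member x ((a, _) # T) = (if a = x then True else key_member x T)"

fun covered :: "sieve \<Rightarrow> int \<Rightarrow> bool" where
  "covered [] x = False"
| "covered ((p, T) # tabs) x = (if key_member (x mod p) T then True else covered tabs x)"

lemma key_member_iff: "key_member x T \<longleftrightarrow> (\<exists>i. (x, i) \<in> set T)"
  by (induction x T rule: key_member.induct) auto

lemma covered_iff: "covered tabs x \<longleftrightarrow> (\<exists>(p, T) \<in> set tabs. key_member (x mod p) T)"
  by (induction tabs x rule: covered.induct) auto

lemma covered_imp: "covered tabs x \<Longrightarrow> \<exists>p T i. (p, T) \<in> set tabs \<and> (x mod p, i) \<in> set T"
  unfolding covered_iff key_member_iff by blast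

fun covers_all :: "sieve \<Rightarrow> int list \<Rightarrow> bool" where
  "covers_all tabs [] = True"
| "covers_all tabs (x # xs) = (if covered tabs x then covers_all tabs xs else False)"

lemma covers_all_iff: "covers_all tabs xs \<longleftrightarrow> (\<forall>x\<in>set xs. covered tabs x)"
  by (induction tabs xs rule: covers_all.induct) auto

text \<open>One parameter x governs both t and m: the pairs used are (s, s^2 - 1), (1, h^2 + 1) and
  (1, m). Being polynomial in x, they depend modulo p only on x modulo p.\<close>

definition sieve_ok :: "(int \<Rightarrow> int) \<Rightarrow> (int \<Rightarrow> int) \<Rightarrow> nat \<Rightarrow> nat \<Rightarrow> sieve \<Rightarrow> bool" where
  "sieve_ok t m n k tabs = list_all (\<lambda>(p, T). let sq = sqs p in
     list_all (\<lambda>(x, mi). minus_square_cert sq p n k (t x) (m x) mi) T) tabs"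

lemma sieve_sound:
  assumes ok: "sieve_ok t m n k tabs" and pr: "list_all (\<lambda>(p, _). prime p) tabs"
    and cov: "covered tabs x"
    and t: "\<And>a b p. [a = b] (mod p) \<Longrightarrow> [t a = t b] (mod p)"
    and m: "\<And>a b p. [a = b] (mod p) \<Longrightarrow> [m a = m b] (mod p)"
  shows "minus_square_obstructed (t x) (m x) n k"
proof -
  obtain p T i where T: "(p, T) \<in> set tabs" "(x mod p, i) \<in> set T" using covered_imp[OF cov] by blast
  have "minus_square_cert (sqs p) p n k (t (x mod p)) (m (x mod p)) i"
    using ok T unfolding sieve_ok_def by (fastforce simp: list_all_iff Let_def)
  moreover have "[x = x mod p] (mod p)" by (simp add: cong_def)
  moreover have "prime p" using pr T by (auto simp: list_all_iff)
  ultimately show ?thesis using minus_square_cert_sound t m by blast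
qed

text \<open>The factor is x + s/m with m = s^2 - 1, the parameter is s. The entries carry no meaning
  of their own: any table that passes \<open>sieve_ok\<close> and \<open>covers_all\<close>
  serves.\<close>

definition root_first :: "(int \<times> (int \<times> int) list) list" where
  "root_first = [(3, [(0,2)]),
    (5, [(0,4), (3,2)]),
    (7, [(2,5), (3,1), (4,1)]),
    (11, [(0,10), (2,4), (3,7), (4,3), (8,7)]),
    (13, [(0,12), (2,9), (3,5), (6,3), (7,3), (8,6), (9,7), (10,5)]),
    (17, [(4,8), (12,5), (13,8), (14,15)]),
    (19, [(0,18), (9,5)]),
    (29, [(27,10)])]"


definition root_even :: "(int \<times> (int \<times> int) list) list" where
  "root_even = [(3, [(0,2)]),
    (7, [(0,6), (4,1)]),
    (11, [(0,10), (4,3)]),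
    (13, [(3,5), (6,3), (11,9)]),
    (17, [(2,6), (4,8), (6,1), (7,11), (10,11), (11,1), (14,15), (15,6)]),
    (19, [(0,18), (4,14), (7,2), (12,2), (17,13)]),
    (23, [(11,14), (13,10), (16,12), (20,3)]),
    (29, [(18,22)]),
    (31, [(0,30), (11,23)]),
    (37, [(8,10), (16,9), (27,3)]),
    (41, [(5,12)]),
    (43, [(0,42)]),
    (47, [(29,39)]),
    (53, [(33,36), (42,19)]),
    (73, [(49,8), (52,37)]),
    (109, [(64,51)])]"


definition root_odd :: "(int \<times> (int \<times> int) list) list" where
  "root_odd = [(5, [(0,4)]),
    (7, [(0,6), (3,1)]),
    (11, [(4,3)]),
    (13, [(0,12), (3,5), (7,3), (10,5), (11,9)]),
    (17, [(2,6), (3,15), (4,8), (6,1), (7,11), (10,11), (11,1), (13,8), (14,15), (15,6)]),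
    (19, [(3,12), (4,14), (12,2), (17,13)]),
    (23, [(5,1), (9,21), (11,14), (14,21), (17,2), (18,1), (20,3), (21,8)]),
    (31, [(20,23)]),
    (37, [(0,36)]),
    (41, [(8,28)]),
    (109, [(53,88)])]"


text \<open>The factor is x + 1/m at even indices, the parameter is h with m = h^2 + 1.\<close>

definition h_even :: "(int \<times> (int \<times> int) list) list" where
  "h_even = [(7, [(1,4), (2,3), (5,3), (6,4)]),
    (11, [(5,3), (6,3)]),
    (13, [(3,4), (10,4)]),
    (17, [(1,9), (2,7), (5,2), (6,6), (7,16), (8,11), (9,11), (10,16), (11,6), (12,2), (15,7), (16,9)]),
    (19, [(2,4), (17,4)]),
    (23, [(4,19), (6,5), (10,18), (19,19)]),
    (31, [(29,25)]),
    (37, [(14,34)]),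
    (47, [(31,15)]),
    (157, [(123,111)]),
    (199, [(136,179)])]"


lemma sieve_primes:
  "list_all (\<lambda>(p, _). prime p) root_first" "list_all (\<lambda>(p, _). prime p) root_even"
  "list_all (\<lambda>(p, _). prime p) root_odd" "list_all (\<lambda>(p, _). prime p) h_even"
  by (simp_all add: root_first_def root_even_def root_odd_def h_even_def)

lemma cong_root: "[a = b] (mod p) \<Longrightarrow> [a * a - 1 = b * b - 1] (mod (p :: int))"
  by (intro cong_diff cong_mult cong_refl)

lemma root_obstructed:
  assumes s: "2 \<le> s" "s \<le> 178"
  shows "minus_square_obstructed s (s^2 - 1) 0 0" "minus_square_obstructed s (s^2 - 1) 2 2"
    "minus_square_obstructed s (s^2 - 1) 3 2"
proof -
  have 0: "sieve_ok (\<lambda>s. s) (\<lambda>s. s * s - 1) 0 0 root_first" "covers_all root_first [2..178]" by code_simp+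
  have 2: "sieve_ok (\<lambda>s. s) (\<lambda>s. s * s - 1) 2 2 root_even" "covers_all root_even [2..178]" by code_simp+
  have 3: "sieve_ok (\<lambda>s. s) (\<lambda>s. s * s - 1) 3 2 root_odd" "covers_all root_odd [2..178]" by code_simp+
  have c: "covered root_first s" "covered root_even s" "covered root_odd s"
    using 0(2) 2(2) 3(2) s unfolding covers_all_iff set_upto by (meson atLeastAtMost_iff)+
  have ss: "s^2 - 1 = s * s - 1" by (simp add: power2_eq_square)
  show "minus_square_obstructed s (s^2 - 1) 0 0"
    unfolding ss by (rule sieve_sound[OF 0(1) sieve_primes(1) c(1)]) (simp_all only: cong_root)
  show "minus_square_obstructed s (s^2 - 1) 2 2"
    unfolding ss by (rule sieve_sound[OF 2(1) sieve_primes(2) c(2)]) (simp_all only: cong_root)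
  show "minus_square_obstructed s (s^2 - 1) 3 2"
    unfolding ss by (rule sieve_sound[OF 3(1) sieve_primes(3) c(3)]) (simp_all only: cong_root)
qed

lemma norm_trace_obstructedI:
  assumes "n > 0"
    and "\<And>j w. w^2 = (crit_orbit r (n + k * j))^2 + b * crit_orbit r (n + k * j) + q \<Longrightarrow> False"
  shows "norm_trace_obstructed r b q n k"
  using assms unfolding norm_trace_obstructed_def by (auto simp del: crit_orbit.simps)

text \<open>Unless m - 1 is a square, the norm condition fails by
  \<open>even_orbit_square_imp\<close>. A sieve is needed only for the fewer than 178 values m = h^2
  + 1.\<close>

lemma even_obstructed:
  assumes m: "2 \<le> m" "m \<le> 31622"
  shows "minus_square_obstructed 1 m 2 2"
proof (cases "\<exists>h. m - 1 = h^2 \<and> h \<ge> 0")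
  case True
  then obtain h where h: "m - 1 = h^2" "h \<ge> 0" by blast
  have "h \<noteq> 0" using h m by auto
  have "h < 178"
  proof (rule ccontr)
    assume "\<not> h < 178"
    hence "178^2 \<le> h^2" by (intro power_mono) auto
    thus False using h m by simp
  qed
  have "sieve_ok (\<lambda>_. 1) (\<lambda>h. h * h + 1) 2 2 h_even" "covers_all h_even [1..177]" by code_simp+
  moreover from this(2) have "covered h_even h" using h \<open>h < 178\<close> \<open>h \<noteq> 0\<close> unfolding covers_all_iff set_upto by simp
  ultimately have "minus_square_obstructed 1 (h * h + 1) 2 2"
    using sieve_sound[of "\<lambda>_. 1" "\<lambda>h. h * h + 1" 2 2 h_even h, OF _ sieve_primes(4)]
    by (meson cong_add cong_mult cong_refl)
  thus ?thesis using h by (simp add: power2_eq_square algebra_simps)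
next
  case False
  show ?thesis
  proof (rule norm_trace_obstructedI)
    fix j w
    assume w: "w^2 = (crit_orbit (1 / rat_of_int (- (m^2))) (2 + 2 * j))^2
      + 0 * crit_orbit (1 / rat_of_int (- (m^2))) (2 + 2 * j) + of_int (1 * m - 1) / of_int (m^2)"
    have "2 + 2 * j = 2 * (j + 1)" by simp
    hence "w^2 = (crit_orbit (1 / rat_of_int (- (m^2))) (2 * (j + 1)))^2 + of_int (m - 1) / of_int (m^2)"
      using w by (simp only: mult_zero_left add_0_right mult_1)
    from even_orbit_square_imp[OF m(1) _ this] obtain h where "m - 1 = h^2" "h \<ge> 0" by auto
    thus False using False by blast
  qed simp
qed

text \<open>For s = 3, 5, 56 and m = s^2 - 1 the number s m + 1 is the square of t = 5, 11, 419.
  Then (x - s/m) o f splits once more, and x + t/m is one of its factors.\<close>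

lemma iterated_root_obstructed:
  assumes "(t, m) \<in> {(5, 8), (11, 24), (419, 3135)}"
  shows "minus_square_obstructed t m 0 0" "minus_square_obstructed t m 2 2" "minus_square_obstructed t m 3 2"
proof -
  note S = minus_square_cert_sound[OF _ _ cong_refl cong_refl]
  have "minus_square_cert (sqs 5) 5 0 0 5 8 2" "minus_square_cert (sqs 17) 17 2 2 5 8 15"
    "minus_square_cert (sqs 7) 7 3 2 5 8 1" "minus_square_cert (sqs 11) 11 0 0 11 24 6"
    "minus_square_cert (sqs 5) 5 2 2 11 24 4" "minus_square_cert (sqs 23) 23 3 2 11 24 1"
    "minus_square_cert (sqs 13) 13 0 0 419 3135 7" "minus_square_cert (sqs 31) 31 2 2 419 3135 8"
    "minus_square_cert (sqs 31) 31 3 2 419 3135 8"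
    by code_simp+
  from S[OF _ this(1)] S[OF _ this(2)] S[OF _ this(3)] S[OF _ this(4)] S[OF _ this(5)] S[OF _ this(6)]
    S[OF _ this(7)] S[OF _ this(8)] S[OF _ this(9)]
  have "minus_square_obstructed 5 8 0 0" "minus_square_obstructed 5 8 2 2" "minus_square_obstructed 5 8 3 2"
    "minus_square_obstructed 11 24 0 0" "minus_square_obstructed 11 24 2 2" "minus_square_obstructed 11 24 3 2"
    "minus_square_obstructed 419 3135 0 0" "minus_square_obstructed 419 3135 2 2" "minus_square_obstructed 419 3135 3 2"
    by simp_all
  thus "minus_square_obstructed t m 0 0" "minus_square_obstructed t m 2 2" "minus_square_obstructed t m 3 2"
    using assms by (auto simp only: insert_iff empty_iff prod.inject)
qed

text \<open>At odd indices and for the first condition every m up to 31622 has to be sieved. The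
  wheel primes 3, 7, 17 (product 357) dispose of whole classes modulo 357 at once; only the
  remaining classes are searched number by number with the other primes.\<close>

definition odd_wheel :: "(int \<times> (int \<times> int) list) list" where
  "odd_wheel = [(3, [(2,2)]),
    (7, [(2,4), (5,3), (6,6)]),
    (17, [(2,9), (3,6), (7,5), (8,15), (9,2), (11,14), (14,11), (15,8), (16,16)])]"

definition odd_rest :: "(int \<times> (int \<times> int) list) list" where
  "odd_rest = [(23, [(2,12), (9,18), (11,21), (12,2), (13,16), (14,5), (15,20), (18,9), (20,15), (21,11), (22,22)]),
    (43, [(3,29), (4,11), (8,27), (13,10), (15,23), (21,41), (22,2), (28,20), (29,3), (33,30), (34,19), (36,6), (39,32), (42,42)]),
    (19, [(4,5), (5,4), (9,17), (11,7), (16,6), (18,18)]),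
    (11, [(4,3), (7,8), (10,10)]),
    (41, [(3,14), (11,15), (12,24), (14,3), (19,13), (21,2), (24,12), (27,38), (29,17), (37,10), (38,27)]),
    (37, [(4,28), (6,31), (8,14), (11,27), (12,34), (13,20), (22,32), (29,23), (31,6)]),
    (29, [(3,10), (8,11), (10,3), (14,27), (19,26), (25,7), (26,19)]),
    (31, [(9,7), (12,13), (24,22), (25,5), (26,6), (30,30)]),
    (47, [(3,16), (6,8), (9,21), (20,40), (22,15), (27,7), (41,39), (46,46)]),
    (13, [(8,5), (10,4)]),
    (53, [(2,27), (4,40), (5,32), (7,38), (15,46), (25,17), (35,50), (38,7), (46,15), (47,44)]),
    (59, [(24,32), (32,24), (35,27), (58,58)]),
    (61, [(2,31), (4,46), (10,55), (17,18), (20,58), (25,22), (26,54), (28,24), (36,39), (41,3), (57,15), (58,20), (59,30)]),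
    (67, [(12,28), (13,31), (33,65), (37,29), (39,55), (41,18), (42,8), (44,32), (49,26), (51,46), (53,43)]),
    (71, [(6,12), (14,66), (23,34), (34,23), (40,16), (56,52), (63,62), (65,59), (67,53), (70,70)]),
    (73, [(2,37), (13,45), (19,50), (33,31), (36,71), (37,2), (40,42), (51,63), (56,30), (57,41), (58,34), (60,28), (68,29), (72,72)]),
    (79, [(4,20), (5,16), (32,42), (35,70), (40,2), (44,9), (59,75), (67,46), (69,71), (74,63), (78,78)]),
    (83, [(8,52), (19,35), (20,54), (33,78), (55,80), (77,69), (82,82)]),
    (89, [(5,18), (57,25), (72,68)]),
    (97, [(9,54), (12,89), (16,91), (47,64), (64,47), (96,96)]),
    (101, [(3,34), (6,17), (24,80), (55,90)]),
    (103, [(2,52), (37,39), (38,19), (66,64), (71,74), (84,65)]),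
    (107, [(58,24), (60,66), (78,59)]),
    (109, [(24,50), (39,14), (70,95)]),
    (113, [(83,64), (89,80)]),
    (127, [(10,89), (18,120), (60,36), (68,99), (126,126)]),
    (137, [(21,124), (35,47), (127,41)]),
    (139, [(57,100), (129,125)]),
    (149, [(111,98), (128,78)]),
    (157, [(58,111), (139,61)]),
    (181, [(123,78)]),
    (251, [(131,23)])]"

text \<open>The wheel modulus is 1785 = 3 5 7 17.\<close>

definition first_wheel :: "(int \<times> (int \<times> int) list) list" where
  "first_wheel = [(3, [(2,2)]),
    (5, [(2,3)]),
    (7, [(2,4), (3,5), (5,3), (6,6)]),
    (17, [(2,9), (3,6), (5,7), (6,3), (7,5), (8,15), (9,2), (13,4), (14,11), (15,8), (16,16)])]"

definition first_rest :: "(int \<times> (int \<times> int) list) list" where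
  "first_rest = [(19, [(3,13), (6,16), (7,11), (8,12), (9,17), (10,2), (11,7), (12,8), (13,3), (14,15), (15,14), (16,6), (17,9), (18,18)]),
    (43, [(2,22), (3,29), (6,36), (7,37), (8,27), (11,4), (12,18), (13,10), (14,40), (15,23), (18,12), (20,28), (23,15), (24,9), (25,31), (26,5), (28,20), (29,3), (30,33), (31,25), (33,30), (34,19), (35,16), (36,6), (37,7), (39,32), (40,14), (41,21), (42,42)]),
    (47, [(2,24), (3,16), (6,8), (7,27), (8,6), (9,21), (12,4), (14,37), (16,3), (17,36), (18,34), (19,5), (20,40), (21,9), (22,15), (23,45), (24,2), (27,7), (28,42), (30,11), (31,44), (32,25), (33,10), (34,18), (36,17), (37,14), (40,20), (41,39), (42,28), (43,35), (46,46)]),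
    (23, [(2,12), (3,8), (6,4), (7,10), (8,3), (9,18), (11,21), (12,2), (13,16), (14,5), (18,9), (20,15), (21,11), (22,22)]),
    (29, [(3,10), (5,6), (8,11), (9,13), (12,17), (14,27), (15,2), (17,12), (19,26), (20,16), (22,4), (23,24), (24,23), (27,14)]),
    (41, [(11,15), (14,3), (32,9), (37,10)]),
    (37, [(3,25), (34,12)]),
    (11, [(3,4)]),
    (31, [(6,26)])]"


fun progression_covered :: "sieve \<Rightarrow> int list \<Rightarrow> int \<Rightarrow> int \<Rightarrow> int list \<Rightarrow> bool" where
  "progression_covered tabs exc W a [] = True"
| "progression_covered tabs exc W a (q # qs) =
     (if covered tabs (W * q + a) then progression_covered tabs exc W a qs
      else if W * q + a \<in> set exc then progression_covered tabs exc W a qs else False)"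

fun wheel_covers :: "sieve \<Rightarrow> sieve \<Rightarrow> int list \<Rightarrow> int \<Rightarrow> int list \<Rightarrow> int list \<Rightarrow> bool" where
  "wheel_covers wheel tabs exc W qs [] = True"
| "wheel_covers wheel tabs exc W qs (a # as) =
     (if covered wheel a then wheel_covers wheel tabs exc W qs as
      else if progression_covered tabs exc W a qs then wheel_covers wheel tabs exc W qs as else False)"

lemma progression_covered_iff:
  "progression_covered tabs exc W a qs \<longleftrightarrow> (\<forall>q\<in>set qs. covered tabs (W * q + a) \<or> W * q + a \<in> set exc)"
  by (induction tabs exc W a qs rule: progression_covered.induct) auto

lemma wheel_covers_iff:
  "wheel_covers wheel tabs exc W qs as \<longleftrightarrow>
    (\<forall>a\<in>set as. covered wheel a \<or> (\<forall>q\<in>set qs. covered tabs (W * q + a) \<or> W * q + a \<in> set exc))"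
  by (induction wheel tabs exc W qs as rule: wheel_covers.induct) (auto simp: progression_covered_iff)

lemma wheel_covers_sound:
  assumes wc: "wheel_covers wheel tabs exc W qs as" and div: "list_all (\<lambda>(p, _). p dvd W) wheel"
    and m: "m mod W \<in> set as" "m div W \<in> set qs" "m \<notin> set exc"
  shows "covered wheel m \<or> covered tabs m"
proof -
  have eq: "W * (m div W) + m mod W = m" by simp
  have "covered wheel (m mod W) \<Longrightarrow> covered wheel m"
    using div unfolding covered_iff list_all_iff by (fastforce simp: mod_mod_cancel)
  thus ?thesis using wc m unfolding wheel_covers_iff by (metis eq)
qed

lemma wheel_primes:
  "list_all (\<lambda>(p, _). prime p) odd_wheel" "list_all (\<lambda>(p, _). prime p) odd_rest"
  "list_all (\<lambda>(p, _). prime p) first_wheel" "list_all (\<lambda>(p, _). prime p) first_rest"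
  by (simp_all add: odd_wheel_def odd_rest_def first_wheel_def first_rest_def)

lemma odd_sieve_ok:
  "sieve_ok (\<lambda>_. 1) (\<lambda>m. m) 3 2 odd_wheel" "sieve_ok (\<lambda>_. 1) (\<lambda>m. m) 3 2 odd_rest"
  by code_simp+

lemma first_sieve_ok:
  "sieve_ok (\<lambda>_. 1) (\<lambda>m. m) 0 0 first_wheel" "sieve_ok (\<lambda>_. 1) (\<lambda>m. m) 0 0 first_rest"
  by code_simp+

lemma odd_wheel_covers:
  "wheel_covers odd_wheel odd_rest [0,1] 357 [0..88] [0..88]"
  "wheel_covers odd_wheel odd_rest [0,1] 357 [0..88] [89..177]"
  "wheel_covers odd_wheel odd_rest [0,1] 357 [0..88] [178..266]"
  "wheel_covers odd_wheel odd_rest [0,1] 357 [0..88] [267..356]"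
  by code_simp+

lemma first_wheel_covers:
  "wheel_covers first_wheel first_rest [0,1,4] 1785 [0..17] [0..594]"
  "wheel_covers first_wheel first_rest [0,1,4] 1785 [0..17] [595..1189]"
  "wheel_covers first_wheel first_rest [0,1,4] 1785 [0..17] [1190..1784]"
  by code_simp+

lemma odd_obstructed:
  assumes m: "2 \<le> m" "m \<le> 31622"
  shows "minus_square_obstructed 1 m 3 2"
proof -
  have d: "list_all (\<lambda>(p, _). p dvd 357) odd_wheel" by (simp add: odd_wheel_def)
  have "m div 357 \<le> 31622 div 357" using m by (intro zdiv_mono1) auto
  hence q: "m div 357 \<in> set [0..88]" unfolding set_upto using m by simp
  have e: "m \<notin> set [0,1]" using m by simp
  have "0 \<le> m mod 357" "m mod 357 < 357" by simp_all
  hence "m mod 357 \<in> set [0..88] \<or> m mod 357 \<in> set [89..177] \<or> m mod 357 \<in> set [178..266] \<or> m mod 357 \<in> set [267..356]"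
    unfolding set_upto atLeastAtMost_iff by linarith
  hence "covered odd_wheel m \<or> covered odd_rest m"
    using wheel_covers_sound[OF _ d _ q e] odd_wheel_covers by blast
  thus ?thesis
    using sieve_sound[OF odd_sieve_ok(1) wheel_primes(1)] sieve_sound[OF odd_sieve_ok(2) wheel_primes(2)] cong_refl
    by blast
qed

text \<open>The exception is genuine: for m = 4 the quadratic (x + 1/4) o f = x^2 + 3/16 splits when
  composed with f.\<close>

lemma first_obstructed:
  assumes m: "2 \<le> m" "m \<le> 31622" "m \<noteq> 4"
  shows "minus_square_obstructed 1 m 0 0"
proof -
  have d: "list_all (\<lambda>(p, _). p dvd 1785) first_wheel" by (simp add: first_wheel_def)
  have "m div 1785 \<le> 31622 div 1785" using m by (intro zdiv_mono1) auto
  hence q: "m div 1785 \<in> set [0..17]" unfolding set_upto using m by simp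
  have e: "m \<notin> set [0,1,4]" using m by simp
  have "0 \<le> m mod 1785" "m mod 1785 < 1785" by simp_all
  hence "m mod 1785 \<in> set [0..594] \<or> m mod 1785 \<in> set [595..1189] \<or> m mod 1785 \<in> set [1190..1784]"
    unfolding set_upto atLeastAtMost_iff by linarith
  hence "covered first_wheel m \<or> covered first_rest m"
    using wheel_covers_sound[OF _ d _ q e] first_wheel_covers by blast
  thus ?thesis
    using sieve_sound[OF first_sieve_ok(1) wheel_primes(3)] sieve_sound[OF first_sieve_ok(2) wheel_primes(4)] cong_refl
    by blast
qed

section \<open>Positive c: reduction to exponential equations\<close>

text \<open>For c >= 4 the square of the bound 2 c^d is at most the added term c^(2d+1), so the
  factor 2 reproduces itself. The numerator is thus about the square root of c^(2^(n+1) - 1), the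
  scale of the equation in which it is an error term.\<close>

lemma orbit_num_bounds:
  assumes "c \<ge> 4"
  shows "0 < orbit_num c (Suc n) \<and> orbit_num c (Suc n) \<le> 2 * c ^ (2^n - 1)"
proof (induction n)
  case 0 thus ?case by simp
next
  case (Suc n)
  let ?a = "orbit_num c (Suc n)"
  define d :: nat where "d = 2^n - 1"
  have IH: "0 < ?a" "?a \<le> 2 * c ^ d" using Suc unfolding d_def by blast+
  have e: "2 ^ Suc n - 1 = d + d + 1"
    using one_le_power[of "2::nat" n] unfolding d_def power_Suc by arith
  have a: "orbit_num c (Suc (Suc n)) = ?a^2 + c ^ (d + d + 1)" by (simp only: orbit_num.simps(2)[of c "Suc n"] e)
  have "?a^2 \<le> (2 * c ^ d)^2" using IH by (intro power_mono) auto
  also have "\<dots> = 4 * c ^ (d + d)" by (simp add: power2_eq_square power_add)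
  also have "\<dots> \<le> c * c ^ (d + d)" using assms by (intro mult_right_mono) auto
  finally have "?a^2 \<le> c ^ (d + d + 1)" by simp
  moreover have "0 < c ^ (d + d + 1)" using assms by simp
  ultimately show ?case unfolding a e by (simp add: add_nonneg_pos)
qed

lemma dvd_orbit_num_minus_1: "c dvd orbit_num c (Suc n) - 1"
proof (induction n)
  case (Suc n)
  have "2 ^ Suc n - 1 = Suc (2 ^ Suc n - 2)" using one_le_power[of "2::nat" n] unfolding power_Suc by arith
  hence "c dvd c ^ (2 ^ Suc n - 1)" by (simp only: power_Suc dvd_triv_left)
  moreover have "orbit_num c (Suc (Suc n)) - 1
      = (orbit_num c (Suc n) - 1) * (orbit_num c (Suc n) + 1) + c ^ (2 ^ Suc n - 1)"
    by (simp only: orbit_num.simps(2)[of c "Suc n"]) (simp add: power2_eq_square algebra_simps del: orbit_num.simps)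
  ultimately show ?case using Suc by (metis dvd_add dvd_mult2)
qed simp

text \<open>For consecutive numerators, a' - 1 = (a - 1)(a + 1) + c^(2^i - 1), and the even factor a
  + 1 gains one power of 2 at each step.\<close>

lemma two_power_dvd_orbit_num_minus_1:
  assumes "2 ^ k dvd c" "k \<ge> 1"
  shows "2 ^ (k + n) dvd orbit_num c (n + 2) - 1"
proof (induction n)
  case 0 thus ?case using assms by (simp add: numeral_2_eq_2)
next
  case (Suc n)
  let ?a = "orbit_num c (n + 2)"
  have le: "Suc n \<le> 2 ^ (n + 2) - 2"
  proof -
    have "n < 2 ^ n" by (rule less_exp)
    moreover have "2 ^ (n + 2) = 4 * (2 ^ n :: nat)" by simp
    ultimately show ?thesis by arith
  qed
  have "k + Suc n \<le> k * (2 ^ (n + 2) - 1)"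
  proof -
    have "1 * Suc n \<le> k * (2 ^ (n + 2) - 2)" using le assms(2) by (intro mult_le_mono)
    hence "k + Suc n \<le> k + k * (2 ^ (n + 2) - 2)" by (simp only: mult_1 add_le_cancel_left)
    also have "\<dots> = k * (1 + (2 ^ (n + 2) - 2))" by (simp only: distrib_left mult_1_right)
    also have "1 + (2 ^ (n + 2) - 2) = (2 ^ (n + 2) - 1 :: nat)" using le by arith
    finally show ?thesis .
  qed
  hence "(2::int) ^ (k + Suc n) dvd 2 ^ (k * (2 ^ (n + 2) - 1))" by (rule le_imp_power_dvd)
  also have "\<dots> dvd c ^ (2 ^ (n + 2) - 1)" unfolding power_mult using assms(1) by (rule dvd_power_same)
  finally have c: "2 ^ (k + Suc n) dvd c ^ (2 ^ (n + 2) - 1)" .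
  have "2 dvd ?a - 1" using Suc assms(2) by (metis dvd_trans dvd_power add_gr_0 One_nat_def Suc_le_lessD)
  hence "2 dvd ?a + 1" by presburger
  hence "2 ^ (k + n) * 2 dvd (?a - 1) * (?a + 1)" using Suc by (intro mult_dvd_mono)
  hence "2 ^ (k + Suc n) dvd (?a - 1) * (?a + 1)" by (simp add: mult.commute)
  moreover have "orbit_num c (Suc n + 2) - 1 = (?a - 1) * (?a + 1) + c ^ (2 ^ (n + 2) - 1)"
    by (simp only: add_Suc orbit_num.simps(2)[of c "n + 2"]) (simp add: power2_eq_square algebra_simps del: orbit_num.simps)
  ultimately show ?case using c by (metis dvd_add)
qed

text \<open>With E = c^(2^(n-2)) the denominators are z = a/E^2, w = b/E^2, y = Y/E, so that b^2 =
  a^2 + c^N and Y^2 = 2 (a + b). Writing Y = 2X gives b = 2 X^2 - a. The hypothesis n >= 2 makes E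
  an integer.\<close>

lemma positive_obstruction_imp_product:
  assumes c: "c > 0" and n: "n \<ge> 2"
    and w: "(w::rat)^2 = (crit_orbit (1 / of_int c) n)^2 + 1 / of_int c"
    and y: "y^2 = 2 * crit_orbit (1 / of_int c) n + 2 * w"
  obtains X where "4 * (X^2 * (X^2 - orbit_num c n)) = c ^ (2^n - 1)"
proof -
  obtain k where k: "n = Suc (Suc k)" using n by (metis add_2_eq_Suc le_Suc_ex)
  define a where "a = orbit_num c n"
  define z :: rat where "z = crit_orbit (1 / of_int c) n"
  define E :: rat where "E = of_int c ^ (2^k)"
  have DE: "of_int c ^ (2 ^ Suc k) = E^2" by (simp add: E_def power_mult[symmetric] mult.commute)
  have za: "z * E^2 = of_int a"
    using crit_orbit_eq_orbit_num[of c "Suc k"] c unfolding z_def a_def k DE by simp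
  have e: "E^2 * E^2 = of_int c * of_int (c ^ (2^n - 1))"
  proof -
    have "E^2 * E^2 = of_int c ^ (2 ^ Suc k + 2 ^ Suc k)" unfolding DE[symmetric] power_add ..
    also have "2 ^ Suc k + 2 ^ Suc k = Suc (2^n - 1)" unfolding k by simp
    finally show ?thesis by (simp only: power_Suc of_int_power)
  qed
  have W: "(w * E^2)^2 = of_int (a^2 + c ^ (2^n - 1))"
  proof -
    have "(w * E^2)^2 = w^2 * (E^2 * E^2)" by (simp add: power2_eq_square algebra_simps)
    also have "\<dots> = (z * E^2)^2 + 1 / of_int c * (E^2 * E^2)"
      unfolding w z_def[symmetric] by (simp add: power2_eq_square algebra_simps)
    also have "1 / of_int c * (E^2 * E^2) = of_int (c ^ (2^n - 1))" unfolding e using c by simp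
    finally show ?thesis unfolding za by (simp only: of_int_add of_int_power)
  qed
  then obtain b where b: "w * E^2 = of_int b" by (rule rat_square_eq_of_int)
  hence b2: "b^2 = a^2 + c ^ (2^n - 1)" using W by (metis of_int_eq_iff of_int_power)
  have "(y * E)^2 = y^2 * E^2" by (simp add: power_mult_distrib)
  also have "\<dots> = 2 * (z * E^2) + 2 * (w * E^2)" unfolding y z_def[symmetric] by (simp add: algebra_simps)
  finally have Y: "(y * E)^2 = of_int (2 * (a + b))" unfolding za b by simp
  then obtain Y where Y': "y * E = of_int Y" by (rule rat_square_eq_of_int)
  hence Y2: "Y^2 = 2 * (a + b)" using Y by (metis of_int_eq_iff of_int_power)
  hence "even (Y^2)" by simp
  then obtain X where X: "Y = 2 * X" by auto
  have "b = 2 * X^2 - a" using Y2 unfolding X by (simp add: power2_eq_square)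
  hence "(2 * X^2 - a)^2 = a^2 + c ^ (2^n - 1)" using b2 by simp
  moreover have "(2 * X^2 - a)^2 = a^2 + 4 * (X^2 * (X^2 - a))" by algebra
  ultimately have "4 * (X^2 * (X^2 - a)) = c ^ (2^n - 1)" by simp
  thus thesis using that unfolding a_def by blast
qed

lemma coprime_mult_eq_power_int:
  fixes x y c :: int
  assumes "x * y = c ^ N" "coprime x y" "x > 0" "y > 0" "c > 0" "N > 0"
  shows "\<exists>u v. x = u ^ N \<and> y = v ^ N \<and> c = u * v \<and> u > 0 \<and> v > 0"
proof -
  have "nat x * nat y = nat c ^ N"
    using assms by (simp add: nat_mult_distrib[symmetric] nat_power_eq[symmetric])
  hence "is_nth_power N (nat x * nat y)" by (metis is_nth_powerI)
  moreover have "coprime (nat x) (nat y)" using assms by (metis coprime_int_iff int_nat_eq order_less_imp_le)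
  ultimately have "is_nth_power N (nat x)" "is_nth_power N (nat y)"
    using is_nth_power_mult_coprime_nat_iff by blast+
  then obtain u v where uv: "nat x = u ^ N" "nat y = v ^ N" by (elim is_nth_powerE)
  have x: "x = (int u) ^ N" and y: "y = (int v) ^ N"
    using uv assms by (metis int_nat_eq of_nat_power order_less_imp_le)+
  have pos: "int u > 0" "int v > 0" using x y assms by (metis gr0I of_nat_0_less_iff of_nat_0 power_0_left less_irrefl)+
  have "(int u * int v) ^ N = c ^ N" using assms(1) x y by (simp add: power_mult_distrib)
  hence "int u * int v = c" by (rule power_eq_imp_eq_base) (use assms(5,6) in simp_all)
  thus ?thesis using x y pos by blast
qed

lemma odd_power_eq_square_int:
  fixes u X :: int
  assumes "X^2 = u ^ (2 * M + 1)" "u > 0"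
  obtains t where "u = t^2" "t > 0"
proof -
  have e: "u ^ (2 * M + 1) = (u ^ M)^2 * u" by (simp add: power_mult[symmetric] mult.commute)
  hence "(u ^ M)^2 dvd X^2" unfolding assms(1) by (metis dvd_triv_left)
  hence "u ^ M dvd X" by simp
  then obtain t where t: "X = u ^ M * t" by (elim dvdE)
  have "(u ^ M)^2 * t^2 = (u ^ M)^2 * u" using assms(1) e t by (simp add: power_mult_distrib)
  hence "u = t^2" using assms(2) by simp
  hence "u = \<bar>t\<bar>^2" "\<bar>t\<bar> > 0" using assms(2) by auto
  thus thesis using that by blast
qed

text \<open>A common divisor of X^2 and X^2 - a divides both a and c^N, hence is a unit. The factor
  4 joins the even one of the two, which keeps them coprime; each is then an N-th power, and N odd
  makes the base belonging to X a square.\<close>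

lemma product_split_cases:
  fixes c X a :: int
  assumes eq: "4 * (X^2 * (X^2 - a)) = c ^ N" and N: "N = 2 * M + 1" and c: "c > 0" and cop: "coprime a c"
  obtains (even) t u where "even t" "t > 0" "odd u" "u > 0" "c = t^2 * u" "(t^2) ^ N = 4 * u ^ N + 4 * a"
  | (odd) t w where "odd t" "t > 0" "even w" "w > 0" "c = t^2 * w" "4 * (t^2) ^ N = w ^ N + 4 * a"
proof -
  have pos: "c ^ N > 0" using c by simp
  have "X \<noteq> 0"
  proof
    assume "X = 0"
    hence "c ^ N = 0" unfolding eq[symmetric] by simp
    thus False using pos by (simp only: less_irrefl)
  qed
  hence X2: "X^2 > 0" by simp
  have Q: "X^2 - a > 0" using pos X2 eq by (metis mult_pos_pos zero_less_mult_pos zero_less_numeral)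
  have "coprime (X^2) (X^2 - a)"
  proof (rule coprimeI)
    fix d assume d: "d dvd X^2" "d dvd X^2 - a"
    hence "d dvd X^2 - (X^2 - a)" by (rule dvd_diff)
    hence "d dvd a" by simp
    moreover have "d dvd c ^ N" unfolding eq[symmetric] using d(1) by simp
    moreover have "coprime a (c ^ N)" using cop by simp
    ultimately show "is_unit d" by (metis coprime_common_divisor)
  qed
  show thesis
  proof (cases "even X")
    case False
    have o: "odd (X^2)" using False by simp
    have four: "(4::int) = 2^2" by simp
    have "coprime (X^2) 4" unfolding four coprime_power_right_iff using o by simp
    hence "coprime (X^2) (4 * (X^2 - a))" using \<open>coprime (X^2) (X^2 - a)\<close> by (simp only: coprime_mult_right_iff)
    moreover have "X^2 * (4 * (X^2 - a)) = c ^ N" unfolding eq[symmetric] by (simp only: mult_ac)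
    moreover have "4 * (X^2 - a) > 0" "N > 0" using Q N by simp_all
    ultimately obtain u w where uw: "X^2 = u ^ N" "4 * (X^2 - a) = w ^ N" "c = u * w" "u > 0" "w > 0"
      using coprime_mult_eq_power_int[OF _ _ X2 _ c] by blast
    obtain t where t: "u = t^2" "t > 0" using odd_power_eq_square_int uw(1,4) N by metis
    have "even (w ^ N)" using uw(2) by (metis dvd_mult2 even_numeral)
    hence ew: "even w" by (simp only: even_power)
    have ot: "odd t"
    proof
      assume "even t"
      hence "even (u ^ N)" using t(1) N by (simp only: even_power) simp
      thus False using o uw(1) by simp
    qed
    have "4 * (t^2) ^ N = w ^ N + 4 * a" unfolding t(1)[symmetric] uw(1)[symmetric] uw(2)[symmetric] by simp
    moreover have "c = t^2 * w" using uw(3) unfolding t(1) .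
    ultimately show thesis using odd ot ew t(2) uw(5) by blast
  next
    case True
    have o: "odd (X^2 - a)"
    proof
      assume "even (X^2 - a)"
      moreover have "even (X^2)" using True by simp
      ultimately have "is_unit (2::int)" using \<open>coprime (X^2) (X^2 - a)\<close> by (metis coprime_common_divisor)
      thus False by simp
    qed
    have four: "(4::int) = 2^2" by simp
    have "coprime 4 (X^2 - a)" unfolding four coprime_power_left_iff using o by simp
    hence "coprime (4 * X^2) (X^2 - a)" using \<open>coprime (X^2) (X^2 - a)\<close> by (simp only: coprime_mult_left_iff)
    moreover have "4 * X^2 * (X^2 - a) = c ^ N" unfolding eq[symmetric] by (simp only: mult_ac)
    moreover have "4 * X^2 > 0" "N > 0" using X2 N by simp_all
    ultimately obtain w u where uw: "4 * X^2 = w ^ N" "X^2 - a = u ^ N" "c = w * u" "w > 0" "u > 0"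
      using coprime_mult_eq_power_int[OF _ _ _ Q c] by blast
    have "(2 * X)^2 = w ^ (2 * M + 1)" using uw(1) N by (simp add: power_mult_distrib)
    then obtain t where t: "w = t^2" "t > 0" using odd_power_eq_square_int uw(4) by metis
    have "even (w ^ N)" unfolding uw(1)[symmetric] by simp
    hence et: "even t" unfolding t(1) by (simp only: even_power)
    have ou: "odd u"
    proof
      assume "even u"
      hence "even (u ^ N)" using N by (simp only: even_power) simp
      thus False using o uw(2) by simp
    qed
    have "(t^2) ^ N = 4 * u ^ N + 4 * a" unfolding t(1)[symmetric] uw(1)[symmetric] uw(2)[symmetric] by simp
    moreover have "c = t^2 * u" using uw(3) unfolding t(1) .
    ultimately show thesis using even et ou t(2) uw(5) by blast
  qed
qed

text \<open>The cofactor 1 + u + ... + u^(N-1) is a sum of an odd number of odd terms.\<close>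

lemma odd_power_diff_two_power_dvd:
  fixes u :: int
  assumes "odd u" "odd N" "2 ^ j dvd u ^ N - 1"
  shows "2 ^ j dvd u - 1"
proof -
  have "u ^ N - 1 = (u - 1) * (\<Sum>i<N. u ^ i)" by (simp add: power_diff_1_eq)
  moreover have "odd (\<Sum>i<N. u ^ i)"
  proof -
    have "even (\<Sum>i<k. u ^ i) \<longleftrightarrow> even k" for k by (induction k) (use assms(1) in auto)
    thus ?thesis using assms(2) by simp
  qed
  hence "coprime (2 ^ j) (\<Sum>i<N. u ^ i)" by (simp add: coprime_left_2_iff_odd)
  ultimately show ?thesis using assms(3) by (metis coprime_dvd_mult_left_iff)
qed

text \<open>The equation is read modulo t^2, u and 2^n, where a = 1 because a = 1 modulo c and 4
  divides c. With t = 2s, division by 4 gives u^N + a = s^2 (t^2)^K for K = N - 1, still divisible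
  by t^2 and 2^n.\<close>

lemma even_case_dvd:
  fixes t u c :: int
  assumes n: "n \<ge> 2" and N: "N = 2^n - 1" and c: "c = t^2 * u" and t: "even t" and u: "odd u"
    and eq: "(t^2) ^ N = 4 * u ^ N + 4 * orbit_num c n"
  shows "t^2 dvd u ^ N + 1" "u dvd (t^2) ^ N - 4" "2 ^ n dvd u + 1"
proof -
  let ?a = "orbit_num c n" and ?w = "t^2"
  obtain k where k: "n = k + 2" using n by (metis add.commute le_Suc_ex)
  define K where "K = 2^n - (2::nat)"
  have n4: "4 \<le> (2::nat) ^ n" using power_increasing[OF n, of "2::nat"] by simp
  have K: "N = Suc K" "K \<ge> 1" using n4 unfolding N K_def by simp_all
  have nK: "n \<le> 2 * K" using less_exp[of n] n4 unfolding K_def by arith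
  obtain s where s: "t = 2 * s" using t by (elim evenE)
  have w: "?w = 4 * s^2" unfolding s by (simp add: power_mult_distrib)
  have "4 * (s^2 * ?w ^ K) = ?w ^ N" unfolding K(1) power_Suc by (subst (2) w) simp
  hence sum: "u ^ N + ?a = s^2 * ?w ^ K" using eq by linarith
  have a1: "c dvd ?a - 1" using dvd_orbit_num_minus_1[of c "Suc k"] unfolding k by simp
  have "?w dvd s^2 * ?w ^ K" using K(2) by (intro dvd_mult dvd_power) simp
  moreover have "?w dvd ?a - 1" using a1 unfolding c by (rule dvd_mult_left)
  ultimately have "?w dvd s^2 * ?w ^ K - (?a - 1)" by (rule dvd_diff)
  also have "s^2 * ?w ^ K - (?a - 1) = u ^ N + 1" using sum by linarith
  finally show "?w dvd u ^ N + 1" .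
  have "u dvd 4 * u ^ N" using K by (intro dvd_mult dvd_power) simp
  moreover have "u dvd 4 * (?a - 1)" using a1 unfolding c by (metis dvd_mult dvd_mult_right)
  ultimately have "u dvd 4 * u ^ N + 4 * (?a - 1)" by (rule dvd_add)
  also have "4 * u ^ N + 4 * (?a - 1) = ?w ^ N - 4" unfolding eq by simp
  finally show "u dvd ?w ^ N - 4" .
  have "(2::int) ^ 2 dvd c" unfolding c w by simp
  hence "2 ^ n dvd ?a - 1" using two_power_dvd_orbit_num_minus_1[of 2 c k] unfolding k by (simp add: add.commute)
  moreover have "2 ^ n dvd s^2 * ?w ^ K"
  proof -
    have "(2::int) ^ n dvd 2 ^ (2 * K)" using nK by (rule le_imp_power_dvd)
    also have "(2::int) ^ (2 * K) = 4 ^ K" by (simp add: power_mult)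
    also have "(4::int) ^ K dvd ?w ^ K" unfolding w by (intro dvd_power_same) simp
    finally show ?thesis by (rule dvd_mult)
  qed
  ultimately have "2 ^ n dvd s^2 * ?w ^ K - (?a - 1)" by (metis dvd_diff)
  also have "s^2 * ?w ^ K - (?a - 1) = u ^ N + 1" using sum by linarith
  finally have "2 ^ n dvd - (u ^ N + 1)" by (simp only: dvd_minus_iff)
  moreover have oN: "odd N" using n unfolding N by simp
  ultimately have d: "2 ^ n dvd (- u) ^ N - 1" by simp
  have "odd (- u)" using u by simp
  from odd_power_diff_two_power_dvd[OF this oN d] have "2 ^ n dvd - u - 1" .
  also have "- u - 1 = - (u + 1)" by simp
  finally show "2 ^ n dvd u + 1" by (simp only: dvd_minus_iff)
qed

text \<open>As in the even case, but c is only known to be divisible by 2, which costs one power of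
  2.\<close>

lemma odd_case_dvd:
  fixes t w c :: int
  assumes n: "n \<ge> 2" and N: "N = 2^n - 1" and c: "c = t^2 * w" and t: "odd t" and w: "even w"
    and eq: "4 * (t^2) ^ N = w ^ N + 4 * orbit_num c n"
  shows "w dvd (t^2) ^ N - 1" "t^2 dvd w ^ N + 4" "2 ^ (n - 1) dvd t^2 - 1"
proof -
  let ?a = "orbit_num c n" and ?u = "t^2"
  obtain k where k: "n = k + 2" using n by (metis add.commute le_Suc_ex)
  define K where "K = 2^n - (3::nat)"
  have n4: "4 \<le> (2::nat) ^ n" using power_increasing[OF n, of "2::nat"] by simp
  have K: "N = Suc (Suc K)" "K \<ge> 1" using n4 unfolding N K_def by simp_all
  have nK: "n - 1 \<le> K"
  proof -
    have "k < 2 ^ k" by (rule less_exp)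
    moreover have "2 ^ n = 4 * (2 ^ k :: nat)" unfolding k by simp
    ultimately show ?thesis unfolding K_def k by arith
  qed
  obtain s where s: "w = 2 * s" using w by (elim evenE)
  have "4 * (s^2 * w ^ K) = w ^ N" unfolding K(1) power_Suc by (simp add: s power2_eq_square)
  hence sum: "?u ^ N - ?a = s^2 * w ^ K" using eq by linarith
  have a1: "c dvd ?a - 1" using dvd_orbit_num_minus_1[of c "Suc k"] unfolding k by simp
  have "w dvd s^2 * w ^ K" using K(2) by (intro dvd_mult dvd_power) simp
  moreover have "w dvd ?a - 1" using a1 unfolding c by (rule dvd_mult_right)
  ultimately have "w dvd s^2 * w ^ K + (?a - 1)" by (rule dvd_add)
  also have "s^2 * w ^ K + (?a - 1) = ?u ^ N - 1" using sum by linarith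
  finally show "w dvd ?u ^ N - 1" .
  have "?u dvd 4 * ?u ^ N" using K by (intro dvd_mult dvd_power) simp
  moreover have "?u dvd 4 * (?a - 1)" using a1 unfolding c by (metis dvd_mult dvd_mult_left)
  ultimately have "?u dvd 4 * ?u ^ N - 4 * (?a - 1)" by (rule dvd_diff)
  also have "4 * ?u ^ N - 4 * (?a - 1) = w ^ N + 4" unfolding eq by simp
  finally show "?u dvd w ^ N + 4" .
  have "(2::int) ^ 1 dvd c" unfolding c using w by simp
  hence "2 ^ (n - 1) dvd ?a - 1" using two_power_dvd_orbit_num_minus_1[of 1 c k] unfolding k by (simp add: add.commute)
  moreover have "2 ^ (n - 1) dvd s^2 * w ^ K"
  proof -
    have "(2::int) ^ (n - 1) dvd 2 ^ K" using nK by (rule le_imp_power_dvd)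
    also have "(2::int) ^ K dvd w ^ K" using w by (intro dvd_power_same)
    finally show ?thesis by (rule dvd_mult)
  qed
  ultimately have "2 ^ (n - 1) dvd s^2 * w ^ K + (?a - 1)" by (metis dvd_add)
  also have "s^2 * w ^ K + (?a - 1) = ?u ^ N - 1" using sum by linarith
  finally have d: "2 ^ (n - 1) dvd ?u ^ N - 1" .
  have "odd N" "odd ?u" using n t unfolding N by simp_all
  from odd_power_diff_two_power_dvd[OF this(2,1) d] show "2 ^ (n - 1) dvd ?u - 1" .
qed

section \<open>Bounding the ratio of the two parts of c\<close>

lemma power_add_ge:
  fixes u d :: int
  assumes "u \<ge> 0" "d \<ge> 0"
  shows "u ^ Suc n + int (Suc n) * d * u ^ n \<le> (u + d) ^ Suc n"
proof (induction n)
  case (Suc n)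
  have "u ^ Suc (Suc n) + int (Suc (Suc n)) * d * u ^ Suc n
      \<le> (u ^ Suc n + int (Suc n) * d * u ^ n) * (u + d)"
    using assms by (simp add: algebra_simps)
  also have "\<dots> \<le> (u + d) ^ Suc n * (u + d)" using Suc assms by (intro mult_right_mono) auto
  finally show ?case by (simp add: mult.commute)
qed simp

text \<open>Here p/q <= 4^(1/N) < w/u, compared through N-th powers so that no roots occur.\<close>

lemma root_window_lower:
  fixes p q u w :: int
  assumes "p ^ N \<le> 4 * q ^ N" "4 * u ^ N < w ^ N" "u \<ge> 0" "w \<ge> 0" "q > 0" "p \<ge> 0"
  shows "p * u < q * w"
proof (rule power_less_imp_less_base)
  have "(p * u) ^ N \<le> 4 * q ^ N * u ^ N" unfolding power_mult_distrib using assms by (intro mult_right_mono) auto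
  also have "\<dots> = q ^ N * (4 * u ^ N)" by simp
  also have "\<dots> < q ^ N * w ^ N" using assms by (intro mult_strict_left_mono) auto
  finally show "(p * u) ^ N < (q * w) ^ N" by (simp only: power_mult_distrib)
qed (use assms in simp)

lemma root_window_upper:
  fixes p q u w :: int
  assumes "4 * q ^ N \<le> p ^ N" "w ^ N < 4 * u ^ N" "u \<ge> 0" "w \<ge> 0" "q > 0" "p \<ge> 0"
  shows "q * w < p * u"
proof (rule power_less_imp_less_base)
  have "(q * w) ^ N < q ^ N * (4 * u ^ N)" unfolding power_mult_distrib using assms by (intro mult_strict_left_mono) auto
  also have "\<dots> = 4 * q ^ N * u ^ N" by simp
  also have "\<dots> \<le> p ^ N * u ^ N" using assms by (intro mult_right_mono) auto
  finally show "(q * w) ^ N < (p * u) ^ N" by (simp only: power_mult_distrib)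
qed (use assms in simp)

text \<open>\<open>w\<close> is the even square t^2, and c = w u. The error a is at most 2 c^M with
  M = (N - 1)/2, so w/u exceeds 4^(1/N) only slightly.\<close>

locale even_case =
  fixes u w a :: int and N M :: nat
  assumes N: "N = 2 * M + 1" and M: "M \<ge> 1" and u5: "u \<ge> 5" and w0: "w > 0"
    and eq: "w ^ N = 4 * u ^ N + 4 * a" and a0: "a > 0" and a_le: "a \<le> 2 * (w * u) ^ M"
begin

lemma gt: "4 * u ^ N < w ^ N" using eq a0 by simp

lemma u_less_w: "u < w"
proof (rule power_less_imp_less_base)
  have "u ^ N > 0" using u5 by simp
  thus "u ^ N < w ^ N" using gt by linarith
qed (use w0 in simp)

lemma split_eq: "w * (w ^ M)^2 \<le> 4 * u * (u ^ M)^2 + 8 * (w ^ M * u ^ M)"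
proof -
  have x: "x ^ N = x * (x ^ M)^2" for x :: int unfolding N by (simp add: power_mult[symmetric] mult.commute)
  have "w * (w ^ M)^2 = 4 * u * (u ^ M)^2 + 4 * a" using eq unfolding x by simp
  moreover have "a \<le> 2 * (w ^ M * u ^ M)" using a_le by (simp only: power_mult_distrib)
  ultimately show ?thesis by linarith
qed

text \<open>The quotient (w/u)^M should be near 4^(M/N) < 2; the constant 3 leaves enough room for
  the error a already at u = 5.\<close>

lemma ratio: "w ^ M < 3 * u ^ M"
proof (rule ccontr)
  define W where "W = w ^ M"
  define U where "U = u ^ M"
  assume "\<not> ?thesis"
  hence UW: "3 * U \<le> W" unfolding W_def U_def by simp
  have U0: "U > 0" unfolding U_def using u5 by simp
  have "9 * (w * W^2) \<le> 36 * u * U^2 + 72 * (W * U)"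
    using split_eq unfolding W_def[symmetric] U_def[symmetric] by (simp add: algebra_simps)
  also have "36 * u * U^2 = 4 * u * (3 * U)^2" by (simp add: power_mult_distrib)
  also have "\<dots> \<le> 4 * u * W^2" using UW U0 u5 by (intro mult_left_mono power_mono) auto
  also have "72 * (W * U) = 24 * W * (3 * U)" by simp
  also have "24 * W * (3 * U) \<le> 24 * W * W" using UW U0 by (intro mult_left_mono) auto
  finally have "(9 * w) * W^2 \<le> (4 * u + 24) * W^2" by (simp add: algebra_simps power2_eq_square)
  hence "9 * w \<le> 4 * u + 24" using UW U0 by (simp add: mult_le_cancel_right)
  thus False using u_less_w u5 by simp
qed

lemma w_le: "w \<le> 3 * u"
proof (rule ccontr)
  assume "\<not> w \<le> 3 * u"
  hence "(3 * u) ^ M < w ^ M" using u5 M by (intro power_strict_mono) auto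
  moreover have "3 ^ 1 * u ^ M \<le> 3 ^ M * u ^ M" using u5 M by (intro mult_right_mono power_increasing) auto
  ultimately show False using ratio by (simp add: power_mult_distrib)
qed

text \<open>The error 4a is below 24 u^(2M), while replacing u by u + d adds at least 4 N d u^(2M)
  to 4 u^N. Hence N d >= 6.\<close>

lemma window_upper:
  assumes "4 * q ^ N \<le> p ^ N" "q > 0" "p \<ge> 0" "d \<ge> 0" "int N * d \<ge> 6"
  shows "q * w < p * (u + d)"
proof (rule root_window_upper[OF assms(1)])
  have "u ^ N + int N * d * u ^ (2 * M) \<le> (u + d) ^ N"
    using power_add_ge[of u d "2 * M"] u5 assms(4) unfolding N by simp
  moreover have "a < int N * d * u ^ (2 * M)"
  proof -
    have "a \<le> 2 * (w ^ M * u ^ M)" using a_le by (simp only: power_mult_distrib)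
    also have "\<dots> < 2 * (3 * u ^ M * u ^ M)" using ratio u5 by (intro mult_strict_left_mono mult_strict_right_mono) auto
    also have "2 * (3 * u ^ M * u ^ M) = 6 * (u ^ M * u ^ M)" by simp
    also have "u ^ M * u ^ M = u ^ (2 * M)" by (simp only: mult_2 power_add)
    also have "6 * u ^ (2 * M) \<le> int N * d * u ^ (2 * M)" using assms(5) u5 by (intro mult_right_mono) auto
    finally show ?thesis .
  qed
  ultimately show "w ^ N < 4 * (u + d) ^ N" using eq by linarith
qed (use assms u5 w0 in auto)

text \<open>From (w/u)^M < 3 and Bernoulli, M (w - u) <= 2u. The value 63 is M for n = 7.\<close>

lemma w_bound:
  assumes "63 \<le> M"
  shows "63 * w \<le> 65 * u"
proof -
  obtain K where K: "M = Suc K" using assms by (cases M) auto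
  have "u ^ M + int M * (w - u) * u ^ K \<le> w ^ M"
    using power_add_ge[of u "w - u" K] u5 u_less_w unfolding K by simp
  also have "\<dots> \<le> 3 * u ^ M" using ratio by simp
  finally have "int M * (w - u) * u ^ K \<le> (2 * u) * u ^ K" unfolding K by simp
  hence "int M * (w - u) \<le> 2 * u" using u5 by (simp add: mult_le_cancel_right)
  moreover have "63 * (w - u) \<le> int M * (w - u)" using assms u_less_w by (intro mult_right_mono) auto
  ultimately show ?thesis by simp
qed

lemma power_bound: "u * w ^ N < (4 * u + 24) * u ^ N"
proof -
  have "a \<le> 2 * (w ^ M * u ^ M)" using a_le by (simp only: power_mult_distrib)
  also have "\<dots> < 2 * (3 * u ^ M * u ^ M)" using ratio u5 by (intro mult_strict_left_mono mult_strict_right_mono) auto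
  also have "2 * (3 * u ^ M * u ^ M) = 6 * (u ^ M * u ^ M)" by simp
  also have "u ^ M * u ^ M = u ^ (2 * M)" by (simp only: mult_2 power_add)
  finally have "u * (4 * a) < u * (24 * u ^ (2 * M))" using u5 by (intro mult_strict_left_mono) auto
  also have "\<dots> = 24 * u ^ N" unfolding N by simp
  finally show ?thesis unfolding eq by (simp add: algebra_simps)
qed

end

text \<open>Now \<open>u\<close> is the odd square t^2 and w the even cofactor; w/u lies slightly
  below 4^(1/N).\<close>

locale odd_case =
  fixes u w a :: int and N M :: nat
  assumes N: "N = 2 * M + 1" and M: "M \<ge> 1" and u5: "u \<ge> 5" and w0: "w > 0"
    and eq: "4 * u ^ N = w ^ N + 4 * a" and a0: "a > 0" and a_le: "a \<le> 2 * (u * w) ^ M"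
begin

lemma lt: "w ^ N < 4 * u ^ N" using eq a0 by simp

lemma u_less_w:
  assumes "u \<noteq> w"
  shows "u < w"
proof (rule ccontr)
  assume "\<not> ?thesis"
  hence wu: "w \<le> u" by simp
  have "w ^ N \<le> u ^ N" using wu w0 by (intro power_mono) auto
  moreover have "(u * w) ^ M \<le> (u * u) ^ M" using wu w0 u5 by (intro power_mono mult_left_mono) auto
  ultimately have "3 * u ^ N \<le> 8 * (u * u) ^ M" using eq a_le by linarith
  also have "(u * u) ^ M = u ^ (2 * M)" by (simp add: mult_2 power_add power_mult_distrib)
  finally have "(3 * u) * u ^ (2 * M) \<le> 8 * u ^ (2 * M)" unfolding N by simp
  hence "3 * u \<le> 8" using u5 by (simp add: mult_le_cancel_right)
  thus False using u5 by simp
qed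

text \<open>Here 4a < 8 w^(2M), which w + d absorbs once N d >= 8.\<close>

lemma window_lower:
  assumes "p ^ N \<le> 4 * q ^ N" "q > 0" "p \<ge> 0" "d \<ge> 0" "int N * d \<ge> 8" "u \<noteq> w"
  shows "p * u < q * (w + d)"
proof (rule root_window_lower[OF assms(1)])
  have "w ^ N + int N * d * w ^ (2 * M) \<le> (w + d) ^ N"
    using power_add_ge[of w d "2 * M"] w0 assms(4) unfolding N by simp
  moreover have "4 * a < int N * d * w ^ (2 * M)"
  proof -
    have "4 * a \<le> 8 * (u ^ M * w ^ M)" using a_le by (simp add: power_mult_distrib)
    also have "\<dots> < 8 * (w ^ M * w ^ M)"
      using u_less_w[OF assms(6)] u5 M w0 by (intro mult_strict_left_mono mult_strict_right_mono power_strict_mono) auto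
    also have "w ^ M * w ^ M = w ^ (2 * M)" by (simp only: mult_2 power_add)
    also have "8 * w ^ (2 * M) \<le> int N * d * w ^ (2 * M)" using assms(5) w0 by (intro mult_right_mono) auto
    finally show ?thesis .
  qed
  ultimately show "4 * u ^ N < (w + d) ^ N" using eq by linarith
qed (use assms u5 w0 in auto)

lemma w_bound:
  assumes "127 \<le> N" "u \<noteq> w"
  shows "127 * w \<le> 130 * u"
proof -
  obtain K where K: "N = Suc K" using assms by (cases N) auto
  have "u ^ N + int N * (w - u) * u ^ K \<le> w ^ N"
    using power_add_ge[of u "w - u" K] u5 u_less_w[OF assms(2)] unfolding K by simp
  also have "\<dots> \<le> 4 * u ^ N" using lt by simp
  finally have "int N * (w - u) * u ^ K \<le> (3 * u) * u ^ K" unfolding K by simp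
  hence "int N * (w - u) \<le> 3 * u" using u5 by (simp add: mult_le_cancel_right)
  moreover have "127 * (w - u) \<le> int N * (w - u)" using assms u_less_w by (intro mult_right_mono) auto
  ultimately show ?thesis by simp
qed

lemma power_bound:
  assumes "u \<noteq> w"
  shows "(4 * u - 16) * u ^ N < u * w ^ N"
proof -
  have "w ^ M < 2 * u ^ M"
  proof (rule ccontr)
    assume "\<not> ?thesis"
    hence "2 * u ^ M \<le> w ^ M" by simp
    hence "(2 * u ^ M)^2 \<le> (w ^ M)^2" using u5 by (intro power_mono) auto
    moreover have "(2 * u ^ M)^2 = 4 * u ^ (2 * M)" "(w ^ M)^2 = w ^ (2 * M)"
      by (simp_all add: power_mult_distrib power_mult[symmetric] mult.commute)
    ultimately have "4 * u ^ (2 * M) \<le> w ^ (2 * M)" by simp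
    hence "u * (4 * u ^ (2 * M)) \<le> w * w ^ (2 * M)"
      using u_less_w[OF assms] u5 w0 by (intro mult_mono) simp_all
    thus False using lt unfolding N by simp
  qed
  have "4 * a \<le> 8 * (u ^ M * w ^ M)" using a_le by (simp add: power_mult_distrib)
  also have "\<dots> < 8 * (u ^ M * (2 * u ^ M))" using \<open>w ^ M < 2 * u ^ M\<close> u5 by (intro mult_strict_left_mono) auto
  also have "8 * (u ^ M * (2 * u ^ M)) = 16 * (u ^ M * u ^ M)" by simp
  also have "u ^ M * u ^ M = u ^ (2 * M)" by (simp only: mult_2 power_add)
  finally have "u * (4 * a) < u * (16 * u ^ (2 * M))" using u5 by (intro mult_strict_left_mono) auto
  also have "\<dots> = 16 * u ^ N" unfolding N by simp
  finally have "u * (4 * a) < 16 * u ^ N" .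
  moreover have "u * (4 * u ^ N) = u * w ^ N + u * (4 * a)" unfolding eq by (simp add: algebra_simps)
  ultimately show ?thesis by (simp add: algebra_simps)
qed

end

text \<open>A substitute for exp: Bernoulli's inequality is applied to each of 32 blocks of length
  2^(n-5), and the number (1 + \<beta>/32)^32, close to exp \<beta>, can be evaluated.\<close>

lemma bernoulli_block_upper:
  fixes u d \<beta> :: real
  assumes "n \<ge> 5" "u > 0" "d \<ge> 0" "\<beta> \<ge> 0" "\<beta> * u \<le> 2^n * d"
  shows "(1 + \<beta> / 32) ^ 32 * u ^ (2^n) \<le> (u + d) ^ (2^n)"
proof -
  define k where "k = n - 5"
  have "n = k + 5" using assms(1) unfolding k_def by simp
  hence n: "2 ^ n = 2 ^ k * (32::nat)" "(2::real) ^ n = 2 ^ k * 32" by (simp_all add: power_add)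
  have "\<beta> / 32 \<le> 2^k * (d / u)" using assms n by (simp add: field_simps)
  hence "1 + \<beta> / 32 \<le> 1 + real (2^k) * (d / u)" by simp
  also have "\<dots> \<le> (1 + d / u) ^ (2^k)" using assms by (intro Bernoulli_inequality) (simp add: field_simps)
  finally have "(1 + \<beta> / 32) ^ 32 \<le> ((1 + d / u) ^ (2^k)) ^ 32" using assms by (intro power_mono) auto
  hence "(1 + \<beta> / 32) ^ 32 * u ^ (2^n) \<le> (1 + d / u) ^ (2^n) * u ^ (2^n)"
    using assms by (intro mult_right_mono) (auto simp: n power_mult)
  also have "\<dots> = ((1 + d / u) * u) ^ (2^n)" by (simp only: power_mult_distrib)
  also have "(1 + d / u) * u = u + d" using assms by (simp add: field_simps)
  finally show ?thesis .
qed

lemma bernoulli_block_lower: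
  fixes w d \<beta> :: real
  assumes "n \<ge> 5" "w > 0" "0 \<le> d" "d \<le> w" "\<beta> \<le> 32" "2^n * d \<le> \<beta> * w"
  shows "(1 - \<beta> / 32) ^ 32 * w ^ (2^n) \<le> (w - d) ^ (2^n)"
proof -
  define k where "k = n - 5"
  have "n = k + 5" using assms(1) unfolding k_def by simp
  hence n: "2 ^ n = 2 ^ k * (32::nat)" "(2::real) ^ n = 2 ^ k * 32" by (simp_all add: power_add)
  have "2^k * (d / w) \<le> \<beta> / 32" using assms n by (simp add: field_simps)
  hence "1 - \<beta> / 32 \<le> 1 + real (2^k) * (- (d / w))" by simp
  also have "\<dots> \<le> (1 + - (d / w)) ^ (2^k)" using assms by (intro Bernoulli_inequality) (simp add: field_simps)
  finally have "(1 - \<beta> / 32) ^ 32 \<le> ((1 - d / w) ^ (2^k)) ^ 32" using assms by (intro power_mono) auto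
  hence "(1 - \<beta> / 32) ^ 32 * w ^ (2^n) \<le> (1 - d / w) ^ (2^n) * w ^ (2^n)"
    using assms by (intro mult_right_mono) (auto simp: n power_mult)
  also have "\<dots> = ((1 - d / w) * w) ^ (2^n)" by (simp only: power_mult_distrib)
  also have "(1 - d / w) * w = w - d" using assms by (simp add: field_simps)
  finally show ?thesis .
qed

section \<open>Positive c: excluding the candidates\<close>

text \<open>Since (w/u)^(2^n) is near 4, 2^n (w - u)/u is near log 4 = 1.386. The enclosing values
  1.3 and 1.7 satisfy (1 - 1.3/32)^32 >= 1/4 and (1 + 1.7/32)^32 >= 5, while (w/u)^(N+1) is below
  (65/63)(4 + 24/u) < 5 for u >= 127.\<close>

lemma (in even_case) crude_window:
  assumes n: "n \<ge> 7" and Nn: "N = 2^n - 1" and u: "u \<ge> 127"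
  shows "13 * w < 10 * 2^n * (w - u)" "10 * 2^n * (w - u) < 17 * u"
proof -
  have n2: "2 ^ n = Suc N" unfolding Nn by simp
  have M63: "63 \<le> M"
  proof -
    have "(2::nat) ^ 7 \<le> 2 ^ n" using n by (intro power_increasing) auto
    thus ?thesis using N n2 by simp
  qed
  let ?u = "real_of_int u" and ?w = "real_of_int w"
  have pos: "?u > 0" "?w > 0" "?u < ?w" using u u_less_w by simp_all
  have gt': "4 * ?u ^ N < ?w ^ N" 
  proof -
    have "real_of_int (4 * u ^ N) < real_of_int (w ^ N)" using gt by (simp only: of_int_less_iff)
    thus ?thesis by simp
  qed
  show "13 * w < 10 * 2^n * (w - u)"
  proof (rule ccontr)
    assume "\<not> ?thesis"
    hence "10 * 2^n * (w - u) \<le> 13 * w" by simp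
    hence "real_of_int (10 * 2^n * (w - u)) \<le> real_of_int (13 * w)" by (simp only: of_int_le_iff)
    hence "2^n * (?w - ?u) \<le> 13/10 * ?w" by simp
    hence "(1 - (13/10) / 32) ^ 32 * ?w ^ (2^n) \<le> (?w - (?w - ?u)) ^ (2^n)"
      using n pos by (intro bernoulli_block_lower) simp_all
    hence 1: "(1 - (13/10) / 32) ^ 32 * ?w ^ Suc N \<le> ?u ^ Suc N" unfolding n2 by simp
    have "4 * ?u ^ Suc N = ?u * (4 * ?u ^ N)" by simp
    also have "\<dots> < ?u * ?w ^ N" using gt' pos by (intro mult_strict_left_mono)
    also have "\<dots> \<le> ?w * ?w ^ N" using pos by (intro mult_right_mono) auto
    finally have "4 * ((1 - (13/10) / 32) ^ 32 * ?w ^ Suc N) < ?w ^ Suc N" using 1 by simp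
    moreover have "1/4 \<le> (1 - (13/10) / 32 :: real) ^ 32" by (simp add: power_divide)
    hence "1/4 * ?w ^ Suc N \<le> (1 - (13/10) / 32) ^ 32 * ?w ^ Suc N" using pos by (intro mult_right_mono) auto
    ultimately show False by linarith
  qed
  show "10 * 2^n * (w - u) < 17 * u"
  proof (rule ccontr)
    assume "\<not> ?thesis"
    hence "17 * u \<le> 10 * 2^n * (w - u)" by simp
    hence "real_of_int (17 * u) \<le> real_of_int (10 * 2^n * (w - u))" by (simp only: of_int_le_iff)
    hence "17/10 * ?u \<le> 2^n * (?w - ?u)" by simp
    hence "(1 + (17/10) / 32) ^ 32 * ?u ^ (2^n) \<le> (?u + (?w - ?u)) ^ (2^n)"
      using n pos by (intro bernoulli_block_upper) simp_all
    hence 1: "(1 + (17/10) / 32) ^ 32 * ?u ^ Suc N \<le> ?w ^ Suc N" unfolding n2 by simp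
    have "5 \<le> (1 + (17/10) / 32 :: real) ^ 32" by (simp add: power_divide)
    hence "5 * ?u ^ Suc N \<le> (1 + (17/10) / 32) ^ 32 * ?u ^ Suc N" using pos by (intro mult_right_mono) auto
    hence "5 * ?u ^ Suc N \<le> ?w ^ Suc N" using 1 by linarith
    hence "real_of_int (5 * u ^ Suc N) \<le> real_of_int (w ^ Suc N)" by simp
    hence "5 * u ^ Suc N \<le> w ^ Suc N" by (simp only: of_int_le_iff)
    hence "63 * u * (5 * u ^ Suc N) \<le> 63 * u * w ^ Suc N" using u by (intro mult_left_mono) auto
    also have "\<dots> = 63 * w * (u * w ^ N)" by simp
    also have "\<dots> \<le> 65 * u * (u * w ^ N)" using w_bound[OF M63] u w0 by (intro mult_right_mono) auto
    also have "\<dots> \<le> 65 * u * ((4 * u + 24) * u ^ N)" using power_bound u by (intro mult_left_mono) auto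
    finally have "(315 * u) * (u * u ^ N) \<le> (65 * (4 * u + 24)) * (u * u ^ N)" by (simp add: algebra_simps)
    hence "315 * u \<le> 65 * (4 * u + 24)" using u by (subst (asm) mult_le_cancel_right) auto
    thus False using u by simp
  qed
qed

text \<open>The same argument with 1.2 and 1.5: the powers pass 2/7 and 43/10, while (w/u)^N > 4 -
  16/u >= 7/2 for u >= 32 and (w/u)^(N+1) < 4 (130/127) < 43/10.\<close>

lemma (in odd_case) crude_window:
  assumes n: "n \<ge> 7" and Nn: "N = 2^n - 1" and u: "u \<ge> 32" and uw: "u \<noteq> w"
  shows "6 * w < 5 * 2^n * (w - u)" "2 * 2^n * (w - u) < 3 * u"
proof -
  have n2: "2 ^ n = Suc N" unfolding Nn by simp
  have N127: "127 \<le> N"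
  proof -
    have "(2::nat) ^ 7 \<le> 2 ^ n" using n by (intro power_increasing) auto
    thus ?thesis using n2 by simp
  qed
  let ?u = "real_of_int u" and ?w = "real_of_int w"
  have pos: "?u > 0" "?w > 0" "?u < ?w" using u u_less_w[OF uw] by simp_all
  show "6 * w < 5 * 2^n * (w - u)"
  proof (rule ccontr)
    assume "\<not> ?thesis"
    hence "5 * 2^n * (w - u) \<le> 6 * w" by simp
    hence "real_of_int (5 * 2^n * (w - u)) \<le> real_of_int (6 * w)" by (simp only: of_int_le_iff)
    hence "2^n * (?w - ?u) \<le> 6/5 * ?w" by simp
    hence "(1 - (6/5) / 32) ^ 32 * ?w ^ (2^n) \<le> (?w - (?w - ?u)) ^ (2^n)"
      using n pos by (intro bernoulli_block_lower) simp_all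
    hence 1: "(1 - (6/5) / 32) ^ 32 * ?w ^ Suc N \<le> ?u ^ Suc N" unfolding n2 by simp
    have "2/7 \<le> (1 - (6/5) / 32 :: real) ^ 32" by (simp add: power_divide)
    hence "2/7 * ?w ^ Suc N \<le> (1 - (6/5) / 32) ^ 32 * ?w ^ Suc N" using pos by (intro mult_right_mono) auto
    hence "2 * ?w ^ Suc N \<le> 7 * ?u ^ Suc N" using 1 by linarith
    hence "real_of_int (2 * w ^ Suc N) \<le> real_of_int (7 * u ^ Suc N)" by simp
    hence "2 * w ^ Suc N \<le> 7 * u ^ Suc N" by (simp only: of_int_le_iff)
    also have "7 * u ^ Suc N = 7 * u * u ^ N" by simp
    also have "7 * u * u ^ N \<le> 2 * (4 * u - 16) * u ^ N" using u by (intro mult_right_mono) auto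
    also have "2 * (4 * u - 16) * u ^ N = 2 * ((4 * u - 16) * u ^ N)" by (simp only: mult.assoc)
    also have "\<dots> < 2 * (u * w ^ N)" using power_bound[OF uw] by (intro mult_strict_left_mono) simp_all
    also have "\<dots> \<le> 2 * (w * w ^ N)" using u_less_w[OF uw] w0 by simp
    finally show False by simp
  qed
  show "2 * 2^n * (w - u) < 3 * u"
  proof (rule ccontr)
    assume "\<not> ?thesis"
    hence "3 * u \<le> 2 * 2^n * (w - u)" by simp
    hence "real_of_int (3 * u) \<le> real_of_int (2 * 2^n * (w - u))" by (simp only: of_int_le_iff)
    hence "3/2 * ?u \<le> 2^n * (?w - ?u)" by simp
    hence "(1 + (3/2) / 32) ^ 32 * ?u ^ (2^n) \<le> (?u + (?w - ?u)) ^ (2^n)"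
      using n pos by (intro bernoulli_block_upper) simp_all
    hence 1: "(1 + (3/2) / 32) ^ 32 * ?u ^ Suc N \<le> ?w ^ Suc N" unfolding n2 by simp
    have "43/10 \<le> (1 + (3/2) / 32 :: real) ^ 32" by (simp add: power_divide)
    hence "43/10 * ?u ^ Suc N \<le> (1 + (3/2) / 32) ^ 32 * ?u ^ Suc N" using pos by (intro mult_right_mono) auto
    hence "43 * ?u ^ Suc N \<le> 10 * ?w ^ Suc N" using 1 by linarith
    hence "real_of_int (43 * u ^ Suc N) \<le> real_of_int (10 * w ^ Suc N)" by simp
    hence "43 * u ^ Suc N \<le> 10 * w ^ Suc N" by (simp only: of_int_le_iff)
    also have "10 * w ^ Suc N = 10 * w * w ^ N" by simp
    also have "\<dots> \<le> 10 * w * (4 * u ^ N)" using lt w0 by (intro mult_left_mono) auto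
    finally have "(43 * u) * u ^ N \<le> (40 * w) * u ^ N" by simp
    hence "43 * u \<le> 40 * w" using u by (subst (asm) mult_le_cancel_right) auto
    thus False using w_bound[OF N127 uw] u by simp
  qed
qed

text \<open>The exponent is 2^n - 1, and 2^(n+1) - 1 = 2 (2^n - 1) + 1 costs one squaring and one
  multiplication.\<close>

fun pow_mod :: "int \<Rightarrow> nat \<Rightarrow> int \<Rightarrow> int" where
  "pow_mod b 0 m = 1"
| "pow_mod b (Suc n) m = (let x = pow_mod b n m in (x * x mod m) * b mod m)"

lemma pow_mod_cong: "[pow_mod b n m = b ^ (2^n - 1)] (mod m)"
proof (induction n)
  case (Suc n)
  let ?x = "pow_mod b n m" and ?e = "2^n - 1 :: nat"
  have e: "2 ^ Suc n - 1 = ?e + ?e + 1" using one_le_power[of "2::nat" n] unfolding power_Suc by arith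
  have "[pow_mod b (Suc n) m = ?x * ?x * b] (mod m)" by (simp add: cong_def Let_def mod_simps)
  also have "[?x * ?x * b = b ^ ?e * b ^ ?e * b] (mod m)" using Suc by (intro cong_mult cong_refl)
  also have "b ^ ?e * b ^ ?e * b = b ^ (2 ^ Suc n - 1)" unfolding e power_add by simp
  finally show ?case .
qed simp

lemma pow_mod_dvd_iff: "m dvd b ^ (2^n - 1) + s \<longleftrightarrow> (pow_mod b n m + s) mod m = 0"
proof -
  have "[pow_mod b n m + s = b ^ (2^n - 1) + s] (mod m)" by (intro cong_add pow_mod_cong cong_refl)
  thus ?thesis by (metis cong_dvd_iff cong_def cong_0_iff dvd_eq_mod_eq_0)
qed

text \<open>\<open>k\<close> stands for \<open>2\<^sup>n\<close>, \<open>s\<close> for the sign; the cheapest test comes first.\<close>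
definition excluded :: "int \<Rightarrow> nat \<Rightarrow> int \<Rightarrow> int \<Rightarrow> int \<Rightarrow> bool" where
  "excluded k n s u w = (if (u + s) mod k \<noteq> 0 then True
     else if (pow_mod u n w + s) mod w \<noteq> 0 then True else (pow_mod w n u - 4 * s) mod u \<noteq> 0)"

lemma not_excluded:
  assumes "k dvd u + s" "w dvd u ^ (2^n - 1) + s" "u dvd w ^ (2^n - 1) - 4 * s"
  shows "\<not> excluded k n s u w"
proof -
  have "(pow_mod w n u + (- 4 * s)) mod u = 0" using assms(3) unfolding pow_mod_dvd_iff[symmetric] by simp
  moreover have "(pow_mod u n w + s) mod w = 0" using assms(2) unfolding pow_mod_dvd_iff .
  ultimately show ?thesis using assms(1) unfolding excluded_def by (auto simp: dvd_eq_mod_eq_0)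
qed

fun even_excluded :: "int \<Rightarrow> nat \<Rightarrow> int \<Rightarrow> int list \<Rightarrow> bool" where
  "even_excluded k n w [] = True"
| "even_excluded k n w (u # us) = (if excluded k n 1 u w then even_excluded k n w us else False)"

text \<open>Here t = 2s and w = 4 s^2. With p/q and p'/q' below and above 4^(1/N), u lies between q'
  w/p' - d and q w/p, where d is the shift of \<open>window_upper\<close>.\<close>

fun even_windows :: "int \<Rightarrow> int \<Rightarrow> int \<Rightarrow> int \<Rightarrow> int \<Rightarrow> int \<Rightarrow> nat \<Rightarrow> int list \<Rightarrow> bool" where
  "even_windows p q p' q' d k n [] = True"
| "even_windows p q p' q' d k n (s # ss) = (let w = 4 * s * s in
     if even_excluded k n w [q' * w div p' - d .. q * w div p] then even_windows p q p' q' d k n ss else False)"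

fun odd_excluded :: "int \<Rightarrow> nat \<Rightarrow> int \<Rightarrow> int list \<Rightarrow> bool" where
  "odd_excluded k n u [] = True"
| "odd_excluded k n u (w # ws) =
     (if w mod 2 = 1 then odd_excluded k n u ws
      else if excluded k n (-1) u w then odd_excluded k n u ws else False)"

text \<open>Here t = 2s + 1. The condition that 2^(n-1) divides t^2 - 1 concerns t alone and is
  tested before a window is opened.\<close>

fun odd_windows :: "int \<Rightarrow> int \<Rightarrow> int \<Rightarrow> int \<Rightarrow> int \<Rightarrow> int \<Rightarrow> nat \<Rightarrow> int list \<Rightarrow> bool" where
  "odd_windows p q p' q' d k n [] = True"
| "odd_windows p q p' q' d k n (s # ss) = (let u = (2 * s + 1) * (2 * s + 1) in
     if (u - 1) mod k \<noteq> 0 then odd_windows p q p' q' d k n ss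
     else if odd_excluded k n u [p * u div q - d .. p' * u div q'] then odd_windows p q p' q' d k n ss else False)"

text \<open>Only the class of -1 modulo k = 2^n is enumerated, as u = k j - 1. The range of j in
  \<open>even_crude\<close> is computed from w alone and is slightly too wide, so the true window is
  tested again through \<open>d\<close>.\<close>

fun even_crude_excluded :: "int \<Rightarrow> nat \<Rightarrow> int \<Rightarrow> int list \<Rightarrow> bool" where
  "even_crude_excluded k n w [] = True"
| "even_crude_excluded k n w (j # js) = (let u = k * j - 1; d = 10 * k * (w - u) in
     if d \<le> 13 * w then even_crude_excluded k n w js
     else if 17 * u \<le> d then even_crude_excluded k n w js
     else if excluded k n 1 u w then even_crude_excluded k n w js else False)"

fun even_crude :: "int \<Rightarrow> nat \<Rightarrow> int list \<Rightarrow> bool" where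
  "even_crude k n [] = True"
| "even_crude k n (s # ss) = (let w = 4 * s * s in
     if even_crude_excluded k n w [(w - 17 * w div (10 * k)) div k .. (w + 1 - 13 * w div (10 * k)) div k]
     then even_crude k n ss else False)"

fun odd_crude :: "int \<Rightarrow> int \<Rightarrow> nat \<Rightarrow> int list \<Rightarrow> bool" where
  "odd_crude K k n [] = True"
| "odd_crude K k n (s # ss) = (let u = (2 * s + 1) * (2 * s + 1) in
     if (u - 1) mod k \<noteq> 0 then odd_crude K k n ss
     else if odd_excluded k n u [u + 6 * u div (5 * K) .. u + 3 * u div (2 * K)] then odd_crude K k n ss else False)"

lemma even_excluded_iff: "even_excluded k n w us \<longleftrightarrow> (\<forall>u\<in>set us. excluded k n 1 u w)"
  by (induction k n w us rule: even_excluded.induct) auto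

lemma even_windows_iff: "even_windows p q p' q' d k n ss \<longleftrightarrow>
    (\<forall>s\<in>set ss. \<forall>u\<in>{q' * (4 * s * s) div p' - d .. q * (4 * s * s) div p}. excluded k n 1 u (4 * s * s))"
  by (induction p q p' q' d k n ss rule: even_windows.induct) (auto simp: even_excluded_iff Let_def)

lemma odd_excluded_iff: "odd_excluded k n u ws \<longleftrightarrow> (\<forall>w\<in>set ws. odd w \<or> excluded k n (-1) u w)"
  by (induction k n u ws rule: odd_excluded.induct) (auto simp: odd_iff_mod_2_eq_one)

lemma odd_windows_iff: "odd_windows p q p' q' d k n ss \<longleftrightarrow>
    (\<forall>s\<in>set ss. \<not> k dvd (2 * s + 1) * (2 * s + 1) - 1 \<or>
      (\<forall>w\<in>{p * ((2 * s + 1) * (2 * s + 1)) div q - d .. p' * ((2 * s + 1) * (2 * s + 1)) div q'}.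
        odd w \<or> excluded k n (-1) ((2 * s + 1) * (2 * s + 1)) w))"
  by (induction p q p' q' d k n ss rule: odd_windows.induct) (auto simp: odd_excluded_iff Let_def dvd_eq_mod_eq_0)

lemma even_crude_excluded_iff: "even_crude_excluded k n w js \<longleftrightarrow>
    (\<forall>j\<in>set js. 10 * k * (w - (k * j - 1)) \<le> 13 * w \<or> 17 * (k * j - 1) \<le> 10 * k * (w - (k * j - 1))
      \<or> excluded k n 1 (k * j - 1) w)"
  by (induction k n w js rule: even_crude_excluded.induct) (auto simp: Let_def)

lemma even_crude_iff: "even_crude k n ss \<longleftrightarrow>
    (\<forall>s\<in>set ss. even_crude_excluded k n (4 * s * s)
       [(4 * s * s - 17 * (4 * s * s) div (10 * k)) div k .. (4 * s * s + 1 - 13 * (4 * s * s) div (10 * k)) div k])"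
  by (induction k n ss rule: even_crude.induct) (auto simp: Let_def)

lemma odd_crude_iff: "odd_crude K k n ss \<longleftrightarrow>
    (\<forall>s\<in>set ss. let u = (2 * s + 1) * (2 * s + 1) in \<not> k dvd u - 1 \<or>
      (\<forall>w\<in>{u + 6 * u div (5 * K) .. u + 3 * u div (2 * K)}. odd w \<or> excluded k n (-1) u w))"
  by (induction K k n ss rule: odd_crude.induct) (auto simp: odd_excluded_iff Let_def dvd_eq_mod_eq_0)

text \<open>The fractions enclose \<open>4\<close> to the power \<open>1 / (2\<^sup>n - 1)\<close>; they are best rational approximations.\<close>
lemma even_windows_checked:
  "even_windows 554 349 227 143 2 4 2 [1..117]"
  "even_windows 295 242 423 347 1 8 3 [1..117]"
  "even_windows 725 661 691 630 1 16 4 [1..117]"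
  "even_windows 343 328 160 153 1 32 5 [1..117]"
  "even_windows 46 45 367 359 1 64 6 [1..117]"
  by code_simp+

lemma odd_windows_checked:
  "odd_windows 554 349 227 143 3 2 2 [1..88]"
  "odd_windows 295 242 423 347 2 4 3 [1..88]"
  "odd_windows 725 661 691 630 1 8 4 [1..88]"
  "odd_windows 343 328 160 153 1 16 5 [1..88]"
  "odd_windows 46 45 367 359 1 32 6 [1..88]"
  by code_simp+

text \<open>2^n <= u + 1 <= 31623 stops at n = 14. The odd case needs n = 15 as well, because only
  2^(n-1) <= t^2 - 1 is known there.\<close>

lemma even_crude_checked:
  "even_crude 128 7 [1..117]"
  "even_crude 256 8 [1..117]"
  "even_crude 512 9 [1..117]"
  "even_crude 1024 10 [1..117]"
  "even_crude 2048 11 [1..117]"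
  "even_crude 4096 12 [1..117]"
  "even_crude 8192 13 [1..117]"
  "even_crude 16384 14 [1..117]"
  by code_simp+

lemma odd_crude_checked:
  "odd_crude 128 64 7 [1..88]"
  "odd_crude 256 128 8 [1..88]"
  "odd_crude 512 256 9 [1..88]"
  "odd_crude 1024 512 10 [1..88]"
  "odd_crude 2048 1024 11 [1..88]"
  "odd_crude 4096 2048 12 [1..88]"
  "odd_crude 8192 4096 13 [1..88]"
  "odd_crude 16384 8192 14 [1..88]"
  "odd_crude 32768 16384 15 [1..88]"
  by code_simp+

section \<open>Impossibility of the two exponential equations\<close>

lemma div_le_of_less:
  fixes a b p :: int
  assumes "p > 0" "a \<le> p * b"
  shows "a div p \<le> b"
  using zdiv_mono1[OF assms(2,1)] assms(1) by simp

lemma le_div_of_le: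
  fixes a b p :: int
  assumes "p > 0" "p * b \<le> a"
  shows "b \<le> a div p"
  using zdiv_mono1[OF assms(2,1)] assms(1) by simp

lemma small_cases: "2 \<le> n \<Longrightarrow> n \<le> 6 \<Longrightarrow> n = 2 \<or> n = 3 \<or> n = 4 \<or> n = 5 \<or> n = (6::nat)"
  by presburger

lemma large_cases: "7 \<le> n \<Longrightarrow> n \<le> 15 \<Longrightarrow>
    n = 7 \<or> n = 8 \<or> n = 9 \<or> n = 10 \<or> n = 11 \<or> n = 12 \<or> n = 13 \<or> n = 14 \<or> n = (15::nat)"
  by presburger

text \<open>The search is finite: u < w <= 3u and w u <= 10^9 bound t, 2^n | u + 1 bounds n, and for
  each t and n the window leaves few u, all refuted by the congruences of
  \<open>even_case_dvd\<close>.\<close>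

lemma even_power_equation_impossible:
  fixes t u c :: int
  assumes n: "n \<ge> 2" and c: "c = t^2 * u" "c \<le> 10^9" and t: "even t" "t > 0" and u: "odd u" "u > 0"
    and eq: "(t^2) ^ (2^n - 1) = 4 * u ^ (2^n - 1) + 4 * orbit_num c n"
  shows False
proof -
  define N where "N = 2^n - (1::nat)"
  define M where "M = 2^(n-1) - (1::nat)"
  let ?a = "orbit_num c n" and ?w = "t^2"
  obtain k where k: "n = Suc k" "k \<ge> 1" using n by (metis Suc_le_D Suc_le_mono numeral_2_eq_2 One_nat_def)
  have k2: "(2::nat) \<le> 2 ^ k" using power_increasing[OF k(2), of "2::nat"] by simp
  have NM: "N = 2 * M + 1" "M \<ge> 1" using k2 unfolding N_def M_def k by simp_all
  obtain s where s: "t = 2 * s" using t by (elim evenE)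
  have w: "?w = 4 * s * s" unfolding s by (simp add: power2_eq_square)
  have s0: "s > 0" using t s by simp
  have w4: "?w \<ge> 4" using s0 unfolding w by (smt (verit) mult_le_cancel_left1 mult.assoc)
  have c4: "c \<ge> 4" using w4 u mult_mono[of 4 ?w 1 u] unfolding c by simp
  have a: "0 < ?a" "?a \<le> 2 * (?w * u) ^ M"
    using orbit_num_bounds[OF c4, of k] unfolding k c(1)[symmetric] M_def by simp_all
  note D = even_case_dvd[OF n refl c(1) t(1) u(1) eq]
  have "(2::int) ^ 2 dvd 2 ^ n" using n by (rule le_imp_power_dvd)
  hence u4: "4 dvd u + 1" using D(3) by (metis dvd_trans power2_eq_square mult_2 numeral_Bit0)
  have eqN: "?w ^ N = 4 * u ^ N + 4 * ?a" using eq unfolding N_def .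
  \<comment> \<open>As 4 divides u + 1, the value 3 is the only one below the bound u >= 5 of the
    locale.\<close>
  have "u \<noteq> 3"
  proof
    assume u3: "u = 3"
    have "n = 2"
    proof (rule ccontr)
      assume "n \<noteq> 2"
      hence "(2::int) ^ 3 dvd 2 ^ n" using n by (intro le_imp_power_dvd) simp
      hence "(8::int) dvd 4" using D(3) u3 dvd_trans[of "2^3" "2^n" "4::int"] by simp
      thus False by simp
    qed
    hence N3: "N = 3" by (simp add: N_def)
    have "?w dvd 28" using D(1) N3 u3 unfolding N_def[symmetric] by simp
    hence w28: "?w \<le> 28" by (rule zdvd_imp_le) simp
    have "s < 3"
    proof (rule ccontr)
      assume "\<not> s < 3"
      hence "3 * 3 \<le> s * s" by (intro mult_mono) auto
      thus False using w28 unfolding w by simp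
    qed
    hence "s = 1 \<or> s = 2" using s0 by auto
    thus False
    proof
      assume "s = 1"
      hence "?w = 4" unfolding w by simp
      hence "(4::int) ^ 3 = 4 * 3 ^ 3 + 4 * ?a" using eqN N3 u3 by simp
      thus False using a by simp
    next
      assume "s = 2"
      hence "16 dvd (28::int)" using \<open>?w dvd 28\<close> unfolding w by simp
      thus False by simp
    qed
  qed
  hence u5: "u \<ge> 5" using u4 u by presburger
  interpret even_case u ?w ?a N M
    using NM u5 w4 eqN a t(2) by unfold_locales simp_all
  have lt: "u < ?w" by (rule u_less_w)
  have prod: "?w * u \<le> 10^9" using c by simp
  \<comment> \<open>w^2 <= 3 w u <= 3 10^9 contradicts w >= 4 118^2 = 55696.\<close>
  have s117: "s \<in> set [1..117]"
  proof -
    have "s < 118"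
    proof (rule ccontr)
      assume "\<not> s < 118"
      hence "118 * 118 \<le> s * s" by (intro mult_mono) auto
      hence w1: "55696 \<le> ?w" unfolding w by simp
      hence "18565 \<le> u" using w_le by simp
      hence "55696 * 18565 \<le> ?w * u" using w1 by (intro mult_mono) auto
      thus False using prod by simp
    qed
    thus ?thesis using s0 unfolding set_upto by simp
  qed
  have ne: "\<not> excluded (2^n) n 1 u ?w"
    by (rule not_excluded) (use D in simp_all)
  show False
  proof (cases "n \<le> 6")
    case True
    have window: False
      if chk: "even_windows p q p' q' d k' n [1..117]" and k': "k' = 2^n"
        and f: "p ^ N \<le> 4 * q ^ N" "4 * q' ^ N \<le> p' ^ N" "int N * d \<ge> 6"
        and pos: "p > 0" "q > 0" "p' > 0" "q' > 0" "d \<ge> 0"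
      for p q p' q' d k'
    proof -
      have "p * u < q * ?w" using root_window_lower[OF f(1) gt] pos u w4 by simp
      hence "u \<le> q * (4 * s * s) div p" using pos unfolding w by (intro le_div_of_le) auto
      moreover have "q' * ?w < p' * (u + d)" using window_upper[OF f(2) _ _ _ f(3)] pos by simp
      hence "q' * (4 * s * s) div p' \<le> u + d" using pos unfolding w by (intro div_le_of_less) auto
      ultimately have "u \<in> {q' * (4 * s * s) div p' - d .. q * (4 * s * s) div p}" by simp
      hence "excluded k' n 1 u (4 * s * s)" using chk s117 unfolding even_windows_iff by blast
      thus False using ne unfolding w k' by simp
    qed
    from small_cases[OF n True] show False
    proof (elim disjE)
      assume "n = 2" thus False using window[OF even_windows_checked(1)[folded \<open>n = 2\<close>]] by (simp add: N_def)
    next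
      assume "n = 3" thus False using window[OF even_windows_checked(2)[folded \<open>n = 3\<close>]] by (simp add: N_def)
    next
      assume "n = 4" thus False using window[OF even_windows_checked(3)[folded \<open>n = 4\<close>]] by (simp add: N_def)
    next
      assume "n = 5" thus False using window[OF even_windows_checked(4)[folded \<open>n = 5\<close>]] by (simp add: N_def)
    next
      assume "n = 6" thus False using window[OF even_windows_checked(5)[folded \<open>n = 6\<close>]] by (simp add: N_def)
    qed
  next
    case False
    hence n7: "n \<ge> 7" by simp
    have k1: "2^n \<le> u + 1" using D(3) u by (intro zdvd_imp_le) auto
    moreover have "(2::int)^7 \<le> 2^n" using n7 by (intro power_increasing) auto
    ultimately have u127: "u \<ge> 127" by simp
    have "u < 31623"
    proof (rule ccontr)
      assume "\<not> u < 31623"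
      hence "31623 * 31623 \<le> ?w * u" using lt by (intro mult_mono) auto
      thus False using prod by simp
    qed
    hence "(2::int)^n < 2^15" using k1 by simp
    hence n14: "n \<le> 14" by (metis less_Suc_eq_le eval_nat_numeral(3) power_less_imp_less_exp one_less_numeral_iff semiring_norm(76))
    note cw = crude_window[OF n7 N_def u127]
    obtain j where j: "u + 1 = 2^n * j" using D(3) by (elim dvdE)
    have crude: False if chk: "even_crude k' n [1..117]" and k': "k' = 2^n" for k'
    proof -
      have kp: "k' > 0" unfolding k' by simp
      have uj: "u = k' * j - 1" using j unfolding k' by simp
      have c1: "13 * ?w < 10 * k' * (?w - u)" "10 * k' * (?w - u) < 17 * u" using cw unfolding k' by simp_all
      have "?w - u \<le> 17 * ?w div (10 * k')" using c1(2) lt kp by (intro le_div_of_le) auto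
      hence "(?w - 17 * ?w div (10 * k')) div k' \<le> j" using uj kp by (intro div_le_of_less) auto
      moreover have "13 * ?w div (10 * k') \<le> ?w - u" using c1(1) kp by (intro div_le_of_less) auto
      hence "j \<le> (?w + 1 - 13 * ?w div (10 * k')) div k'" using uj kp by (intro le_div_of_le) auto
      ultimately have "j \<in> set [(4 * s * s - 17 * (4 * s * s) div (10 * k')) div k' .. (4 * s * s + 1 - 13 * (4 * s * s) div (10 * k')) div k']"
        unfolding w set_upto by simp
      moreover have "even_crude_excluded k' n (4 * s * s)
          [(4 * s * s - 17 * (4 * s * s) div (10 * k')) div k' .. (4 * s * s + 1 - 13 * (4 * s * s) div (10 * k')) div k']"
        using chk s117 unfolding even_crude_iff by blast
      ultimately have "10 * k' * (?w - u) \<le> 13 * ?w \<or> 17 * u \<le> 10 * k' * (?w - u) \<or> excluded k' n 1 u ?w"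
        unfolding even_crude_excluded_iff uj w by blast
      thus False using c1 ne unfolding k' by simp
    qed
    have "n \<le> 15" using n14 by simp
    from large_cases[OF n7 this] show False
    proof (elim disjE)
      assume "n = 7" thus False using crude[OF even_crude_checked(1)[folded \<open>n = 7\<close>]] by simp
    next
      assume "n = 8" thus False using crude[OF even_crude_checked(2)[folded \<open>n = 8\<close>]] by simp
    next
      assume "n = 9" thus False using crude[OF even_crude_checked(3)[folded \<open>n = 9\<close>]] by simp
    next
      assume "n = 10" thus False using crude[OF even_crude_checked(4)[folded \<open>n = 10\<close>]] by simp
    next
      assume "n = 11" thus False using crude[OF even_crude_checked(5)[folded \<open>n = 11\<close>]] by simp
    next
      assume "n = 12" thus False using crude[OF even_crude_checked(6)[folded \<open>n = 12\<close>]] by simp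
    next
      assume "n = 13" thus False using crude[OF even_crude_checked(7)[folded \<open>n = 13\<close>]] by simp
    next
      assume "n = 14" thus False using crude[OF even_crude_checked(8)[folded \<open>n = 14\<close>]] by simp
    next
      assume "n = 15" thus False using n14 by simp
    qed
  qed
qed

lemma odd_power_equation_impossible:
  fixes t w c :: int
  assumes n: "n \<ge> 2" and c: "c = t^2 * w" "c \<le> 10^9" and t: "odd t" "t > 0" and w: "even w" "w > 0"
    and eq: "4 * (t^2) ^ (2^n - 1) = w ^ (2^n - 1) + 4 * orbit_num c n"
  shows False
proof -
  define N where "N = 2^n - (1::nat)"
  define M where "M = 2^(n-1) - (1::nat)"
  let ?a = "orbit_num c n" and ?u = "t^2"
  obtain k where k: "n = Suc k" "k \<ge> 1" using n by (metis Suc_le_D Suc_le_mono numeral_2_eq_2 One_nat_def)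
  have k2: "(2::nat) \<le> 2 ^ k" using power_increasing[OF k(2), of "2::nat"] by simp
  have NM: "N = 2 * M + 1" "M \<ge> 1" using k2 unfolding N_def M_def k by simp_all
  have eqN: "4 * ?u ^ N = w ^ N + 4 * ?a" using eq unfolding N_def .
  obtain s where s: "t = 2 * s + 1" using t by (elim oddE)
  have u: "?u = (2 * s + 1) * (2 * s + 1)" unfolding s by (simp add: power2_eq_square)
  \<comment> \<open>t = 1 would give 4 = w^N + 4a with a >= 1.\<close>
  have "s \<noteq> 0"
  proof
    assume "s = 0"
    hence "t = 1" using s by simp
    moreover have "orbit_num c n \<ge> 1"
    proof -
      have "c ^ (2^k - 1) \<ge> 1" using c w \<open>t = 1\<close> by simp
      thus ?thesis unfolding k orbit_num.simps using zero_le_power2[of "orbit_num c k"] by linarith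
    qed
    moreover have "w ^ N > 0" using w by simp
    ultimately show False using eqN by simp
  qed
  hence s0: "s \<ge> 1" using t s by simp
  have u9: "?u \<ge> 9" using mult_mono[of 3 "2 * s + 1" 3 "2 * s + 1"] s0 unfolding u by simp
  have c4: "c \<ge> 4" using u9 w mult_mono[of 9 ?u 1 w] unfolding c by simp
  have a: "0 < ?a" "?a \<le> 2 * (?u * w) ^ M"
    using orbit_num_bounds[OF c4, of k] unfolding k c(1)[symmetric] M_def by simp_all
  note D = odd_case_dvd[OF n refl c(1) t(1) w(1) eq]
  interpret odd_case ?u w ?a N M
    using NM u9 w eqN a by unfold_locales simp_all
  have uw: "?u \<noteq> w" using t w by (metis even_power)
  have lt': "?u < w" by (rule u_less_w[OF uw])
  have prod: "?u * w \<le> 10^9" using c by simp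
  have u_le: "?u < 31623"
  proof (rule ccontr)
    assume "\<not> ?u < 31623"
    hence "31623 * 31623 \<le> ?u * w" using lt' by (intro mult_mono) auto
    thus False using prod by simp
  qed
  have s88: "s \<in> set [1..88]"
  proof -
    have "s < 89"
    proof (rule ccontr)
      assume "\<not> s < 89"
      hence "179 * 179 \<le> ?u" unfolding u by (intro mult_mono) auto
      thus False using u_le by simp
    qed
    thus ?thesis using s0 unfolding set_upto by simp
  qed
  have ne: "\<not> excluded (2^(n-1)) n (-1) ?u w"
    by (rule not_excluded) (use D in simp_all)
  have kd: "2^(n-1) dvd (2 * s + 1) * (2 * s + 1) - 1" using D(3) unfolding u .
  show False
  proof (cases "n \<le> 6")
    case True
    have window: False
      if chk: "odd_windows p q p' q' d k' n [1..88]" and k': "k' = 2^(n-1)"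
        and f: "p ^ N \<le> 4 * q ^ N" "4 * q' ^ N \<le> p' ^ N" "int N * d \<ge> 8"
        and pos: "p > 0" "q > 0" "p' > 0" "q' > 0" "d \<ge> 0"
      for p q p' q' d k'
    proof -
      have "q' * w < p' * ?u" using root_window_upper[OF f(2) lt] pos u9 w by simp
      hence "w \<le> p' * ?u div q'" using pos by (intro le_div_of_le) auto
      moreover have "p * ?u < q * (w + d)" using window_lower[OF f(1) _ _ _ f(3) uw] pos by simp
      hence "p * ?u div q \<le> w + d" using pos by (intro div_le_of_less) auto
      ultimately have "w \<in> {p * ?u div q - d .. p' * ?u div q'}" by simp
      hence "odd w \<or> excluded k' n (-1) ?u w" using chk s88 kd unfolding odd_windows_iff u k' by blast
      thus False using ne w unfolding k' by simp
    qed
    from small_cases[OF n True] show False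
    proof (elim disjE)
      assume "n = 2" thus False using window[OF odd_windows_checked(1)[folded \<open>n = 2\<close>]] by (simp add: N_def)
    next
      assume "n = 3" thus False using window[OF odd_windows_checked(2)[folded \<open>n = 3\<close>]] by (simp add: N_def)
    next
      assume "n = 4" thus False using window[OF odd_windows_checked(3)[folded \<open>n = 4\<close>]] by (simp add: N_def)
    next
      assume "n = 5" thus False using window[OF odd_windows_checked(4)[folded \<open>n = 5\<close>]] by (simp add: N_def)
    next
      assume "n = 6" thus False using window[OF odd_windows_checked(5)[folded \<open>n = 6\<close>]] by (simp add: N_def)
    qed
  next
    case False
    hence n7: "n \<ge> 7" by simp
    have k1: "2^(n-1) \<le> ?u - 1" using D(3) u9 by (intro zdvd_imp_le) auto
    moreover have "(2::int)^6 \<le> 2^(n-1)" using n7 by (intro power_increasing) auto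
    ultimately have u32: "?u \<ge> 32" by simp
    have "(2::int)^(n-1) < 2^15" using k1 u_le by simp
    hence "n - 1 < 15" by (rule power_less_imp_less_exp[rotated]) simp
    hence n15: "n \<le> 15" by simp
    note cw = crude_window[OF n7 N_def u32 uw]
    have crude: False if chk: "odd_crude K k' n [1..88]" and K: "K = 2^n" "k' = 2^(n-1)" for K k'
    proof -
      have kp: "K > 0" unfolding K by simp
      have c1: "6 * w < 5 * K * (w - ?u)" "2 * K * (w - ?u) < 3 * ?u" using cw unfolding K by simp_all
      have "6 * ?u div (5 * K) \<le> w - ?u" using c1(1) lt' kp by (intro div_le_of_less) auto
      moreover have "w - ?u \<le> 3 * ?u div (2 * K)" using c1(2) kp by (intro le_div_of_le) auto
      ultimately have "w \<in> {?u + 6 * ?u div (5 * K) .. ?u + 3 * ?u div (2 * K)}" by simp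
      hence "odd w \<or> excluded k' n (-1) ?u w" using chk s88 kd unfolding odd_crude_iff u K(2) Let_def by blast
      thus False using ne w unfolding K by simp
    qed
    from large_cases[OF n7 n15] show False
    proof (elim disjE)
      assume "n = 7" thus False using crude[OF odd_crude_checked(1)[folded \<open>n = 7\<close>]] by simp
    next
      assume "n = 8" thus False using crude[OF odd_crude_checked(2)[folded \<open>n = 8\<close>]] by simp
    next
      assume "n = 9" thus False using crude[OF odd_crude_checked(3)[folded \<open>n = 9\<close>]] by simp
    next
      assume "n = 10" thus False using crude[OF odd_crude_checked(4)[folded \<open>n = 10\<close>]] by simp
    next
      assume "n = 11" thus False using crude[OF odd_crude_checked(5)[folded \<open>n = 11\<close>]] by simp
    next
      assume "n = 12" thus False using crude[OF odd_crude_checked(6)[folded \<open>n = 12\<close>]] by simp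
    next
      assume "n = 13" thus False using crude[OF odd_crude_checked(7)[folded \<open>n = 13\<close>]] by simp
    next
      assume "n = 14" thus False using crude[OF odd_crude_checked(8)[folded \<open>n = 14\<close>]] by simp
    next
      assume "n = 15" thus False using crude[OF odd_crude_checked(9)[folded \<open>n = 15\<close>]] by simp
    qed
  qed
qed

theorem positive_obstructed:
  assumes c: "c > 0" "c \<le> 10^9" and n: "n \<ge> 2" and z: "z = crit_orbit (1 / rat_of_int c) n"
  shows "\<nexists>w y. w^2 = z^2 + 1 / of_int c \<and> y^2 = 2 * z + 2 * w"
proof
  assume "\<exists>w y. w^2 = z^2 + 1 / of_int c \<and> y^2 = 2 * z + 2 * w"
  then obtain w y where wy: "w^2 = z^2 + 1 / of_int c" "y^2 = 2 * z + 2 * w" by blast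
  obtain X where X: "4 * (X^2 * (X^2 - orbit_num c n)) = c ^ (2^n - 1)"
    using positive_obstruction_imp_product[OF c(1) n] wy unfolding z by metis
  obtain k where k: "n = Suc k" using n by (cases n) auto
  have "2^n - 1 = 2 * (2^k - 1) + (1::nat)" using one_le_power[of "2::nat" k] unfolding k power_Suc by arith
  moreover have "coprime (orbit_num c n) c" unfolding k by (rule coprime_orbit_num)
  ultimately show False
    using product_split_cases[OF X _ c(1)] even_power_equation_impossible[OF n _ c(2)]
      odd_power_equation_impossible[OF n _ c(2)] by metis
qed

section \<open>The family c = 4m^2(m^2-1)\<close>

text \<open>\<open>ci\<close> stands for 1/c. As c = 4 m^2 (m^2 - 1), the number 4 m (m^2 - 1)/c is
  1/m, and the single test m mi = 1 confirms both inverses.\<close>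

definition pair_cert :: "(int \<times> int) list \<Rightarrow> int \<Rightarrow> nat \<Rightarrow> nat \<Rightarrow> int \<Rightarrow> int \<Rightarrow> bool" where
  "pair_cert sq p n k m ci = (let mi = (4 * m * (m * m - 1) * ci) mod p in
     (m * mi) mod p = 1 \<and> quadratic_cert sq p ci mi (((2 * m * m - 1) * ci) mod p) n k)"

abbreviation pair_obstructed :: "int \<Rightarrow> nat \<Rightarrow> nat \<Rightarrow> bool" where
  "pair_obstructed m \<equiv> norm_trace_obstructed (1 / of_int (4 * m^2 * (m^2 - 1))) (1 / of_int m)
     (of_int (2 * m^2 - 1) / of_int (4 * m^2 * (m^2 - 1)))"

lemma pair_cert_sound:
  assumes p: "prime p" and c: "pair_cert (sqs p) p n k m ci" and m': "[m' = m] (mod p)"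
  shows "pair_obstructed m' n k"
proof -
  define mi where "mi = (4 * m * (m * m - 1) * ci) mod p"
  have c1: "(m * mi) mod p = 1" and c2: "quadratic_cert (sqs p) p ci mi (((2 * m * m - 1) * ci) mod p) n k"
    using c unfolding pair_cert_def mi_def Let_def by simp_all
  have m1: "[m * mi = 1] (mod p)" using c1 prime_gt_1_int[OF p] by (simp add: cong_def)
  have "[m' * mi = m * mi] (mod p)" using m' by (intro cong_mult cong_refl)
  hence "[m' * mi = 1] (mod p)" using m1 by (rule cong_trans)
  hence b: "rat_cong p (1 / of_int m') mi" by (rule rat_cong_inverse[OF rat_cong_of_int])
  have "[mi = 4 * m * (m * m - 1) * ci] (mod p)" unfolding mi_def by (simp add: cong_def)
  hence "[m * mi = m * (4 * m * (m * m - 1) * ci)] (mod p)" by (intro cong_mult cong_refl)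
  hence 1: "[m * (4 * m * (m * m - 1) * ci) = 1] (mod p)" using m1 by (metis cong_sym cong_trans)
  have "[4 * m' * m' * (m' * m' - 1) * ci = 4 * m * m * (m * m - 1) * ci] (mod p)"
    using m' by (intro cong_mult cong_diff cong_refl)
  also have "4 * m * m * (m * m - 1) * ci = m * (4 * m * (m * m - 1) * ci)" by simp
  also note 1
  finally have "[4 * m'^2 * (m'^2 - 1) * ci = 1] (mod p)" by (simp add: power2_eq_square mult.assoc)
  hence r: "rat_cong p (1 / of_int (4 * m'^2 * (m'^2 - 1))) ci" by (rule rat_cong_inverse[OF rat_cong_of_int])
  have "[2 * m'^2 - 1 = 2 * m * m - 1] (mod p)"
    unfolding power2_eq_square mult.assoc using m' by (intro cong_mult cong_diff cong_refl)
  hence "rat_cong p (of_int (2 * m'^2 - 1)) (2 * m * m - 1)" using rat_cong_of_int rat_cong_cong by blast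
  hence "rat_cong p (of_int (2 * m'^2 - 1) * (1 / of_int (4 * m'^2 * (m'^2 - 1)))) (((2 * m * m - 1) * ci) mod p)"
    using r by (intro rat_cong_mod rat_cong_mult)
  hence q: "rat_cong p (of_int (2 * m'^2 - 1) / of_int (4 * m'^2 * (m'^2 - 1))) (((2 * m * m - 1) * ci) mod p)"
    by simp
  show ?thesis using quadratic_cert_sound[OF p r b q c2] .
qed

definition pair_sieve_ok :: "nat \<Rightarrow> nat \<Rightarrow> sieve \<Rightarrow> bool" where
  "pair_sieve_ok n k tabs = list_all (\<lambda>(p, T). let sq = sqs p in
     list_all (\<lambda>(m, ci). pair_cert sq p n k m ci) T) tabs"

lemma pair_sieve_sound:
  assumes ok: "pair_sieve_ok n k tabs" and pr: "list_all (\<lambda>(p, _). prime p) tabs" and cov: "covered tabs m"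
  shows "pair_obstructed m n k"
proof -
  obtain p T i where T: "(p, T) \<in> set tabs" "(m mod p, i) \<in> set T" using covered_imp[OF cov] by blast
  have "pair_cert (sqs p) p n k (m mod p) i"
    using ok T unfolding pair_sieve_ok_def by (fastforce simp: list_all_iff Let_def)
  moreover have "[m = m mod p] (mod p)" by (simp add: cong_def)
  moreover have "prime p" using pr T by (auto simp: list_all_iff)
  ultimately show ?thesis using pair_cert_sound by blast
qed

definition pair_first :: "(int \<times> (int \<times> int) list) list" where
  "pair_first = [(5, [(3,2)]),
    (7, [(4,1), (5,6)]),
    (11, [(3,6), (5,6), (6,6), (7,4), (8,6)]),
    (13, [(5,5), (6,3), (7,3), (9,6), (11,3)]),
    (17, [(4,15), (6,15), (8,10), (11,15), (13,15), (14,16), (15,11)]),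
    (19, [(3,13), (5,16), (6,4), (7,13), (8,6), (9,5), (13,4), (15,2), (16,13), (17,2)]),
    (23, [(5,3), (8,14), (10,19), (16,1), (21,12)]),
    (29, [(12,11)]),
    (31, [(21,12)]),
    (41, [(4,29)])]"


definition pair_even :: "(int \<times> (int \<times> int) list) list" where
  "pair_even = [(5, [(2,2), (3,2)]),
    (7, [(5,6)]),
    (11, [(5,6)]),
    (13, [(5,5), (6,3), (8,5)]),
    (17, [(3,16), (4,15), (6,15), (7,5), (10,5), (11,15), (13,15), (14,16)]),
    (19, [(2,2), (3,13), (7,13), (13,4), (15,2), (16,13)]),
    (23, [(4,19), (8,14), (13,19), (19,19), (20,2)]),
    (29, [(7,17), (12,11), (22,17), (25,10)]),
    (31, [(23,4), (27,30)]),
    (37, [(8,9), (27,26)]),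
    (41, [(6,27), (13,20), (29,40), (35,27)]),
    (43, [(13,26)]),
    (47, [(9,45), (20,46), (22,45)]),
    (53, [(39,36), (46,2)]),
    (73, [(17,35), (56,35)])]"


definition pair_odd :: "(int \<times> (int \<times> int) list) list" where
  "pair_odd = [(5, [(2,2)]),
    (7, [(2,6), (4,1), (5,6)]),
    (11, [(5,6), (7,4)]),
    (13, [(4,6), (6,3), (8,5)]),
    (17, [(3,16), (4,15), (6,15), (7,5), (10,5), (11,15), (13,15), (14,16)]),
    (19, [(2,2), (7,13), (11,6), (15,2), (16,13)]),
    (23, [(4,19), (7,1), (9,22), (12,14), (13,19), (14,22), (21,12)]),
    (29, [(12,11), (20,24), (22,17)]),
    (31, [(4,30), (27,30)]),
    (37, [(11,11), (26,11)]),
    (41, [(6,27), (36,28)]),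
    (43, [(8,29), (9,19), (14,23), (37,24)]),
    (47, [(22,45)]),
    (71, [(52,29)])]"


lemma pair_primes:
  "list_all (\<lambda>(p, _). prime p) pair_first" "list_all (\<lambda>(p, _). prime p) pair_even"
  "list_all (\<lambda>(p, _). prime p) pair_odd"
  by (simp_all add: pair_first_def pair_even_def pair_odd_def)

text \<open>A negative m stands for the conjugate factor x^2 - x/|m| + q. The value m = 2 belongs to
  c = 48, where x^2 + x/2 + 7/48 splits after one composition with f; its conjugate, m = -2, does
  not.\<close>

lemma pair_obstructed_range:
  assumes m: "- 125 \<le> m \<and> m \<le> - 2 \<or> 3 \<le> m \<and> m \<le> 125"
  shows "pair_obstructed m 0 0" "pair_obstructed m 2 2" "pair_obstructed m 3 2"
proof -
  have 0: "pair_sieve_ok 0 0 pair_first" "covers_all pair_first [-125..-2]" "covers_all pair_first [3..125]" by code_simp+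
  have 2: "pair_sieve_ok 2 2 pair_even" "covers_all pair_even [-125..-2]" "covers_all pair_even [3..125]" by code_simp+
  have 3: "pair_sieve_ok 3 2 pair_odd" "covers_all pair_odd [-125..-2]" "covers_all pair_odd [3..125]" by code_simp+
  have "covered pair_first m" "covered pair_even m" "covered pair_odd m"
    using 0(2,3) 2(2,3) 3(2,3) m unfolding covers_all_iff set_upto by (meson atLeastAtMost_iff)+
  thus "pair_obstructed m 0 0" "pair_obstructed m 2 2" "pair_obstructed m 3 2"
    using pair_sieve_sound[OF 0(1) pair_primes(1)] pair_sieve_sound[OF 2(1) pair_primes(2)]
      pair_sieve_sound[OF 3(1) pair_primes(3)] by - assumption+
qed

lemma rat_cong_frac:
  assumes "prime p" "(x - i * y) mod p = 0" "y mod p \<noteq> 0"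
  shows "rat_cong p (of_int x / of_int y) i"
proof -
  have "\<not> p dvd y" using assms(3) by (simp add: dvd_eq_mod_eq_0)
  hence "coprime y p" using prime_imp_coprime[OF assms(1)] by (metis coprime_commute)
  moreover have "y \<noteq> 0" using assms(3) by auto
  ultimately show ?thesis unfolding rat_cong_def using assms(2)
    by (intro exI[of _ x] exI[of _ y]) (simp add: cong_iff_dvd_diff dvd_eq_mod_eq_0)
qed

text \<open>The quadratic factors of \<open>f\<^sup>2 + 1/4\<close> for \<open>c = -16\<close>.\<close>
lemma minus16_obstructed:
  assumes "(n, k) \<in> {(0, 0), (2, 2), (3, 2)}"
  shows "norm_trace_obstructed (- 1 / 16) 1 (7 / 16) n k" "norm_trace_obstructed (- 1 / 16) (- 1) (7 / 16) n k"
proof -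
  have "norm_trace_obstructed (of_int (-1) / of_int 16) (of_int (1) / of_int 1) (of_int 7 / of_int 16) n k"
  proof (rule quadratic_cert_sound)
    show "prime (5::int)" by simp
    show "rat_cong 5 (of_int (-1) / of_int 16) 4" "rat_cong 5 (of_int (1) / of_int 1) 1"
      "rat_cong 5 (of_int 7 / of_int 16) 2"
      by (rule rat_cong_frac; simp)+
    have "quadratic_cert (sqs 5) 5 4 1 2 0 0" "quadratic_cert (sqs 5) 5 4 1 2 2 2"
      "quadratic_cert (sqs 5) 5 4 1 2 3 2"
      by code_simp+
    thus "quadratic_cert (sqs 5) 5 4 1 2 n k" using assms by (elim insertE emptyE) simp_all
  qed
  thus "norm_trace_obstructed (- 1 / 16) 1 (7 / 16) n k" by simp
  have "norm_trace_obstructed (of_int (-1) / of_int 16) (of_int (-1) / of_int 1) (of_int 7 / of_int 16) n k"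
  proof (rule quadratic_cert_sound)
    show "prime (7::int)" by simp
    show "rat_cong 7 (of_int (-1) / of_int 16) 3" "rat_cong 7 (of_int (-1) / of_int 1) 6"
      "rat_cong 7 (of_int 7 / of_int 16) 0"
      by (rule rat_cong_frac; simp)+
    have "quadratic_cert (sqs 7) 7 3 6 0 0 0" "quadratic_cert (sqs 7) 7 3 6 0 2 2"
      "quadratic_cert (sqs 7) 7 3 6 0 3 2"
      by code_simp+
    thus "quadratic_cert (sqs 7) 7 3 6 0 n k" using assms by (elim insertE emptyE) simp_all
  qed
  thus "norm_trace_obstructed (- 1 / 16) (- 1) (7 / 16) n k" by simp
qed

text \<open>The quadratic factors of \<open>(x\<^sup>2 + x/2 + 7/48) \<circ> f\<close> for \<open>c = 48\<close>.\<close>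
lemma fortyeight_obstructed:
  assumes "(n, k) \<in> {(0, 0), (2, 2), (3, 2)}"
  shows "norm_trace_obstructed (1 / 48) (1 / 2) (19 / 48) n k" "norm_trace_obstructed (1 / 48) (- 1 / 2) (19 / 48) n k"
proof -
  have "norm_trace_obstructed (of_int (1) / of_int 48) (of_int (1) / of_int 2) (of_int 19 / of_int 48) n k"
  proof (rule quadratic_cert_sound)
    show "prime (7::int)" by simp
    show "rat_cong 7 (of_int (1) / of_int 48) 6" "rat_cong 7 (of_int (1) / of_int 2) 4"
      "rat_cong 7 (of_int 19 / of_int 48) 2"
      by (rule rat_cong_frac; simp)+
    have "quadratic_cert (sqs 7) 7 6 4 2 0 0" "quadratic_cert (sqs 7) 7 6 4 2 2 2"
      "quadratic_cert (sqs 7) 7 6 4 2 3 2"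
      by code_simp+
    thus "quadratic_cert (sqs 7) 7 6 4 2 n k" using assms by (elim insertE emptyE) simp_all
  qed
  thus "norm_trace_obstructed (1 / 48) (1 / 2) (19 / 48) n k" by simp
  have "norm_trace_obstructed (of_int (1) / of_int 48) (of_int (-1) / of_int 2) (of_int 19 / of_int 48) n k"
  proof (rule quadratic_cert_sound)
    show "prime (61::int)" by simp
    show "rat_cong 61 (of_int (1) / of_int 48) 14" "rat_cong 61 (of_int (-1) / of_int 2) 30"
      "rat_cong 61 (of_int 19 / of_int 48) 22"
      by (rule rat_cong_frac; simp)+
    have "quadratic_cert (sqs 61) 61 14 30 22 0 0" "quadratic_cert (sqs 61) 61 14 30 22 2 2"
      "quadratic_cert (sqs 61) 61 14 30 22 3 2"
      by code_simp+
    thus "quadratic_cert (sqs 61) 61 14 30 22 n k" using assms by (elim insertE emptyE) simp_all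
  qed
  thus "norm_trace_obstructed (1 / 48) (- 1 / 2) (19 / 48) n k" by simp
qed

section \<open>Counting factors\<close>

lemma square_between_int:
  fixes x b y :: int
  assumes "b^2 < x" "x < (b + 1)^2" "b \<ge> 0"
  shows "x \<noteq> y^2"
proof
  assume "x = y^2"
  hence "b^2 < \<bar>y\<bar>^2" "\<bar>y\<bar>^2 < (b + 1)^2" using assms by simp_all
  hence "b < \<bar>y\<bar>" "\<bar>y\<bar> < b + 1"
    using power_less_imp_less_base[of b 2 "\<bar>y\<bar>"] power_less_imp_less_base[of "\<bar>y\<bar>" 2 "b + 1"] assms(3)
    by linarith+
  thus False by simp
qed

lemma rat_square_scaled_eq_of_int:
  assumes "(q::rat)^2 = of_int x / of_int (m^2)" "m \<noteq> 0"
  obtains y where "x = y^2"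
proof -
  have "(q * of_int m)^2 = of_int x" using assms by (simp add: power_mult_distrib)
  moreover from this obtain y where "q * of_int m = of_int y" by (rule rat_square_eq_of_int)
  ultimately have "of_int x = (of_int (y^2) :: rat)" by simp
  thus thesis using that[of y] by (simp only: of_int_eq_iff)
qed

fun nonsquare_by :: "(int \<times> (int \<times> int) list) list \<Rightarrow> int \<Rightarrow> bool" where
  "nonsquare_by [] x = False"
| "nonsquare_by ((p, sq) # l) x = (if is_sq sq (x mod p) then nonsquare_by l x else True)"

lemma nonsquare_by_sound:
  assumes "nonsquare_by (map (\<lambda>p. (p, sqs p)) ps) x" "list_all (\<lambda>p. p > 0) ps"
  shows "x \<noteq> y^2"
  using assms
proof (induction ps)
  case (Cons p ps)
  show ?case
  proof (cases "is_sq (sqs p) (x mod p)")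
    case True thus ?thesis using Cons by simp
  next
    case False
    show ?thesis
    proof
      assume x: "x = y^2"
      have "is_sq (sqs p) (y * y mod p)" using sqs_memb[of p y] Cons.prems(2) unfolding is_sq_iff by force
      thus False using False x by (simp add: power2_eq_square)
    qed
  qed
qed simp

fun all_nonsquare_cubes :: "(int \<times> (int \<times> int) list) list \<Rightarrow> int list \<Rightarrow> bool" where
  "all_nonsquare_cubes l [] = True"
| "all_nonsquare_cubes l (s # ss) = (if nonsquare_by l (s * (s * s - 1) + 1) then all_nonsquare_cubes l ss else False)"

lemma all_nonsquare_cubes_iff:
  "all_nonsquare_cubes l ss \<longleftrightarrow> (\<forall>s\<in>set ss. nonsquare_by l (s * (s * s - 1) + 1))"
  by (induction l ss rule: all_nonsquare_cubes.induct) auto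

text \<open>With m = s^2 - 1 the number s m + 1 decides whether (x - s/m) o f splits. The excluded s
  are those in this range giving integral points on the elliptic curve y^2 = s^3 - s + 1.\<close>

lemma cube_nonsquare:
  fixes s :: int
  assumes s: "2 \<le> s" "s \<le> 178" "s \<notin> {3, 5, 56}"
  shows "s * (s^2 - 1) + 1 \<noteq> y^2"
proof -
  let ?ps = "[17, 11, 13, 19, 29, 31, 5, 7, 23, 41] :: int list"
  have "all_nonsquare_cubes (map (\<lambda>p. (p, sqs p)) ?ps) [2..2]" "all_nonsquare_cubes (map (\<lambda>p. (p, sqs p)) ?ps) [4..4]"
    "all_nonsquare_cubes (map (\<lambda>p. (p, sqs p)) ?ps) [6..55]" "all_nonsquare_cubes (map (\<lambda>p. (p, sqs p)) ?ps) [57..178]"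
    by code_simp+
  moreover have "s \<in> set [2..2] \<or> s \<in> set [4..4] \<or> s \<in> set [6..55] \<or> s \<in> set [57..178]"
    using s unfolding set_upto atLeastAtMost_iff by auto
  ultimately have "nonsquare_by (map (\<lambda>p. (p, sqs p)) ?ps) (s * (s * s - 1) + 1)"
    unfolding all_nonsquare_cubes_iff by blast
  moreover have "list_all (\<lambda>p. p > 0) ?ps" by simp
  ultimately have "s * (s * s - 1) + 1 \<noteq> y^2" by (rule nonsquare_by_sound)
  thus ?thesis by (simp add: power2_eq_square)
qed

section \<open>Factorisations of iterates over the rationals\<close>

lemma quad_eq: "quad r = [:r, 0, 1:]"
  by (simp add: quad_def)

abbreviation iter :: "rat \<Rightarrow> nat \<Rightarrow> rat poly" where
  "iter r n \<equiv> poly_iter n [:r,0,1:]"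

lemma iter_Suc_factor:
  assumes "[:r,0,1:] = p * q"
  shows "iter r (Suc n) = (p \<circ>\<^sub>p iter r n) * (q \<circ>\<^sub>p iter r n)"
  unfolding poly_iter_Suc by (simp only: assms pcompose_mult)

lemma pcompose_iter_Suc_factor:
  assumes "g \<circ>\<^sub>p [:r,0,1:] = p * q"
  shows "g \<circ>\<^sub>p iter r (Suc n) = (p \<circ>\<^sub>p iter r n) * (q \<circ>\<^sub>p iter r n)"
proof -
  have "g \<circ>\<^sub>p iter r (Suc n) = (g \<circ>\<^sub>p [:r,0,1:]) \<circ>\<^sub>p iter r n"
    by (simp only: poly_iter_Suc pcompose_assoc)
  thus ?thesis by (simp only: assms pcompose_mult)
qed

lemma pcompose_iter_1: "g \<circ>\<^sub>p iter r (Suc 0) = g \<circ>\<^sub>p [:r,0,1:]"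
  by (simp add: poly_iter_Suc pcompose_idR)

abbreviation nif :: "rat poly \<Rightarrow> nat" where "nif \<equiv> num_irreducible_factors"

lemma nif_mult_irreducible:
  assumes "irreducible p" "nif q = k" "k > 0"
  shows "nif (p * q) = Suc k"
proof -
  have "q \<noteq> 0"
  proof
    assume "q = 0"
    thus False using assms(2,3) by (simp add: num_irreducible_factors_def)
  qed
  moreover have "p \<noteq> 0" using assms(1) by auto
  ultimately show ?thesis
    using num_irreducible_factors_mult[of p q] num_irreducible_factors_irreducible[OF assms(1)] assms(2) by simp
qed

lemmas nif_1 = num_irreducible_factors_irreducible

lemma nif_2: "irreducible p \<Longrightarrow> irreducible q \<Longrightarrow> nif (p * q) = 2"
  using nif_mult_irreducible[of p q 1] nif_1[of q] by simp

lemma nif_3: "irreducible p \<Longrightarrow> irreducible q \<Longrightarrow> irreducible t \<Longrightarrow> nif (p * (q * t)) = 3"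
  using nif_mult_irreducible[of p "q * t" 2] nif_2[of q t] by simp

lemma nif_4: "irreducible p \<Longrightarrow> irreducible q \<Longrightarrow> irreducible t \<Longrightarrow> irreducible u \<Longrightarrow> nif (p * (q * (t * u))) = 4"
  using nif_mult_irreducible[of p "q * (t * u)" 3] nif_3[of q t u] by simp

lemma irreducible_quadratic_neg_disc:
  fixes b q :: rat
  assumes "b^2 < 4 * q"
  shows "irreducible [:q,b,1:]"
proof (rule irreducible_quadratic_field)
  fix x :: rat
  have "4 * (x^2 + b * x + q) = (2 * x + b)^2 + (4 * q - b^2)" by (simp add: power2_eq_square algebra_simps)
  moreover have "(2 * x + b)^2 \<ge> 0" by simp
  ultimately have "4 * (x^2 + b * x + q) > 0" using assms by linarith
  thus "x^2 + b * x + q \<noteq> 0" by auto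
qed

text \<open>The interval [r, 0) is mapped into itself, because z^2 <= r^2 < -r on it.\<close>

lemma crit_orbit_negative:
  fixes r :: rat
  assumes "- 1 < r" "r < 0"
  shows "r \<le> crit_orbit r (Suc n)" "crit_orbit r (Suc n) < 0"
proof -
  have "r \<le> crit_orbit r (Suc n) \<and> crit_orbit r (Suc n) < 0"
  proof (induction n)
    case 0 thus ?case using assms by simp
  next
    case (Suc n)
    define z where "z = crit_orbit r (Suc n)"
    have z: "r \<le> z" "z < 0" using Suc unfolding z_def by blast+
    have "(- z) * (- z) \<le> (- r) * (- r)" using z assms by (intro mult_mono) auto
    also have "\<dots> < 1 * (- r)" using assms by (intro mult_strict_right_mono) auto
    finally have "z^2 < - r" by (simp add: power2_eq_square)
    moreover have "crit_orbit r (Suc (Suc n)) = z^2 + r" unfolding z_def by simp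
    ultimately show ?case using zero_le_power2[of z] by linarith
  qed
  thus "r \<le> crit_orbit r (Suc n)" "crit_orbit r (Suc n) < 0" by simp_all
qed

text \<open>The criterion is applied to g = x: the first condition would make -c a square, the later
  ones fail by sign.\<close>

lemma irreducible_iter_negative_nonsquare:
  fixes c :: int
  assumes c: "c < - 1" and ns: "\<nexists>m. c = - (m^2)"
  shows "irreducible (iter (1 / of_int c) n)"
proof -
  let ?r = "1 / of_int c :: rat"
  have r: "- 1 < ?r" "?r < 0" using c by (simp_all add: field_simps)
  have "irreducible ([:0,1:] \<circ>\<^sub>p iter ?r n)"
  proof (rule irreducible_iterates)
    show "irreducible [:0, 1::rat:]" by (rule irreducible_linear_field_poly) simp
    show "\<nexists>q. (- 1) ^ degree [:0, 1::rat:] * poly [:0, 1:] ?r = q^2"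
    proof
      assume "\<exists>q. (- 1) ^ degree [:0, 1::rat:] * poly [:0, 1:] ?r = q^2"
      then obtain q where "q^2 = - ?r" by auto
      hence "q^2 = of_int (- c) / of_int (c^2)" using c by (simp add: power2_eq_square)
      then obtain y where "- c = y^2" using c by (elim rat_square_scaled_eq_of_int) auto
      thus False using ns by (metis minus_minus)
    qed
  next
    fix n :: nat assume "n \<ge> 2"
    then obtain k where k: "n = Suc k" by (cases n) auto
    have "crit_orbit ?r n < 0" unfolding k using crit_orbit_negative[OF r] by blast
    thus "\<nexists>q. poly [:0, 1:] (crit_orbit ?r n) = q^2" by (auto simp: not_less[symmetric])
  qed simp
  thus ?thesis by (simp add: pcompose_pCons)
qed

context
  fixes m :: int and r :: rat
  assumes m: "m \<ge> 2" and r: "r = 1 / of_int (- (m^2))"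
begin

text \<open>Composed with f, x - t/m becomes x^2 - (t m + 1)/m^2, which splits into two factors of
  the same form if t m + 1 is a square.\<close>

definition lin :: "int \<Rightarrow> rat poly" where
  "lin t = [:- (of_int t / of_int m), 1:]"

lemma minus_square_r: "- 1 < r" "r < 0" "r = - 1 / of_int m ^ 2"
proof -
  have "1 < m * m" using m mult_strict_mono[of 1 m 1 m] by simp
  hence "(1::rat) < of_int (m * m)" by (simp only: of_int_1_less_iff)
  hence "1 < (of_int m :: rat)^2" by (simp add: power2_eq_square)
  moreover from this have "1 / (of_int m :: rat)^2 < 1 / 1" by (intro divide_strict_left_mono) (use m in simp_all)
  moreover have "r = - (1 / of_int m ^ 2)" unfolding r by simp
  ultimately show "- 1 < r" "r < 0" "r = - 1 / of_int m ^ 2" using m by simp_all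
qed

text \<open>From the second index on f^n(0) - t/m is negative, so only the first condition can hold,
  and it makes t m + 1 a square.\<close>

lemma irreducible_lin_pos:
  assumes t: "t \<ge> 1" and ns: "\<And>y. t * m + 1 \<noteq> y^2"
  shows "irreducible (lin t \<circ>\<^sub>p iter r n)"
proof (rule irreducible_iterates)
  show "irreducible (lin t)" unfolding lin_def by (rule irreducible_linear_field_poly) simp
  show "lead_coeff (lin t) = 1" by (simp add: lin_def)
  show "\<nexists>q. (- 1) ^ degree (lin t) * poly (lin t) r = q^2"
  proof
    assume "\<exists>q. (- 1) ^ degree (lin t) * poly (lin t) r = q^2"
    then obtain q where q: "q^2 = - (r - of_int t / of_int m)" by (auto simp: lin_def)
    have "- (r - of_int t / of_int m) = of_int (t * m + 1) / of_int (m^2)"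
      unfolding minus_square_r(3) using m by (simp add: field_simps power2_eq_square)
    hence "q^2 = of_int (t * m + 1) / of_int (m^2)" using q by (simp only:)
    moreover have "m \<noteq> 0" using m by simp
    ultimately obtain y where "t * m + 1 = y^2" by (rule rat_square_scaled_eq_of_int)
    thus False using ns by blast
  qed
next
  fix n :: nat assume "n \<ge> 2"
  then obtain k where k: "n = Suc k" by (cases n) auto
  have "crit_orbit r n < 0" unfolding k using crit_orbit_negative minus_square_r by blast
  moreover have "of_int t / (of_int m :: rat) > 0" using t m by simp
  ultimately have "poly (lin t) (crit_orbit r n) < 0" by (simp add: lin_def)
  thus "\<nexists>q. poly (lin t) (crit_orbit r n) = q^2" by (metis not_less zero_le_power2)
qed

lemma lin_neg_quad: "lin (- t) \<circ>\<^sub>p [:r,0,1:] = [:of_int (t * m - 1) / of_int (m^2), 0, 1:]"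
  using m by (simp add: lin_def pcompose_pCons minus_square_r(3) field_simps power2_eq_square)

text \<open>For x + t/m the linear criterion offers norms only. One composition with f yields x^2 +
  (t m - 1)/m^2, of negative discriminant, to which the trace condition applies too.\<close>

lemma irreducible_lin_neg:
  assumes t: "t \<ge> 1"
    and ob: "minus_square_obstructed t m 0 0" "minus_square_obstructed t m 2 2" "minus_square_obstructed t m 3 2"
  shows "irreducible (lin (- t) \<circ>\<^sub>p iter r n)"
proof (cases n)
  case 0
  have "irreducible (lin (- t))" unfolding lin_def by (rule irreducible_linear_field_poly) simp
  thus ?thesis using 0 by (simp add: pcompose_idR)
next
  case (Suc k)
  let ?q = "of_int (t * m - 1) / of_int (m^2) :: rat"
  have "1 * 2 \<le> t * m" using t m by (intro mult_mono) auto
  hence "0 < t * m - 1" by simp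
  hence "(0::rat) < of_int (t * m - 1)" by (simp only: of_int_0_less_iff)
  moreover have "(0::rat) < of_int (m^2)" using m by simp
  ultimately have "?q > 0" by (rule divide_pos_pos)
  hence "(0::rat)^2 < 4 * ?q" unfolding zero_power2 by (intro mult_pos_pos) simp_all
  hence "irreducible [:?q, 0, 1:]" by (rule irreducible_quadratic_neg_disc)
  hence "irreducible ([:?q, 0, 1:] \<circ>\<^sub>p iter r k)"
    using irreducible_iterates_if_obstructed ob unfolding r by blast
  moreover have "lin (- t) \<circ>\<^sub>p iter r n = [:?q, 0, 1:] \<circ>\<^sub>p iter r k"
    unfolding Suc poly_iter_Suc pcompose_assoc lin_neg_quad[symmetric] ..
  ultimately show ?thesis by simp
qed

lemma lin_split:
  assumes "t * m + 1 = y^2"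
  shows "lin t \<circ>\<^sub>p [:r,0,1:] = lin y * lin (- y)"
proof -
  have "(of_int (t * m + 1) :: rat) = of_int (y^2)" unfolding assms ..
  thus ?thesis using m by (simp add: lin_def pcompose_pCons minus_square_r(3) field_simps power2_eq_square)
qed

lemma quad_split: "[:r,0,1:] = lin 1 * lin (- 1)"
  using m by (simp add: lin_def minus_square_r(3) field_simps power2_eq_square)

end

text \<open>With w = b/c one has b^2 = c + 1, and the trace condition becomes y^2 (b + 1) = 2. So 2
  (b + 1) is a square, b = 2 M^2 - 1 and c = b^2 - 1.\<close>

lemma positive_first_obstruction:
  fixes c :: int
  assumes c: "c > 0" and w: "(w::rat)^2 = (1 / of_int c)^2 + 1 / of_int c" and y: "y^2 = 2 * w - 2 * (1 / of_int c)"
  obtains m where "m \<ge> 2" "c = 4 * m^2 * (m^2 - 1)"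
proof -
  let ?c = "of_int c :: rat"
  have c0: "?c > 0" using c by simp
  have "(w * ?c)^2 = of_int (1 + c)" unfolding power_mult_distrib w using c by (simp add: field_simps power2_eq_square)
  moreover from this obtain b where b: "w * ?c = of_int b" by (rule rat_square_eq_of_int)
  ultimately have "of_int (b^2) = (of_int (1 + c) :: rat)" by simp
  hence b2: "b^2 = 1 + c" by (simp only: of_int_eq_iff)
  \<comment> \<open>y^2 >= 0 selects the positive root b.\<close>
  have "0 \<le> 2 * w - 2 * (1 / ?c)" using zero_le_power2[of y] unfolding y .
  moreover have "1 / ?c > 0" using c0 by simp
  ultimately have "w > 0" by linarith
  hence "of_int b > (0::rat)" unfolding b[symmetric] using c0 by simp
  hence bpos: "b > 0" by simp
  have ce: "?c = (of_int b - 1) * (of_int b + 1)"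
  proof -
    have "c = (b - 1) * (b + 1)" using b2 by (simp add: algebra_simps power2_eq_square)
    thus ?thesis by simp
  qed
  have "y^2 * ?c = 2 * (of_int b - 1)" unfolding y b[symmetric] using c by (simp add: field_simps)
  hence "(y^2 * (of_int b + 1)) * (of_int b - 1) = 2 * (of_int b - 1)" unfolding ce by (simp add: algebra_simps)
  moreover have "of_int b - 1 \<noteq> (0::rat)" using ce c0 by auto
  ultimately have "y^2 * (of_int b + 1) = 2" by (metis mult_right_cancel)
  moreover have "(y * (of_int b + 1))^2 = (y^2 * (of_int b + 1)) * (of_int b + 1)" by (simp add: power2_eq_square)
  ultimately have "(y * (of_int b + 1))^2 = 2 * (of_int b + 1)" by (simp only:)
  hence Y: "(y * (of_int b + 1))^2 = of_int (2 * (b + 1))" by simp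
  then obtain Y where "y * (of_int b + 1) = of_int Y" by (rule rat_square_eq_of_int)
  hence "of_int (Y^2) = (of_int (2 * (b + 1)) :: rat)" using Y by simp
  hence Y2: "Y^2 = 2 * (b + 1)" by (simp only: of_int_eq_iff)
  hence "even (Y^2)" by simp
  then obtain M where M: "Y = 2 * M" by auto
  have "b = 2 * \<bar>M\<bar>^2 - 1" using Y2 unfolding M by (simp add: power2_eq_square)
  hence "c = (2 * \<bar>M\<bar>^2 - 1)^2 - 1" using b2 by simp
  moreover have "(2 * x - 1)^2 - 1 = 4 * x * (x - 1)" for x :: int by (simp add: power2_eq_square algebra_simps)
  ultimately have cM: "c = 4 * \<bar>M\<bar>^2 * (\<bar>M\<bar>^2 - 1)" by (simp only:)
  define X where "X = \<bar>M\<bar>"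
  have cX: "c = 4 * X^2 * (X^2 - 1)" and "X \<ge> 0" using cM unfolding X_def by simp_all
  moreover have "X \<noteq> 0" "X \<noteq> 1" using cX c by auto
  ultimately show thesis using that[of X] by simp
qed

lemma irreducible_quad_positive: "c > 0 \<Longrightarrow> irreducible [:1 / rat_of_int c, 0, 1:]"
  by (rule irreducible_quadratic_neg_disc) simp

lemma iter_Suc_0: "iter r (Suc 0) = [:r, 0, 1:]"
  by (simp add: poly_iter_Suc pcompose_idR)

lemma irreducible_iter_positive:
  fixes c :: int
  assumes c: "c > 0" "c \<le> 10^9" and ns: "\<not> (\<exists>m\<ge>2. c = 4 * m^2 * (m^2 - 1))"
  shows "irreducible (iter (1 / of_int c) (Suc n))"
proof -
  let ?r = "1 / of_int c :: rat"
  have "norm_trace_obstructed ?r 0 ?r n' k'" if "n' \<ge> 2" for n' k'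
    unfolding norm_trace_obstructed_def using positive_obstructed[OF c] that by auto
  moreover have "norm_trace_obstructed ?r 0 ?r 0 0"
    unfolding norm_trace_obstructed_def using positive_first_obstruction[OF c(1)] ns by (auto simp: power_divide)
  ultimately have "irreducible ([:?r,0,1:] \<circ>\<^sub>p iter ?r n)"
    using irreducible_quad_positive[OF c(1)] by (intro irreducible_iterates_if_obstructed) simp_all
  thus ?thesis by (simp add: poly_iter_Suc)
qed

definition pair_factor :: "int \<Rightarrow> rat poly" where
  "pair_factor m = [:of_int (2 * m^2 - 1) / of_int (4 * m^2 * (m^2 - 1)), 1 / of_int m, 1:]"

text \<open>A difference of squares: f o f = (x^2 + q)^2 - (x/m)^2 amounts to q^2 = r^2 + r and 2q -
  1/m^2 = 2r, and both hold for this c.\<close>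

lemma pair_split:
  assumes m: "m \<ge> 2" and r: "r = 1 / rat_of_int (4 * m^2 * (m^2 - 1))"
  shows "[:r,0,1:] \<circ>\<^sub>p [:r,0,1:] = pair_factor m * pair_factor (- m)"
proof -
  define x where "x = rat_of_int m"
  have "1 < m * m" using m mult_strict_mono[of 1 m 1 m] by simp
  hence "(1::rat) < of_int (m * m)" by (simp only: of_int_1_less_iff)
  hence x: "x \<noteq> 0" "x^2 - 1 \<noteq> 0" using m by (auto simp: x_def power2_eq_square)
  define k where "k = 4 * x^2 * (x^2 - 1)"
  define q where "q = (2 * x^2 - 1) / k"
  have k: "k \<noteq> 0" using x unfolding k_def by simp
  have r': "r = 1 / k" unfolding r x_def k_def by simp
  have f: "pair_factor m = [:q, 1 / x, 1:]" "pair_factor (- m) = [:q, - (1 / x), 1:]"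
    unfolding pair_factor_def x_def q_def k_def by simp_all
  have "(2 * x^2 - 1) * (2 * x^2 - 1) = 1 + k" unfolding k_def by (simp add: algebra_simps)
  hence 1: "q * q = r * r + r" unfolding q_def r' using k by (simp add: field_simps)
  have "k = (4 * (x^2 - 1)) * (x * x)" unfolding k_def by (simp add: power2_eq_square algebra_simps)
  moreover have "4 * (x^2 - 1) \<noteq> 0" using x by simp
  ultimately have "1 / (x * x) = 4 * (x^2 - 1) / k" by (metis nonzero_divide_mult_cancel_left)
  hence 2: "2 * q - 1 / (x * x) = 2 * r" unfolding q_def r' by (simp add: diff_divide_distrib[symmetric] add_divide_distrib[symmetric])
  have "pair_factor m * pair_factor (- m) = [:q * q, 0, 2 * q - 1 / (x * x), 0, 1:]"
    unfolding f by (simp add: algebra_simps)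
  also have "\<dots> = [:r,0,1:] \<circ>\<^sub>p [:r,0,1:]" unfolding 1 2 by (simp add: pcompose_pCons algebra_simps)
  finally show ?thesis ..
qed

text \<open>Partial fractions give 4q = 1/m^2 + 1/(m^2 - 1), which exceeds the square 1/m^2 of the
  linear coefficient.\<close>

lemma irreducible_pair_factor:
  assumes m: "\<bar>m\<bar> \<ge> 2"
  shows "irreducible (pair_factor m)"
proof -
  define x where "x = rat_of_int m"
  have "2 * 2 \<le> \<bar>m\<bar> * \<bar>m\<bar>" using m by (intro mult_mono) auto
  hence "4 \<le> m * m" by simp
  hence "(4::rat) \<le> of_int (m * m)" by (simp only: of_int_numeral_le_iff)
  hence x: "x^2 \<ge> 4" by (simp add: x_def power2_eq_square)
  have e: "4 * ((2 * y - 1) / (4 * y * (y - 1))) = 1 / y + 1 / (y - 1)" if y: "y \<ge> 4" for y :: rat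
  proof -
    have "y \<noteq> 0" "y - 1 \<noteq> 0" using y by auto
    thus ?thesis by (simp add: field_simps)
  qed
  have "1 / (x^2 - 1) > 0" using x by simp
  hence "(1 / x)^2 < 4 * ((2 * x^2 - 1) / (4 * x^2 * (x^2 - 1)))"
    unfolding e[OF x] by (simp only: power_divide power_one less_add_same_cancel1)
  hence "irreducible [:(2 * x^2 - 1) / (4 * x^2 * (x^2 - 1)), 1 / x, 1:]" by (rule irreducible_quadratic_neg_disc)
  thus ?thesis unfolding pair_factor_def x_def by simp
qed

lemma irreducible_pair_factor_iter:
  assumes m: "- 125 \<le> m \<and> m \<le> - 2 \<or> 3 \<le> m \<and> m \<le> 125" and r: "r = 1 / rat_of_int (4 * m^2 * (m^2 - 1))"
  shows "irreducible (pair_factor m \<circ>\<^sub>p iter r n)"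
proof -
  have "irreducible (pair_factor m)" using m by (intro irreducible_pair_factor) auto
  thus ?thesis unfolding pair_factor_def r
    using pair_obstructed_range[OF m] by (intro irreducible_iterates_if_obstructed)
qed

section \<open>The number of factors in each case\<close>

lemma k_fac_iter: "k_fac c n = nif (iter (1 / of_int c) n)"
  by (simp add: k_fac_def quad_eq)

lemma ge_imp_Suc:
  "n \<ge> 1 \<Longrightarrow> \<exists>k. n = Suc k" "n \<ge> 2 \<Longrightarrow> \<exists>k. n = Suc (Suc k)" "n \<ge> 3 \<Longrightarrow> \<exists>k. n = Suc (Suc (Suc k))"
  by (rule exI[of _ "n - 1"], simp, rule exI[of _ "n - 2"], simp, rule exI[of _ "n - 3"], simp)

lemma k_fac_case1:
  assumes m: "2 \<le> m" "m \<le> 31622" and ns: "\<not> (\<exists>t::int. m + 1 = t^2)" and m4: "m \<noteq> 4" and n: "n \<ge> 1"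
  shows "k_fac (- (m^2)) n = 2"
proof -
  obtain k where k: "n = Suc k" using ge_imp_Suc(1)[OF n] by blast
  let ?r = "1 / rat_of_int (- (m^2))"
  have "irreducible (lin m 1 \<circ>\<^sub>p iter ?r k)" using ns by (intro irreducible_lin_pos[OF m(1) refl]) auto
  moreover have "irreducible (lin m (- 1) \<circ>\<^sub>p iter ?r k)"
    using first_obstructed[OF m m4] even_obstructed[OF m] odd_obstructed[OF m]
    by (intro irreducible_lin_neg[OF m(1) refl]) simp_all
  ultimately show ?thesis
    unfolding k_fac_iter k iter_Suc_factor[OF quad_split[OF m(1) refl]] by (rule nif_2)
qed

text \<open>(x + 1/4) o f = x^2 + 3/16 is irreducible, but its composition with f is (x^2 + 7/16)^2
  - x^2; hence the third factor appears only at n = 3.\<close>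

lemma k_fac_case2:
  shows "k_fac (-16) 1 = 2" "k_fac (-16) 2 = 2" "n \<ge> 3 \<Longrightarrow> k_fac (-16) n = 3"
proof -
  define r where "r = 1 / rat_of_int (- (4^2))"
  have r: "r = - 1 / 16" by (simp add: r_def)
  have m: "(2::int) \<le> 4" by simp
  note f = iter_Suc_factor[OF quad_split[OF m r_def]]
  have c: "k_fac (-16) n = nif (iter r n)" for n unfolding k_fac_iter r by simp
  have sq: "1 * 4 + 1 \<noteq> y^2" for y :: int using square_between_int[of 2 5] by simp
  have i1: "irreducible (lin 4 1 \<circ>\<^sub>p iter r k)" for k
    using sq by (intro irreducible_lin_pos[OF m r_def]) simp_all
  have l0: "irreducible (lin 4 (- 1))" unfolding lin_def[OF m r_def] by (rule irreducible_linear_field_poly) simp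
  have l1: "lin 4 (- 1) \<circ>\<^sub>p [:r,0,1:] = [:3/16,0,1:]" using lin_neg_quad[OF m r_def, of 1] by simp
  have i2: "irreducible [:3/16::rat,0,1:]" by (rule irreducible_quadratic_neg_disc) simp
  have "irreducible [:7/16,1,1::rat:]" "irreducible [:7/16,-1,1::rat:]"
    by (rule irreducible_quadratic_neg_disc; simp)+
  hence i3: "irreducible ([:7/16,1,1:] \<circ>\<^sub>p iter r k)" "irreducible ([:7/16,-1,1:] \<circ>\<^sub>p iter r k)" for k
    unfolding r using minus16_obstructed by (auto intro!: irreducible_iterates_if_obstructed)
  have l2: "[:3/16,0,1:] \<circ>\<^sub>p [:r,0,1:] = [:7/16,1,1:] * [:7/16,-1,1:]"
    unfolding r by (simp add: pcompose_pCons)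
  show "k_fac (-16) 1 = 2" unfolding c One_nat_def f using i1[of 0] l0 by (simp add: nif_2 pcompose_idR)
  have "iter r 2 = (lin 4 1 \<circ>\<^sub>p iter r 1) * (lin 4 (- 1) \<circ>\<^sub>p iter r 1)"
    unfolding numeral_2_eq_2 One_nat_def by (rule f)
  also have "lin 4 (- 1) \<circ>\<^sub>p iter r 1 = [:3/16,0,1:]" unfolding One_nat_def pcompose_iter_1 by (rule l1)
  finally show "k_fac (-16) 2 = 2" unfolding c using nif_2[OF i1 i2] by simp
  assume "n \<ge> 3"
  then obtain k where k: "n = Suc (Suc (Suc k))" using ge_imp_Suc(3) by blast
  have "lin 4 (- 1) \<circ>\<^sub>p iter r (Suc (Suc k)) = [:3/16,0,1:] \<circ>\<^sub>p iter r (Suc k)"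
    unfolding poly_iter_Suc[of "Suc k"] pcompose_assoc l1 ..
  also have "\<dots> = ([:7/16,1,1:] \<circ>\<^sub>p iter r k) * ([:7/16,-1,1:] \<circ>\<^sub>p iter r k)"
    by (rule pcompose_iter_Suc_factor[OF l2])
  finally show "k_fac (-16) n = 3" unfolding c k f[of "Suc (Suc k)"] by (simp only: nif_3 i1 i3)
qed

text \<open>The chain of splittings is f = (x - 1/m)(x + 1/m), then (x - 1/m) o f = (x - s/m)(x +
  s/m) because m + 1 = s^2, and for s = 3, 5, 56 also (x - s/m) o f = (x - y/m)(x + y/m) with s m +
  1 = y^2. All other factors stay irreducible.\<close>

lemma k_fac_root:
  assumes s': "2 \<le> s" "s \<le> 177" and c: "c = - ((s^2 - 1)^2)"
  shows "k_fac c 1 = 2" "k_fac c 2 = 3"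
    "s \<notin> {3, 5, 56} \<Longrightarrow> n \<ge> 2 \<Longrightarrow> k_fac c n = 3"
    "s \<in> {3, 5, 56} \<Longrightarrow> n \<ge> 3 \<Longrightarrow> k_fac c n = 4"
proof -
  have s: "2 \<le> s" "s \<le> 178" using s' by simp_all
  define m where "m = s^2 - 1"
  define r where "r = 1 / rat_of_int (- (m^2))"
  have "2 * 2 \<le> s * s" using s by (intro mult_mono) auto
  hence m3: "m \<ge> 3" unfolding m_def by (simp add: power2_eq_square)
  hence m: "m \<ge> 2" by simp
  have "s * s \<le> 177 * 177" using s' by (intro mult_mono) auto
  hence m_le: "m \<le> 31622" unfolding m_def by (simp add: power2_eq_square)
  have kf: "k_fac c n = nif (iter r n)" for n unfolding k_fac_iter c m_def[symmetric] r_def ..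
  note f = iter_Suc_factor[OF quad_split[OF m r_def]]
  have s1: "lin m 1 \<circ>\<^sub>p [:r,0,1:] = lin m s * lin m (- s)"
    by (rule lin_split[OF m r_def]) (simp add: m_def)
  have lin0: "irreducible (lin m t)" for t unfolding lin_def[OF m r_def] by (rule irreducible_linear_field_poly) simp
  have i1: "irreducible (lin m (- s) \<circ>\<^sub>p iter r n)" for n
    using root_obstructed[OF s] s unfolding m_def[symmetric] by (intro irreducible_lin_neg[OF m r_def]) simp_all
  have neg1: "irreducible (lin m (- 1) \<circ>\<^sub>p iter r n)" for n
  proof -
    have "m \<noteq> 4"
    proof
      assume "m = 4"
      hence "5 = s^2" unfolding m_def by simp
      thus False using square_between_int[of 2 5 s] by simp
    qed
    thus ?thesis using first_obstructed[OF m m_le] even_obstructed[OF m m_le] odd_obstructed[OF m m_le]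
      by (intro irreducible_lin_neg[OF m r_def]) simp_all
  qed
  show "k_fac c 1 = 2" unfolding kf One_nat_def f using lin0 by (simp add: nif_2 pcompose_idR)
  have e2: "iter r (Suc (Suc k)) = (lin m (- 1) \<circ>\<^sub>p iter r (Suc k)) * ((lin m s \<circ>\<^sub>p iter r k) * (lin m (- s) \<circ>\<^sub>p iter r k))" for k
    unfolding f[of "Suc k"] pcompose_iter_Suc_factor[OF s1] by (rule mult.commute)
  show "k_fac c 2 = 3" unfolding kf numeral_2_eq_2 e2 using lin0 neg1[of "Suc 0"]
    by (intro nif_3) (simp_all add: pcompose_idR)
  show "k_fac c n = 3" if s3: "s \<notin> {3, 5, 56}" and n2: "n \<ge> 2"
  proof -
    obtain k where k: "n = Suc (Suc k)" using ge_imp_Suc(2)[OF n2] by blast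
    have "irreducible (lin m s \<circ>\<^sub>p iter r k)"
      using s cube_nonsquare[OF s s3] unfolding m_def[symmetric] by (intro irreducible_lin_pos[OF m r_def]) simp_all
    thus ?thesis unfolding kf k e2 using i1 neg1 by (intro nif_3)
  qed
  show "k_fac c n = 4" if s4: "s \<in> {3, 5, 56}" and n3: "n \<ge> 3"
  proof -
    obtain k where k: "n = Suc (Suc (Suc k))" using ge_imp_Suc(3)[OF n3] by blast
    obtain y where y: "s * m + 1 = y^2" "(y, m) \<in> {(5, 8), (11, 24), (419, 3135)}"
      using s4 by (elim insertE emptyE) (auto simp: m_def)
    \<comment> \<open>The chain stops here, as y m + 1 lies strictly between consecutive
      squares.\<close>
    have ns: "y * m + 1 \<noteq> x^2" for x
    proof -
      consider "y * m + 1 = 41" | "y * m + 1 = 265" | "y * m + 1 = 1313566" using y(2) by auto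
      thus ?thesis using square_between_int[of 6 41 x] square_between_int[of 16 265 x] square_between_int[of 1146 1313566 x]
        by cases simp_all
    qed
    have y1: "y \<ge> 1" using y(2) by auto
    have "irreducible (lin m y \<circ>\<^sub>p iter r k)" using ns y1 by (intro irreducible_lin_pos[OF m r_def])
    moreover have "irreducible (lin m (- y) \<circ>\<^sub>p iter r k)"
      using iterated_root_obstructed[OF y(2)] y1 by (intro irreducible_lin_neg[OF m r_def])
    moreover have "lin m s \<circ>\<^sub>p iter r (Suc k) = (lin m y \<circ>\<^sub>p iter r k) * (lin m (- y) \<circ>\<^sub>p iter r k)"
      by (rule pcompose_iter_Suc_factor[OF lin_split[OF m r_def y(1)]])
    moreover have "X * ((A * B) * C) = X * (C * (A * B))" for X A B C :: "rat poly" by (simp only: mult_ac)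
    ultimately show ?thesis
      unfolding kf k e2[of "Suc k"] using nif_4[OF neg1 i1] by (simp only:)
  qed
qed

lemma k_fac_case5:
  assumes m: "3 \<le> m" "m \<le> 125" and c: "c = 4 * m^2 * (m^2 - 1)"
  shows "k_fac c 1 = 1" "n \<ge> 2 \<Longrightarrow> k_fac c n = 2"
proof -
  define r where "r = 1 / rat_of_int (4 * m^2 * (m^2 - 1))"
  have m2: "m \<ge> 2" using m by simp
  have kf: "k_fac c n = nif (iter r n)" for n unfolding k_fac_iter c r_def ..
  have "3 * 3 \<le> m * m" using m by (intro mult_mono) auto
  hence c0: "4 * m^2 * (m^2 - 1) > 0" by (simp add: power2_eq_square)
  have "irreducible [:r, 0, 1:]" unfolding r_def by (rule irreducible_quad_positive[OF c0])
  thus "k_fac c 1 = 1" unfolding kf One_nat_def iter_Suc_0 by (rule nif_1[unfolded One_nat_def])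
  assume "n \<ge> 2"
  then obtain k where k: "n = Suc (Suc k)" using ge_imp_Suc(2) by blast
  have "iter r n = (pair_factor m \<circ>\<^sub>p iter r k) * (pair_factor (- m) \<circ>\<^sub>p iter r k)"
    unfolding k poly_iter_Suc[of "Suc k"] by (rule pcompose_iter_Suc_factor[OF pair_split[OF m2 r_def]])
  moreover have "irreducible (pair_factor m \<circ>\<^sub>p iter r k)"
    using m by (intro irreducible_pair_factor_iter) (simp_all add: r_def)
  moreover have "irreducible (pair_factor (- m) \<circ>\<^sub>p iter r k)"
    using m by (intro irreducible_pair_factor_iter) (simp_all add: r_def)
  ultimately show "k_fac c n = 2" unfolding kf by (simp only: nif_2)
qed

text \<open>This is c = 4 m^2 (m^2 - 1) with m = 2, where one of the two quadratic factors splits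
  again: (x^2 + x/2 + 7/48) o f = (x^2 + 19/48)^2 - (x/2)^2.\<close>

lemma k_fac_case6:
  shows "k_fac 48 1 = 1" "k_fac 48 2 = 2" "n \<ge> 3 \<Longrightarrow> k_fac 48 n = 3"
proof -
  define r where "r = 1 / rat_of_int (4 * 2^2 * (2^2 - 1))"
  have r48: "r = 1 / 48" unfolding r_def by simp
  have kf: "k_fac 48 n = nif (iter r n)" for n unfolding k_fac_iter r48 by simp
  note sp = pair_split[OF order_refl r_def]
  have s2: "iter r (Suc (Suc k)) = (pair_factor 2 \<circ>\<^sub>p iter r k) * (pair_factor (- 2) \<circ>\<^sub>p iter r k)" for k
    unfolding poly_iter_Suc[of "Suc k"] by (rule pcompose_iter_Suc_factor[OF sp])
  have i2: "irreducible (pair_factor (- 2) \<circ>\<^sub>p iter r k)" for k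
    by (rule irreducible_pair_factor_iter) (simp_all add: r_def)
  have p2: "irreducible (pair_factor 2)" "irreducible (pair_factor (- 2))" by (rule irreducible_pair_factor; simp)+
  have s3: "pair_factor 2 \<circ>\<^sub>p [:r,0,1:] = [:19/48,1/2,1:] * [:19/48,-1/2,1:]"
    unfolding pair_factor_def r48 by (simp add: pcompose_pCons)
  have "irreducible [:19/48,1/2,1::rat:]" "irreducible [:19/48,-1/2,1::rat:]"
    by (rule irreducible_quadratic_neg_disc; simp add: power2_eq_square)+
  hence i3: "irreducible ([:19/48,1/2,1:] \<circ>\<^sub>p iter r k)" "irreducible ([:19/48,-1/2,1:] \<circ>\<^sub>p iter r k)" for k
    unfolding r48 using fortyeight_obstructed by (auto intro!: irreducible_iterates_if_obstructed)
  show "k_fac 48 1 = 1" 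
    unfolding kf One_nat_def iter_Suc_0 r_def
    by (rule nif_1[OF irreducible_quad_positive, unfolded One_nat_def]) simp
  show "k_fac 48 2 = 2" unfolding kf numeral_2_eq_2 s2 using p2 by (simp add: nif_2 pcompose_idR)
  assume "n \<ge> 3"
  then obtain k where k: "n = Suc (Suc (Suc k))" using ge_imp_Suc(3) by blast
  have "iter r n = (pair_factor (- 2) \<circ>\<^sub>p iter r (Suc k)) * (([:19/48,1/2,1:] \<circ>\<^sub>p iter r k) * ([:19/48,-1/2,1:] \<circ>\<^sub>p iter r k))"
    unfolding k s2[of "Suc k"] pcompose_iter_Suc_factor[OF s3] by (rule mult.commute)
  thus "k_fac 48 n = 3" unfolding kf by (simp only: nif_3 i2 i3)
qed

lemma k_fac_case7:
  assumes c: "c \<notin> {0, -1}" "\<bar>c\<bar> \<le> 10^9"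
    and no: "\<not> (case1 c \<or> case2 c \<or> case3 c \<or> case4 c \<or> case5 c \<or> case6 c)" and n: "n \<ge> 1"
  shows "k_fac c n = 1"
proof -
  obtain k where k: "n = Suc k" using ge_imp_Suc(1)[OF n] by blast
  have "irreducible (iter (1 / of_int c) n)"
  proof (cases "c > 0")
    case True
    have "\<not> (\<exists>m\<ge>2. c = 4 * m^2 * (m^2 - 1))"
    proof
      assume "\<exists>m\<ge>2. c = 4 * m^2 * (m^2 - 1)"
      then obtain m where m: "m \<ge> 2" "c = 4 * m^2 * (m^2 - 1)" by blast
      show False
      proof (cases "m = 2")
        case True thus False using m no by (simp add: case6_def)
      next
        case False
        hence "case5 c" using m unfolding case5_def by (intro exI[of _ m]) simp
        thus False using no by simp
      qed
    qed
    thus ?thesis unfolding k using True c by (intro irreducible_iter_positive) auto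
  next
    case False
    hence c1: "c < - 1" using c by auto
    have "\<nexists>m. c = - (m^2)"
    proof
      assume "\<exists>m. c = - (m^2)"
      then obtain m0 where "c = - (m0^2)" by blast
      then obtain m where m: "c = - (m^2)" "m \<ge> 0" by (metis power2_abs abs_ge_zero)
      have "m \<noteq> 0" "m \<noteq> 1" using m c1 by auto
      hence m2: "m \<ge> 2" using m by simp
      show False
      proof (cases "\<exists>t. m + 1 = t^2")
        case False
        show False
        proof (cases "m = 4")
          case True thus False using m no by (simp add: case2_def)
        next
          case m4: False
          hence "case1 c" using False m m2 unfolding case1_def by (intro exI[of _ m]) auto
          thus False using no by simp
        qed
      next
        case True
        then obtain t where "m + 1 = t^2" by blast
        then obtain s where s: "m + 1 = s^2" "s \<ge> 0" by (metis power2_abs abs_ge_zero)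
        have "s \<noteq> 0" "s \<noteq> 1" using s m2 by auto
        hence s2: "s \<ge> 2" using s by simp
        have cs: "c = - ((s^2 - 1)^2)" using m s(1) by (simp add: algebra_simps flip: s(1))
        show False
        proof (cases "s \<in> {3, 5, 56}")
          case True
          hence "case4 c" using cs unfolding case4_def by blast
          thus False using no by simp
        next
          case False
          hence "case3 c" using cs s2 unfolding case3_def by blast
          thus False using no by simp
        qed
      qed
    qed
    thus ?thesis by (rule irreducible_iter_negative_nonsquare[OF c1])
  qed
  thus ?thesis unfolding k_fac_iter by (rule nif_1)
qed

lemma abs_le_of_square_le:
  fixes m b :: int
  assumes "m^2 < (b + 1)^2" "b \<ge> 0"
  shows "m \<le> b"
proof -
  have "m < b + 1" using power_less_imp_less_base[of m 2 "b + 1"] assms by simp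
  thus ?thesis by simp
qed

theorem theorem1p1:
  fixes c :: int
  assumes "c \<notin> {0, -1}" and "\<bar>c\<bar> \<le> 10 ^ 9"
  shows "eventually_stable (quad (1 / of_int c))
    \<and> (\<forall>n\<ge>1. k_fac c n \<le> 4)
    \<and> (case1 c \<longrightarrow> (\<forall>n\<ge>1. k_fac c n = 2))
    \<and> (case2 c \<longrightarrow> k_fac c 1 = 2 \<and> k_fac c 2 = 2 \<and> (\<forall>n\<ge>3. k_fac c n = 3))
    \<and> (case3 c \<longrightarrow> k_fac c 1 = 2 \<and> (\<forall>n\<ge>2. k_fac c n = 3))
    \<and> (case4 c \<longrightarrow> k_fac c 1 = 2 \<and> k_fac c 2 = 3 \<and> (\<forall>n\<ge>3. k_fac c n = 4))
    \<and> (case5 c \<longrightarrow> k_fac c 1 = 1 \<and> (\<forall>n\<ge>2. k_fac c n = 2))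
    \<and> (case6 c \<longrightarrow> k_fac c 1 = 1 \<and> k_fac c 2 = 2 \<and> (\<forall>n\<ge>3. k_fac c n = 3))
    \<and> (\<not> (case1 c \<or> case2 c \<or> case3 c \<or> case4 c \<or> case5 c \<or> case6 c)
         \<longrightarrow> (\<forall>n\<ge>1. k_fac c n = 1))"
proof -
  \<comment> \<open>31622 is the integer part of the square root of 10^9.\<close>
  have sq_le: "m \<le> 31622" if "c = - (m^2)" for m
  proof (rule abs_le_of_square_le)
    have "m^2 \<le> 10^9" using that assms(2) by simp
    also have "(10::int)^9 < (31622 + 1)^2" by simp
    finally show "m^2 < (31622 + 1)^2" .
  qed simp
  have s_le: "s \<le> 177" if "c = - ((s^2 - 1)^2)" for s
  proof (rule abs_le_of_square_le)
    have "s^2 - 1 \<le> 31622" using sq_le that by blast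
    thus "s^2 < (177 + 1)^2" by simp
  qed simp
  \<comment> \<open>4 126^2 (126^2 - 1) is just above 10^9.\<close>
  have m_le: "m \<le> 125" if "c = 4 * m^2 * (m^2 - 1)" "m \<ge> 3" for m
  proof (rule ccontr)
    assume "\<not> m \<le> 125"
    hence "126 * 126 \<le> m * m" by (intro mult_mono) auto
    hence m2: "15876 \<le> m^2" by (simp add: power2_eq_square)
    hence "15876 * 15875 \<le> m^2 * (m^2 - 1)" by (intro mult_mono) auto
    thus False using that(1) assms(2) by simp
  qed
  have 1: "\<forall>n\<ge>1. k_fac c n = 2" if c1: "case1 c"
  proof -
    obtain m where m: "m > 0" "\<not> (\<exists>t. m + 1 = t^2)" "m \<noteq> 4" "c = - (m^2)"
      using c1 unfolding case1_def by blast
    have "m \<noteq> 1" using m(4) assms(1) by auto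
    thus ?thesis using k_fac_case1[OF _ sq_le[OF m(4)] m(2,3)] m(1,4) by simp
  qed
  have 2: "k_fac c 1 = 2 \<and> k_fac c 2 = 2 \<and> (\<forall>n\<ge>3. k_fac c n = 3)" if c2: "case2 c"
    using c2 k_fac_case2 unfolding case2_def by blast
  have 3: "k_fac c 1 = 2 \<and> (\<forall>n\<ge>2. k_fac c n = 3)" if c3: "case3 c"
  proof -
    obtain s where s: "s \<ge> 2" "s \<notin> {3, 5, 56}" "c = - ((s^2 - 1)^2)" using c3 unfolding case3_def by blast
    show ?thesis using k_fac_root(1,3)[OF s(1) s_le[OF s(3)] s(3)] s(2) by blast
  qed
  have 4: "k_fac c 1 = 2 \<and> k_fac c 2 = 3 \<and> (\<forall>n\<ge>3. k_fac c n = 4)" if c4: "case4 c"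
  proof -
    obtain s where s: "s \<in> {3, 5, 56}" "c = - ((s^2 - 1)^2)" using c4 unfolding case4_def by blast
    have "s \<ge> 2" using s(1) by auto
    show ?thesis using k_fac_root(1,2,4)[OF \<open>s \<ge> 2\<close> s_le[OF s(2)] s(2)] s(1) by blast
  qed
  have 5: "k_fac c 1 = 1 \<and> (\<forall>n\<ge>2. k_fac c n = 2)" if c5: "case5 c"
  proof -
    obtain m where m: "m \<ge> 3" "c = 4 * m^2 * (m^2 - 1)" using c5 unfolding case5_def by blast
    show ?thesis using k_fac_case5[OF m(1) m_le[OF m(2,1)] m(2)] by blast
  qed
  have 6: "k_fac c 1 = 1 \<and> k_fac c 2 = 2 \<and> (\<forall>n\<ge>3. k_fac c n = 3)" if c6: "case6 c"
    using c6 k_fac_case6 unfolding case6_def by blast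
  have 7: "\<forall>n\<ge>1. k_fac c n = 1" if "\<not> (case1 c \<or> case2 c \<or> case3 c \<or> case4 c \<or> case5 c \<or> case6 c)"
    using k_fac_case7[OF assms that] by blast
  have le4: "k_fac c n \<le> 4" if n: "n \<ge> 1" for n
  proof -
    have nn: "n = 1 \<or> n = 2 \<or> n \<ge> 3" using n by linarith
    consider "case1 c" | "case2 c" | "case3 c" | "case4 c" | "case5 c" | "case6 c"
      | "\<not> (case1 c \<or> case2 c \<or> case3 c \<or> case4 c \<or> case5 c \<or> case6 c)" by blast
    thus ?thesis
    proof cases
      case a: 1 show ?thesis using 1[OF a] n by simp
    next
      case a: 2 from nn show ?thesis using 2[OF a] by auto
    next
      case a: 3 from nn show ?thesis using 3[OF a] by auto
    next
      case a: 4 from nn show ?thesis using 4[OF a] by auto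
    next
      case a: 5 from nn show ?thesis using 5[OF a] by auto
    next
      case a: 6 from nn show ?thesis using 6[OF a] by auto
    next
      case a: 7 show ?thesis using 7[OF a] n by simp
    qed
  qed
  have "eventually_stable (quad (1 / of_int c))"
    unfolding eventually_stable_def using le4 unfolding k_fac_def by blast
  thus ?thesis using le4 1 2 3 4 5 6 7 by blast
qed

end
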